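(* Let $q=p^f\geq 4$ be a prime power and let $\mathcal D$ be a $4$-$(q+1,k,\lambda)$ design with $\lambda>10$ and $q+1>k>4$. Suppose the simple group $G=PSL(2,q)$ acts on the $q+1$ points of $\mathcal D$ as a flag-transitive group of automorphisms of $\mathcal D$, and let $G_B$ be the setwise stabilizer of a block $B$. Suppose $G_B$ is isomorphic to $A_4$, $S_4$, $A_5$, $PGL(2,q_0)$ (with $g>1$ even) or $PSL(2,q_0)$, where $q_0^g=q$. Then no such design exists.
   Context: A $t$-$(v,k,\lambda)$ design consists of a set of $v$ points and a set of $k$-element subsets (blocks) such that every $t$-subset of points lies in exactly $\lambda$ blocks. A group of automorphisms is flag-transitive if it acts transitively on incident point-block pairs (flags). *)

theory Defs
  imports
    "HOL-Algebra.Sym_Groups"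
    "HOL-Algebra.Group_Action"
    "HOL-Analysis.Determinants"
    "HOL-Computational_Algebra.Primes"
begin

definition t_design :: "nat \<Rightarrow> nat \<Rightarrow> nat \<Rightarrow> nat \<Rightarrow> 'p set \<Rightarrow> 'p set set \<Rightarrow> bool" where
  "t_design t v k l P \<B> \<longleftrightarrow>
     finite P \<and> card P = v \<and>
     (\<forall>B\<in>\<B>. B \<subseteq> P \<and> card B = k) \<and>
     (\<forall>T. T \<subseteq> P \<and> card T = t \<longrightarrow> card {B \<in> \<B>. T \<subseteq> B} = l)"

definition acts_by_automorphisms ::
    "('g, 'm) monoid_scheme \<Rightarrow> 'p set \<Rightarrow> 'p set set \<Rightarrow> ('g \<Rightarrow> 'p \<Rightarrow> 'p) \<Rightarrow> bool" where
  "acts_by_automorphisms G P \<B> \<phi> \<longleftrightarrow>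
     group_action G P \<phi> \<and> (\<forall>g \<in> carrier G. (\<lambda>B. \<phi> g ` B) ` \<B> = \<B>)"

definition flags :: "'p set set \<Rightarrow> ('p \<times> 'p set) set" where
  "flags \<B> = {(x, B). B \<in> \<B> \<and> x \<in> B}"

definition flag_transitive ::
    "('g, 'm) monoid_scheme \<Rightarrow> 'p set set \<Rightarrow> ('g \<Rightarrow> 'p \<Rightarrow> 'p) \<Rightarrow> bool" where
  "flag_transitive G \<B> \<phi> \<longleftrightarrow>
     (\<forall>(x, B) \<in> flags \<B>. \<forall>(y, C) \<in> flags \<B>. \<exists>g \<in> carrier G. \<phi> g x = y \<and> \<phi> g ` B = C)"

definition setwise_stabilizer ::
    "('g, 'm) monoid_scheme \<Rightarrow> ('g \<Rightarrow> 'p \<Rightarrow> 'p) \<Rightarrow> 'p set \<Rightarrow> ('g, 'm) monoid_scheme" where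
  "setwise_stabilizer G \<phi> B = G\<lparr>carrier := stabilizer G (\<lambda>g. image (\<phi> g)) B\<rparr>"

(* The field is the type 'a; for finite 'a these are the groups over the field with CARD('a)
   elements. The range of mat is the set of scalar matrices. *)

definition GL2 :: "('a::field ^ 2 ^ 2) monoid" where
  "GL2 = \<lparr>carrier = {A. det A \<noteq> 0}, mult = (**), one = mat 1\<rparr>"

definition SL2 :: "('a::field ^ 2 ^ 2) monoid" where
  "SL2 = \<lparr>carrier = {A. det A = 1}, mult = (**), one = mat 1\<rparr>"

definition PGL2 :: "('a::field ^ 2 ^ 2) set monoid" where
  "PGL2 = GL2 Mod (carrier GL2 \<inter> range mat)"

definition PSL2 :: "('a::field ^ 2 ^ 2) set monoid" where
  "PSL2 = SL2 Mod (carrier SL2 \<inter> range mat)"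

lemma group_GL2: "group (GL2 :: ('a::field ^ 2 ^ 2) monoid)"
proof (rule groupI)
  fix A :: "'a ^ 2 ^ 2" assume "A \<in> carrier GL2"
  then obtain B where B: "A ** B = mat 1" "B ** A = mat 1"
    by (auto simp: GL2_def invertible_det_nz[symmetric] invertible_def)
  then have "invertible B"
    by (auto simp: invertible_def)
  with B show "\<exists>B \<in> carrier GL2. B \<otimes>\<^bsub>GL2\<^esub> A = \<one>\<^bsub>GL2\<^esub>"
    by (auto simp: GL2_def invertible_det_nz)
qed (auto simp: GL2_def det_mul matrix_mul_assoc)

lemma group_SL2: "group (SL2 :: ('a::field ^ 2 ^ 2) monoid)"
proof (rule groupI)
  fix A :: "'a ^ 2 ^ 2" assume A: "A \<in> carrier SL2"
  then have "invertible A"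
    by (simp add: SL2_def invertible_det_nz)
  then obtain B where B: "B ** A = mat 1"
    by (auto simp: invertible_def)
  then have "det B * det A = 1"
    by (metis det_mul det_I)
  with A B show "\<exists>B \<in> carrier SL2. B \<otimes>\<^bsub>SL2\<^esub> A = \<one>\<^bsub>SL2\<^esub>"
    by (auto simp: SL2_def)
qed (auto simp: SL2_def det_mul matrix_mul_assoc)

lemma mat_mult_mat: "mat a ** mat b = (mat (a * b) :: 'a::field ^ 2 ^ 2)"
  by (simp add: vec_eq_iff matrix_matrix_mult_def mat_def sum_2 forall_2)

lemma mat_mult_commute: "mat c ** A = A ** (mat c :: 'a::field ^ 2 ^ 2)"
  by (simp add: vec_eq_iff matrix_matrix_mult_def mat_def if_distrib if_distribR
      mult.commute cong: if_cong)

lemma det_mat2: "det (mat c :: 'a::field ^ 2 ^ 2) = c * c"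
  by (simp add: det_2 mat_def)

lemma scalars_normal_GL2: "carrier GL2 \<inter> range mat \<lhd> (GL2 :: ('a::field ^ 2 ^ 2) monoid)"
proof -
  interpret group "GL2 :: ('a ^ 2 ^ 2) monoid" by (rule group_GL2)
  have "subgroup (carrier GL2 \<inter> range mat) (GL2 :: ('a ^ 2 ^ 2) monoid)"
  proof (rule subgroupI)
    have "(mat 1 :: 'a ^ 2 ^ 2) \<in> carrier GL2 \<inter> range mat"
      by (simp add: GL2_def)
    then show "carrier GL2 \<inter> range mat \<noteq> ({} :: ('a ^ 2 ^ 2) set)"
      by blast
  next
    fix A :: "'a ^ 2 ^ 2" assume A: "A \<in> carrier GL2 \<inter> range mat"
    then obtain c where c: "A = mat c" "c \<noteq> 0" by (auto simp: GL2_def det_mat2)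
    have m: "mat (inverse c) \<in> carrier (GL2 :: ('a ^ 2 ^ 2) monoid)"
      using c by (simp add: GL2_def det_mat2)
    have "mat (inverse c) \<otimes>\<^bsub>GL2\<^esub> A = \<one>\<^bsub>GL2\<^esub>"
      using c by (simp add: GL2_def mat_mult_mat)
    with m A have "inv\<^bsub>GL2\<^esub> A = mat (inverse c)"
      by (intro inv_equality) auto
    then show "inv\<^bsub>GL2\<^esub> A \<in> carrier GL2 \<inter> range mat" using m by auto
  qed (auto simp: GL2_def det_mul mat_mult_mat)
  then show ?thesis
    by (rule normalI) (auto simp: r_coset_def l_coset_def GL2_def mat_mult_commute)
qed

lemma scalars_normal_SL2: "carrier SL2 \<inter> range mat \<lhd> (SL2 :: ('a::field ^ 2 ^ 2) monoid)"
proof -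
  interpret group "SL2 :: ('a ^ 2 ^ 2) monoid" by (rule group_SL2)
  have "subgroup (carrier SL2 \<inter> range mat) (SL2 :: ('a ^ 2 ^ 2) monoid)"
  proof (rule subgroupI)
    have "(mat 1 :: 'a ^ 2 ^ 2) \<in> carrier SL2 \<inter> range mat"
      by (simp add: SL2_def)
    then show "carrier SL2 \<inter> range mat \<noteq> ({} :: ('a ^ 2 ^ 2) set)"
      by blast
  next
    fix A :: "'a ^ 2 ^ 2" assume A: "A \<in> carrier SL2 \<inter> range mat"
    then obtain c where c: "A = mat c" "c * c = 1" by (auto simp: SL2_def det_mat2)
    then have "A \<otimes>\<^bsub>SL2\<^esub> A = \<one>\<^bsub>SL2\<^esub>"
      by (simp add: SL2_def mat_mult_mat)
    with A have "inv\<^bsub>SL2\<^esub> A = A"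
      by (intro inv_equality) auto
    then show "inv\<^bsub>SL2\<^esub> A \<in> carrier SL2 \<inter> range mat" using A by auto
  qed (auto simp: SL2_def det_mul mat_mult_mat)
  then show ?thesis
    by (rule normalI) (auto simp: r_coset_def l_coset_def SL2_def mat_mult_commute)
qed

lemma group_PGL2: "group (PGL2 :: ('a::field ^ 2 ^ 2) set monoid)"
  unfolding PGL2_def by (rule normal.factorgroup_is_group[OF scalars_normal_GL2])

lemma group_PSL2: "group (PSL2 :: ('a::field ^ 2 ^ 2) set monoid)"
  unfolding PSL2_def by (rule normal.factorgroup_is_group[OF scalars_normal_SL2])

end

theory Submission
  imports Defs "HOL-Number_Theory.Residues"
begin

text \<open>
  Let \<open>H\<close> be the stabilizer of a block and \<open>m\<close> the order of the stabilizer in \<open>H\<close> of a point of the block.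
  Double counting gives \<open>k m = |H|\<close> and \<open>(k - 1) (k - 2) (k - 3) = l d (q - 2) m\<close> with
  \<open>d = gcd(2, q - 1)\<close>, and the action on the points is that on the projective line.

  For \<open>H = A\<^sub>4, S\<^sub>4, A\<^sub>5\<close> this leaves finitely many \<open>(k, q)\<close>.  If \<open>l\<close> is odd, a Klein four-group fixes
  a block through each of its regular orbits, and counting Klein four-groups bounds \<open>q\<close>.  In the remaining
  cases \<open>k = q - 1\<close>, where the elements of order 3 fix the two points outside the block and hence commute,
  or orders of elements and point stabilizers do not fit.

  For \<open>H = PSL(2, Q), PGL(2, Q)\<close> with \<open>q = Q\<^sup>g\<close>, either \<open>k \<le> Q + 1\<close>, which is too small, or the point
  stabilizer in \<open>H\<close> is trivial or nearly a full nonsplit torus.  So \<open>k\<close> is one of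
  a few polynomials in \<open>Q\<close>, and \<open>Q\<^sup>g - 2\<close> does not divide \<open>(k - 1) (k - 2) (k - 3)\<close> with a large enough quotient.
\<close>

section \<open>Diophantine equations\<close>

text \<open>Only the isomorphism type of the block stabilizer is given, not how it sits in
  \<open>PSL2\<close>, and no list of subgroups of \<open>PSL2\<close> is quoted. What is needed of
  the embedding is recovered from fixed points: a nontrivial element fixes at most two points, a
  nontrivial element of \<open>p\<close>-power order at most one, and elements with two common fixed
  points commute. For the subfield groups this suffices because \<open>Q\<close> is a power of
  \<open>p\<close>: each of the \<open>Q + 1\<close> transvection groups over the small field
  singles out one point of the design. The hypothesis \<open>l > 10\<close> sits at the edge:
  \<open>Q = 2\<close>, \<open>g = 3\<close>, \<open>k = 6\<close> solves the equation with quotient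
  exactly 10. Size alone does not decide the equation while \<open>g\<close> is small; hence a
  division with remainder for each small exponent. For A4, S4 and A5 divisibility alone admits
  values such as \<open>k = 12\<close>, \<open>q = 47\<close>, \<open>l = 11\<close>. The parity of
  \<open>l\<close> is not an assumption there: for odd \<open>q\<close> the number
  \<open>l * (q - 2)\<close> turns out to be odd in the cases that remain.\<close>

lemma horner_sum_bound:
  fixes Q M :: int
  assumes "Q > 1" and "\<forall>x\<in>set cs. \<bar>x\<bar> \<le> M" and "M \<ge> 0"
  shows "(Q - 1) * \<bar>horner_sum (\<lambda>x. x) Q cs\<bar> \<le> M * (Q ^ length cs - 1)"
  using assms(2)
proof (induction cs)
  case (Cons a cs)
  have "\<bar>horner_sum (\<lambda>x. x) Q (a # cs)\<bar> \<le> \<bar>a\<bar> + Q * \<bar>horner_sum (\<lambda>x. x) Q cs\<bar>"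
    using \<open>Q > 1\<close> by (simp add: abs_mult order.trans[OF abs_triangle_ineq])
  then have "(Q - 1) * \<bar>horner_sum (\<lambda>x. x) Q (a # cs)\<bar> \<le> (Q - 1) * \<bar>a\<bar> + Q * ((Q - 1) * \<bar>horner_sum (\<lambda>x. x) Q cs\<bar>)"
    using mult_left_mono[of "\<bar>horner_sum (\<lambda>x. x) Q (a # cs)\<bar>" "\<bar>a\<bar> + Q * \<bar>horner_sum (\<lambda>x. x) Q cs\<bar>" "Q - 1"] \<open>Q > 1\<close>
    by (simp add: algebra_simps)
  also have "\<dots> \<le> (Q - 1) * M + Q * (M * (Q ^ length cs - 1))"
    using Cons \<open>Q > 1\<close> by (intro add_mono mult_left_mono) auto
  also have "\<dots> = M * (Q ^ length (a # cs) - 1)"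
    by (simp add: algebra_simps)
  finally show ?case .
qed simp

text \<open>Modulo \<open>Q\<close> only the lowest digit counts, and a nonzero digit smaller than
  \<open>Q\<close> in absolute value is not divisible by \<open>Q\<close>; zero digits are stripped
  first.\<close>

lemma horner_sum_neq_0:
  fixes Q M :: int
  assumes "Q > M" and "\<forall>x\<in>set cs. \<bar>x\<bar> \<le> M" and "\<exists>x\<in>set cs. x \<noteq> 0"
  shows "horner_sum (\<lambda>x. x) Q cs \<noteq> 0"
  using assms(2,3)
proof (induction cs)
  case (Cons a cs)
  show ?case
  proof (cases "a = 0")
    case True
    then have "horner_sum (\<lambda>x. x) Q cs \<noteq> 0" using Cons by auto
    moreover have "Q \<noteq> 0" using Cons.prems(1) assms(1) by auto
    ultimately show ?thesis using True by (metis add_0 horner_sum_simps(2) mult_eq_0_iff)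
  next
    case False
    then have "\<not> Q dvd a" using Cons.prems assms(1) dvd_imp_le_int[of a Q] by auto
    then show ?thesis
      by (metis dvd_0_right dvd_add_left_iff dvd_triv_left horner_sum_simps(2))
  qed
qed simp

text \<open>A nonzero multiple of \<open>Q ^ g - 2\<close> is at least that large. After
  multiplication by \<open>Q - 1\<close> the geometric series bounds the sum by
  \<open>M * (Q ^ g - 1)\<close>, while \<open>Q - 1\<close> already exceeds
  \<open>M\<close>.\<close>

lemma not_dvd_horner_sum:
  fixes Q M :: int
  assumes "Q > M + 1" and "\<forall>x\<in>set cs. \<bar>x\<bar> \<le> M" and "\<exists>x\<in>set cs. x \<noteq> 0"
    and "length cs \<le> g" and "g \<ge> 2"
  shows "\<not> Q ^ g - 2 dvd horner_sum (\<lambda>x. x) Q cs"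
proof
  assume dvd: "Q ^ g - 2 dvd horner_sum (\<lambda>x. x) Q cs"
  have "M > 0" using assms(2,3) by force
  have "horner_sum (\<lambda>x. x) Q cs \<noteq> 0" using assms by (intro horner_sum_neq_0) auto
  then have le: "\<bar>Q ^ g - 2\<bar> \<le> \<bar>horner_sum (\<lambda>x. x) Q cs\<bar>"
    using dvd by (rule dvd_imp_le_int)
  have "Q ^ length cs \<le> Q ^ g" using assms \<open>M > 0\<close> by (intro power_increasing) auto
  have "Q ^ 2 \<le> Q ^ g" using assms \<open>M > 0\<close> by (intro power_increasing) auto
  moreover have "Q * 2 \<le> Q * Q" using assms \<open>M > 0\<close> by (intro mult_left_mono) auto
  ultimately have big: "Q ^ g \<ge> 2 * Q" by (simp add: power2_eq_square)
  have "(M + 1) * (Q ^ g - 2) \<le> (Q - 1) * \<bar>horner_sum (\<lambda>x. x) Q cs\<bar>"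
    using le assms(1) big \<open>M > 0\<close> by (intro mult_mono) auto
  also have "\<dots> \<le> M * (Q ^ length cs - 1)"
    using assms \<open>M > 0\<close> by (intro horner_sum_bound) auto
  also have "\<dots> \<le> M * (Q ^ g - 1)"
    using \<open>Q ^ length cs \<le> Q ^ g\<close> \<open>M > 0\<close> by simp
  finally have "Q ^ g \<le> M + 2" by (simp add: algebra_simps)
  then show False using big assms(1) \<open>M > 0\<close> by linarith
qed

text \<open>
  Dividing the polynomial \<open>P\<close> by \<open>Q ^ g - 2\<close> leaves a remainder with coefficients \<open>cs\<close>, which is
  nonzero and smaller than \<open>Q ^ g - 2\<close> once \<open>Q\<close> exceeds \<open>M + 1\<close>; only the finitely many values in
  \<open>small\<close> are left.
\<close>

lemma no_quotient:
  fixes Q Y c :: int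
  assumes "(Q ^ g - 2) * Y = P Q" and "Q \<ge> 2" and "Y \<ge> c" and "R Q"
    and small: "list_all (\<lambda>Q. \<not> R Q \<or> P Q mod (Q ^ g - 2) \<noteq> 0 \<or> P Q < c * (Q ^ g - 2)) [2..M + 1]"
    and rem: "P Q = (Q ^ g - 2) * s + horner_sum (\<lambda>x. x) Q cs"
    and "\<forall>x\<in>set cs. \<bar>x\<bar> \<le> M" and "\<exists>x\<in>set cs. x \<noteq> 0" and "length cs \<le> g" and "g \<ge> 2"
  shows False
proof (cases "Q \<le> M + 1")
  case True
  have "Q ^ 2 \<le> Q ^ g" using assms by (intro power_increasing) auto
  moreover have "Q * 2 \<le> Q * Q" using assms by (intro mult_left_mono) auto
  ultimately have "Q ^ g - 2 > 0" using \<open>Q \<ge> 2\<close> unfolding power2_eq_square by linarith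
  have "Q \<in> set [2..M + 1]" using True assms by simp
  then have "\<not> R Q \<or> P Q mod (Q ^ g - 2) \<noteq> 0 \<or> P Q < c * (Q ^ g - 2)"
    by (rule bspec[OF small[unfolded list_all_iff]])
  moreover have "P Q mod (Q ^ g - 2) = 0" unfolding assms(1)[symmetric] by simp
  moreover have "P Q \<ge> c * (Q ^ g - 2)"
    unfolding assms(1)[symmetric] using \<open>Y \<ge> c\<close> \<open>Q ^ g - 2 > 0\<close>
    by (simp add: mult.commute mult_left_mono)
  ultimately show False using \<open>R Q\<close> by linarith
next
  case False
  have "horner_sum (\<lambda>x. x) Q cs = (Q ^ g - 2) * (Y - s)"
    using rem assms(1) by (simp add: algebra_simps)
  then have "Q ^ g - 2 dvd horner_sum (\<lambda>x. x) Q cs" by simp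
  moreover have "\<not> Q ^ g - 2 dvd horner_sum (\<lambda>x. x) Q cs"
    by (rule not_dvd_horner_sum[where M = M]) (use False assms(7-10) in simp_all)
  ultimately show False by blast
qed

text \<open>
  In the lemmas named \<open>regular\<close> the stabilizer \<open>PGL(2, Q)\<close> or \<open>PSL(2, Q)\<close> of a block acts regularly
  on it, so that \<open>k = Q\<^sup>3 - Q\<close> (\<open>full\<close>) or \<open>2 k = Q\<^sup>3 - Q\<close> (\<open>half\<close>).
  In the lemmas named \<open>nonsplit_e\<close> the point stabilizer lies in a nonsplit torus and
  \<open>2 k = e Q (Q - 1)\<close>.
\<close>

lemma regular_full_3:
  fixes Q X :: int
  assumes "(Q ^ 3 - 2) * X = (Q^3 - Q - 1) * (Q^3 - Q - 2) * (Q^3 - Q - 3)"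
    and "Q \<ge> 2" and "X \<ge> 11"
  shows False
  \<comment> \<open>Here and below \<open>s\<close> and \<open>cs\<close> are quotient and remainder
    of the right side by \<open>Q ^ g - 2\<close> as polynomials in \<open>Q\<close>, with the
    constant term of \<open>cs\<close> first; \<open>M\<close> is the largest absolute value in
    \<open>cs\<close>. \<open>code_simp\<close> runs through \<open>Q\<close> from 2 to
    \<open>M + 1\<close>.\<close>
  by (rule no_quotient[where P = "\<lambda>Q. (Q^3 - Q - 1) * (Q^3 - Q - 2) * (Q^3 - Q - 3)" and Q = Q and R = "\<lambda>_. True" and c = 11 and M = 2
      and s = "Q^6 - 3*Q^4 - 4*Q^3 + 3*Q^2 + 6*Q + 2"
      and cs = "[-2, 1]", OF assms(1,2)])
    (use assms in simp, use assms in simp, code_simp, simp only: horner_sum_simps, Groebner_Basis.algebra, simp_all)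

lemma regular_full_4:
  fixes Q X :: int
  assumes "(Q ^ 4 - 2) * X = (Q^3 - Q - 1) * (Q^3 - Q - 2) * (Q^3 - Q - 3)"
    and "Q \<ge> 2" and "X \<ge> 11"
  shows False
  by (rule no_quotient[where P = "\<lambda>Q. (Q^3 - Q - 1) * (Q^3 - Q - 2) * (Q^3 - Q - 3)" and Q = Q and R = "\<lambda>_. True" and c = 11 and M = 18
      and s = "Q^5 - 3*Q^3 - 6*Q^2 + 5*Q + 12"
      and cs = "[18, -1, -18, 4]", OF assms(1,2)])
    (use assms in simp, use assms in simp, code_simp, simp only: horner_sum_simps, Groebner_Basis.algebra, simp_all)

lemma regular_full_5:
  fixes Q X :: int
  assumes "(Q ^ 5 - 2) * X = (Q^3 - Q - 1) * (Q^3 - Q - 2) * (Q^3 - Q - 3)"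
    and "Q \<ge> 2" and "X \<ge> 11"
  shows False
  by (rule no_quotient[where P = "\<lambda>Q. (Q^3 - Q - 1) * (Q^3 - Q - 2) * (Q^3 - Q - 3)" and Q = Q and R = "\<lambda>_. True" and c = 11 and M = 23
      and s = "Q^4 - 3*Q^2 - 6*Q + 3"
      and cs = "[0, -23, -12, 10, 14]", OF assms(1,2)])
    (use assms in simp, use assms in simp, code_simp, simp only: horner_sum_simps, Groebner_Basis.algebra, simp_all)

lemma regular_full_6:
  fixes Q X :: int
  assumes "(Q ^ 6 - 2) * X = (Q^3 - Q - 1) * (Q^3 - Q - 2) * (Q^3 - Q - 3)"
    and "Q \<ge> 2" and "X \<ge> 11"
  shows False
  by (rule no_quotient[where P = "\<lambda>Q. (Q^3 - Q - 1) * (Q^3 - Q - 2) * (Q^3 - Q - 3)" and Q = Q and R = "\<lambda>_. True" and c = 11 and M = 18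
      and s = "Q^3 - 3*Q - 6"
      and cs = "[-18, -17, -6, 12, 12, 3]", OF assms(1,2)])
    (use assms in simp, use assms in simp, code_simp, simp only: horner_sum_simps, Groebner_Basis.algebra, simp_all)

lemma regular_full_7:
  fixes Q X :: int
  assumes "(Q ^ 7 - 2) * X = (Q^3 - Q - 1) * (Q^3 - Q - 2) * (Q^3 - Q - 3)"
    and "Q \<ge> 2" and "X \<ge> 11"
  shows False
  by (rule no_quotient[where P = "\<lambda>Q. (Q^3 - Q - 1) * (Q^3 - Q - 2) * (Q^3 - Q - 3)" and Q = Q and R = "\<lambda>_. True" and c = 11 and M = 12
      and s = "Q^2 - 3"
      and cs = "[-12, -11, -4, 10, 12, 3, -6]", OF assms(1,2)])
    (use assms in simp, use assms in simp, code_simp, simp only: horner_sum_simps, Groebner_Basis.algebra, simp_all)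

lemma regular_full_8:
  fixes Q X :: int
  assumes "(Q ^ 8 - 2) * X = (Q^3 - Q - 1) * (Q^3 - Q - 2) * (Q^3 - Q - 3)"
    and "Q \<ge> 2" and "X \<ge> 11"
  shows False
  by (rule no_quotient[where P = "\<lambda>Q. (Q^3 - Q - 1) * (Q^3 - Q - 2) * (Q^3 - Q - 3)" and Q = Q and R = "\<lambda>_. True" and c = 11 and M = 12
      and s = "Q"
      and cs = "[-6, -9, -6, 10, 12, 3, -6, -3]", OF assms(1,2)])
    (use assms in simp, use assms in simp, code_simp, simp only: horner_sum_simps, Groebner_Basis.algebra, simp_all)

text \<open>Doubling each of \<open>k - 1\<close>, \<open>k - 2\<close>, \<open>k - 3\<close> gives
  8 and \<open>d = 2\<close> gives another 2, whence the 16 and the bound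
  \<open>c = 176 = 16 * 11\<close>.\<close>

lemma regular_half_3:
  fixes Q X :: int
  assumes "(Q ^ 3 - 2) * (16 * X) = (Q^3 - Q - 2) * (Q^3 - Q - 4) * (Q^3 - Q - 6)"
    and "Q \<ge> 2" and "X \<ge> 11"
  shows False
  by (rule no_quotient[where P = "\<lambda>Q. (Q^3 - Q - 2) * (Q^3 - Q - 4) * (Q^3 - Q - 6)" and Q = Q and R = "\<lambda>_. True" and c = 176 and M = 8
      and s = "Q^6 - 3*Q^4 - 10*Q^3 + 3*Q^2 + 18*Q + 23"
      and cs = "[-2, -8, -6]", OF assms(1,2)])
    (use assms in simp, use assms in simp, code_simp, simp only: horner_sum_simps, Groebner_Basis.algebra, simp_all)

lemma regular_half_4:
  fixes Q X :: int
  assumes "(Q ^ 4 - 2) * (16 * X) = (Q^3 - Q - 2) * (Q^3 - Q - 4) * (Q^3 - Q - 6)"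
    and "Q \<ge> 2" and "X \<ge> 11"
  shows False
  by (rule no_quotient[where P = "\<lambda>Q. (Q^3 - Q - 2) * (Q^3 - Q - 4) * (Q^3 - Q - 6)" and Q = Q and R = "\<lambda>_. True" and c = 176 and M = 37
      and s = "Q^5 - 3*Q^3 - 12*Q^2 + 5*Q + 24"
      and cs = "[0, -34, -36, 37]", OF assms(1,2)])
    (use assms in simp, use assms in simp, code_simp, simp only: horner_sum_simps, Groebner_Basis.algebra, simp_all)

lemma regular_half_5:
  fixes Q X :: int
  assumes "(Q ^ 5 - 2) * (16 * X) = (Q^3 - Q - 2) * (Q^3 - Q - 4) * (Q^3 - Q - 6)"
    and "Q \<ge> 2" and "X \<ge> 11"
  shows False
  by (rule no_quotient[where P = "\<lambda>Q. (Q^3 - Q - 2) * (Q^3 - Q - 4) * (Q^3 - Q - 6)" and Q = Q and R = "\<lambda>_. True" and c = 176 and M = 68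
      and s = "Q^4 - 3*Q^2 - 12*Q + 3"
      and cs = "[-42, -68, -18, 43, 26]", OF assms(1,2)])
    (use assms in simp, use assms in simp, code_simp, simp only: horner_sum_simps, Groebner_Basis.algebra, simp_all)

lemma regular_half_6:
  fixes Q X :: int
  assumes "(Q ^ 6 - 2) * (16 * X) = (Q^3 - Q - 2) * (Q^3 - Q - 4) * (Q^3 - Q - 6)"
    and "Q \<ge> 2" and "X \<ge> 11"
  shows False
  by (rule no_quotient[where P = "\<lambda>Q. (Q^3 - Q - 2) * (Q^3 - Q - 4) * (Q^3 - Q - 6)" and Q = Q and R = "\<lambda>_. True" and c = 176 and M = 72
      and s = "Q^3 - 3*Q - 12"
      and cs = "[-72, -50, -12, 45, 24, 3]", OF assms(1,2)])
    (use assms in simp, use assms in simp, code_simp, simp only: horner_sum_simps, Groebner_Basis.algebra, simp_all)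

lemma regular_half_7:
  fixes Q X :: int
  assumes "(Q ^ 7 - 2) * (16 * X) = (Q^3 - Q - 2) * (Q^3 - Q - 4) * (Q^3 - Q - 6)"
    and "Q \<ge> 2" and "X \<ge> 11"
  shows False
  by (rule no_quotient[where P = "\<lambda>Q. (Q^3 - Q - 2) * (Q^3 - Q - 4) * (Q^3 - Q - 6)" and Q = Q and R = "\<lambda>_. True" and c = 176 and M = 54
      and s = "Q^2 - 3"
      and cs = "[-54, -44, -10, 43, 24, 3, -12]", OF assms(1,2)])
    (use assms in simp, use assms in simp, code_simp, simp only: horner_sum_simps, Groebner_Basis.algebra, simp_all)

lemma regular_half_8:
  fixes Q X :: int
  assumes "(Q ^ 8 - 2) * (16 * X) = (Q^3 - Q - 2) * (Q^3 - Q - 4) * (Q^3 - Q - 6)"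
    and "Q \<ge> 2" and "X \<ge> 11"
  shows False
  by (rule no_quotient[where P = "\<lambda>Q. (Q^3 - Q - 2) * (Q^3 - Q - 4) * (Q^3 - Q - 6)" and Q = Q and R = "\<lambda>_. True" and c = 176 and M = 48
      and s = "Q"
      and cs = "[-48, -42, -12, 43, 24, 3, -12, -3]", OF assms(1,2)])
    (use assms in simp, use assms in simp, code_simp, simp only: horner_sum_simps, Groebner_Basis.algebra, simp_all)

text \<open>From \<open>2 * k = e * Q * (Q - 1)\<close> follows
  \<open>2 * k - 2 * e = e * (Q + 1) * (Q - 2)\<close>. So for \<open>e\<close> equal to 1, 2 or 3
  one factor of the left product absorbs the \<open>Q + 1\<close> of the point stabilizer, and
  \<open>Q - 2\<close> with two quadratic factors remains.\<close>

lemma nonsplit_1_2: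
  fixes Q X :: int
  assumes "(Q ^ 2 - 2) * (16 * X) = (Q - 2) * (Q * (Q - 1) - 4) * (Q * (Q - 1) - 6)"
    and "Q \<ge> 2" and "X \<ge> 11"
  shows False
  by (rule no_quotient[where P = "\<lambda>Q. (Q - 2) * (Q * (Q - 1) - 4) * (Q * (Q - 1) - 6)" and Q = Q and R = "\<lambda>_. True" and c = 176 and M = 8
      and s = "Q^3 - 4*Q^2 - 3*Q + 20"
      and cs = "[-8, -2]", OF assms(1,2)])
    (use assms in simp, use assms in simp, code_simp, simp only: horner_sum_simps, Groebner_Basis.algebra, simp_all)

lemma nonsplit_1_3:
  fixes Q X :: int
  assumes "(Q ^ 3 - 2) * (16 * X) = (Q - 2) * (Q * (Q - 1) - 4) * (Q * (Q - 1) - 6)"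
    and "Q \<ge> 2" and "X \<ge> 11"
  shows False
  by (rule no_quotient[where P = "\<lambda>Q. (Q - 2) * (Q * (Q - 1) - 4) * (Q * (Q - 1) - 6)" and Q = Q and R = "\<lambda>_. True" and c = 176 and M = 58
      and s = "Q^2 - 4*Q - 5"
      and cs = "[-58, -4, 30]", OF assms(1,2)])
    (use assms in simp, use assms in simp, code_simp, simp only: horner_sum_simps, Groebner_Basis.algebra, simp_all)

lemma nonsplit_1_4:
  fixes Q X :: int
  assumes "(Q ^ 4 - 2) * (16 * X) = (Q - 2) * (Q * (Q - 1) - 4) * (Q * (Q - 1) - 6)"
    and "Q \<ge> 2" and "X \<ge> 11"
  shows False
  by (rule no_quotient[where P = "\<lambda>Q. (Q - 2) * (Q * (Q - 1) - 4) * (Q * (Q - 1) - 6)" and Q = Q and R = "\<lambda>_. True" and c = 176 and M = 56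
      and s = "Q - 4"
      and cs = "[-56, 6, 28, -5]", OF assms(1,2)])
    (use assms in simp, use assms in simp, code_simp, simp only: horner_sum_simps, Groebner_Basis.algebra, simp_all)

lemma nonsplit_2_2:
  fixes Q X :: int
  assumes "(Q ^ 2 - 2) * X = (Q - 2) * (Q * (Q - 1) - 1) * (Q * (Q - 1) - 3)"
    and "Q \<ge> 2" and "X \<ge> 11"
  shows False
  by (rule no_quotient[where P = "\<lambda>Q. (Q - 2) * (Q * (Q - 1) - 1) * (Q * (Q - 1) - 3)" and Q = Q and R = "\<lambda>_. True" and c = 11 and M = 2
      and s = "Q^3 - 4*Q^2 + 3*Q + 2"
      and cs = "[-2, 1]", OF assms(1,2)])
    (use assms in simp, use assms in simp, code_simp, simp only: horner_sum_simps, Groebner_Basis.algebra, simp_all)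

lemma nonsplit_2_3:
  fixes Q X :: int
  assumes "(Q ^ 3 - 2) * X = (Q - 2) * (Q * (Q - 1) - 1) * (Q * (Q - 1) - 3)"
    and "Q \<ge> 2" and "X \<ge> 11"
  shows False
  by (rule no_quotient[where P = "\<lambda>Q. (Q - 2) * (Q * (Q - 1) - 1) * (Q * (Q - 1) - 3)" and Q = Q and R = "\<lambda>_. True" and c = 11 and M = 13
      and s = "Q^2 - 4*Q + 1"
      and cs = "[-4, -13, 12]", OF assms(1,2)])
    (use assms in simp, use assms in simp, code_simp, simp only: horner_sum_simps, Groebner_Basis.algebra, simp_all)

lemma nonsplit_2_4:
  fixes Q X :: int
  assumes "(Q ^ 4 - 2) * X = (Q - 2) * (Q * (Q - 1) - 1) * (Q * (Q - 1) - 3)"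
    and "Q \<ge> 2" and "X \<ge> 11"
  shows False
  by (rule no_quotient[where P = "\<lambda>Q. (Q - 2) * (Q * (Q - 1) - 1) * (Q * (Q - 1) - 3)" and Q = Q and R = "\<lambda>_. True" and c = 11 and M = 14
      and s = "Q - 4"
      and cs = "[-14, -3, 10, 1]", OF assms(1,2)])
    (use assms in simp, use assms in simp, code_simp, simp only: horner_sum_simps, Groebner_Basis.algebra, simp_all)

text \<open>The stabilizer has order \<open>(Q + 1) / 3\<close>, so 3 divides \<open>Q + 1\<close>.
  This is what excludes \<open>Q = 3\<close>, where the quotient 288 is an integer above
  176.\<close>

lemma nonsplit_3_2:
  fixes Q X :: int
  assumes "(Q ^ 2 - 2) * (16 * X) = 9 * (Q - 2) * (3 * Q * (Q - 1) - 2) * (3 * Q * (Q - 1) - 4)"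
    and "Q \<ge> 2" and "X \<ge> 11" and "3 dvd Q + 1"
  shows False
  by (rule no_quotient[where P = "\<lambda>Q. 9 * (Q - 2) * (3 * Q * (Q - 1) - 2) * (3 * Q * (Q - 1) - 4)" and Q = Q and R = "\<lambda>Q. 3 dvd Q + 1" and c = 176 and M = 792
      and s = "81*Q^3 - 324*Q^2 + 405*Q - 324"
      and cs = "[-792, 558]", OF assms(1,2)])
    (use assms in simp, use assms in simp, code_simp, simp only: horner_sum_simps, Groebner_Basis.algebra, simp_all)

lemma nonsplit_3_3:
  fixes Q X :: int
  assumes "(Q ^ 3 - 2) * (16 * X) = 9 * (Q - 2) * (3 * Q * (Q - 1) - 2) * (3 * Q * (Q - 1) - 4)"
    and "Q \<ge> 2" and "X \<ge> 11" and "3 dvd Q + 1"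
  shows False
  by (rule no_quotient[where P = "\<lambda>Q. 9 * (Q - 2) * (3 * Q * (Q - 1) - 2) * (3 * Q * (Q - 1) - 4)" and Q = Q and R = "\<lambda>Q. 3 dvd Q + 1" and c = 176 and M = 900
      and s = "81*Q^2 - 324*Q + 243"
      and cs = "[342, -900, 486]", OF assms(1,2)])
    (use assms in simp, use assms in simp, code_simp, simp only: horner_sum_simps, Groebner_Basis.algebra, simp_all)

lemma nonsplit_3_4:
  fixes Q X :: int
  assumes "(Q ^ 4 - 2) * (16 * X) = 9 * (Q - 2) * (3 * Q * (Q - 1) - 2) * (3 * Q * (Q - 1) - 4)"
    and "Q \<ge> 2" and "X \<ge> 11" and "3 dvd Q + 1"
  shows False
  by (rule no_quotient[where P = "\<lambda>Q. 9 * (Q - 2) * (3 * Q * (Q - 1) - 2) * (3 * Q * (Q - 1) - 4)" and Q = Q and R = "\<lambda>Q. 3 dvd Q + 1" and c = 176 and M = 792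
      and s = "81*Q - 324"
      and cs = "[-792, -90, 324, 243]", OF assms(1,2)])
    (use assms in simp, use assms in simp, code_simp, simp only: horner_sum_simps, Groebner_Basis.algebra, simp_all)

section \<open>Elimination for every exponent\<close>

lemma power_minus_two_le:
  fixes Q :: int
  assumes "Q \<ge> 2" "n \<le> g"
  shows "Q ^ n - 2 \<le> Q ^ g - 2"
  using assms by (simp add: power_increasing)

lemma regular_full:
  fixes Q X :: int
  assumes eq: "(Q ^ g - 2) * X = (Q^3 - Q - 1) * (Q^3 - Q - 2) * (Q^3 - Q - 3)" and Q: "Q \<ge> 2" and X: "X \<ge> 11" and "g \<ge> 3"
  shows False
proof -
  consider "g = 3" | "g = 4" | "g = 5" | "g = 6" | "g = 7" | "g = 8" | "g \<ge> 9" using \<open>g \<ge> 3\<close> by linarith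
  then show False
  proof cases
    \<comment> \<open>The right side is at most \<open>Q ^ 9\<close>, so from \<open>g = 9\<close>
      on the left side is too large; only the exponents 3 to 8 call for a division.\<close>
    case 7
    have Q3: "Q ^ 3 \<ge> 8" using power_mono[of 2 Q 3] Q by simp
    have "Q ^ 3 - Q \<ge> 3"
    proof -
      have "Q * Q \<ge> 2 * 2" using Q by (intro mult_mono) auto
      then have "Q * (Q * Q) \<ge> Q * 4" using Q by (intro mult_left_mono) auto
      then have "Q ^ 3 \<ge> Q * 4" by (simp add: power3_eq_cube mult.assoc)
      then show ?thesis using Q by linarith
    qed
    then have "(Q^3 - Q - 1) * (Q^3 - Q - 2) * (Q^3 - Q - 3) \<le> Q^3 * Q^3 * Q^3"
      using Q by (intro mult_mono mult_nonneg_nonneg; linarith)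
    also have "\<dots> = Q ^ 9" by (simp add: power_add[symmetric])
    finally have le: "(Q ^ g - 2) * X \<le> Q ^ 9" using eq by simp
    have "Q ^ 9 \<ge> 512" using power_mono[of 2 Q 9] Q by simp
    moreover have "(Q ^ 9 - 2) * 11 \<le> (Q ^ g - 2) * X"
      using power_minus_two_le[OF Q 7] X calculation by (intro mult_mono; linarith)
    then have "(Q ^ 9 - 2) * 11 \<le> Q ^ 9" using le by (rule order.trans)
    then have "10 * Q ^ 9 \<le> 22" by (simp add: algebra_simps)
    ultimately show False by linarith
  qed (use eq Q X regular_full_3[of Q X] regular_full_4[of Q X] regular_full_5[of Q X] regular_full_6[of Q X]
      regular_full_7[of Q X] regular_full_8[of Q X] in blast)+
qed

lemma regular_half:
  fixes Q X :: int
  assumes eq: "(Q ^ g - 2) * (16 * X) = (Q^3 - Q - 2) * (Q^3 - Q - 4) * (Q^3 - Q - 6)" and Q: "Q \<ge> 2" and X: "X \<ge> 11" and "g \<ge> 3"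
  shows False
proof -
  consider "g = 3" | "g = 4" | "g = 5" | "g = 6" | "g = 7" | "g = 8" | "g \<ge> 9" using \<open>g \<ge> 3\<close> by linarith
  then show False
  proof cases
    case 7
    have "Q ^ 3 - Q \<ge> 6"
    proof -
      have "Q * Q \<ge> 2 * 2" using Q by (intro mult_mono) auto
      then have "Q * (Q * Q) \<ge> Q * 4" using Q by (intro mult_left_mono) auto
      then have "Q ^ 3 \<ge> Q * 4" by (simp add: power3_eq_cube mult.assoc)
      then show ?thesis using Q by linarith
    qed
    then have "(Q^3 - Q - 2) * (Q^3 - Q - 4) * (Q^3 - Q - 6) \<le> Q^3 * Q^3 * Q^3"
      using Q by (intro mult_mono mult_nonneg_nonneg; linarith)
    also have "\<dots> = Q ^ 9" by (simp add: power_add[symmetric])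
    finally have le: "(Q ^ g - 2) * (16 * X) \<le> Q ^ 9" using eq by simp
    have "Q ^ 9 \<ge> 512" using power_mono[of 2 Q 9] Q by simp
    moreover have "(Q ^ 9 - 2) * 11 \<le> (Q ^ g - 2) * (16 * X)"
      using power_minus_two_le[OF Q 7] X calculation by (intro mult_mono; linarith)
    then have "(Q ^ 9 - 2) * 11 \<le> Q ^ 9" using le by (rule order.trans)
    then have "10 * Q ^ 9 \<le> 22" by (simp add: algebra_simps)
    ultimately show False by linarith
  qed (use eq Q X regular_half_3[of Q X] regular_half_4[of Q X] regular_half_5[of Q X] regular_half_6[of Q X]
      regular_half_7[of Q X] regular_half_8[of Q X] in blast)+
qed

text \<open>The right sides are at most \<open>c * Q ^ 5\<close>, so from \<open>g = 5\<close> on a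
  quotient of \<open>c + 10\<close> is impossible: \<open>10 * Q ^ 5\<close> would be at most
  \<open>2 * c + 20\<close>.\<close>

lemma nonsplit_size:
  fixes Q Y R :: int
  assumes "(Q ^ g - 2) * Y = R" "R \<le> c * Q ^ 5" "Q \<ge> 2" "Y \<ge> c + 10" "c \<ge> 0" "g \<ge> 5" "c \<le> 100"
  shows False
proof -
  have Q5: "Q ^ 5 \<ge> 32" using power_mono[of 2 Q 5] assms(3) by simp
  have "(Q ^ 5 - 2) * (c + 10) \<le> (Q ^ g - 2) * Y"
    using power_minus_two_le[OF assms(3,6)] assms Q5 by (intro mult_mono; linarith)
  then have "(Q ^ 5 - 2) * (c + 10) \<le> c * Q ^ 5" using assms(1,2) by linarith
  then have "10 * Q ^ 5 \<le> 2 * c + 20" by (simp add: algebra_simps)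
  then show False using Q5 assms(7) by linarith
qed

lemma nonsplit_1:
  fixes Q X :: int
  assumes eq: "(Q ^ g - 2) * (16 * X) = (Q - 2) * (Q * (Q - 1) - 4) * (Q * (Q - 1) - 6)" and Q: "Q \<ge> 2" and X: "X \<ge> 11" and "g \<ge> 2"
  shows False
proof -
  consider "g = 2" | "g = 3" | "g = 4" | "g \<ge> 5" using \<open>g \<ge> 2\<close> by linarith
  then show False
  proof cases
    case 4
    have "Q = 2 \<or> Q \<ge> 3" using Q by auto
    then have "(Q - 2) * ((Q * (Q - 1) - 4) * (Q * (Q - 1) - 6)) \<le> Q * ((Q * Q) * (Q * Q))"
    proof
      assume "Q \<ge> 3"
      then have "Q * (Q - 1) \<ge> 3 * 2" by (intro mult_mono) auto
      moreover have "Q * (Q - 1) \<le> Q * Q" using Q by (simp add: algebra_simps)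
      ultimately show ?thesis using Q by (intro mult_mono mult_nonneg_nonneg; linarith)
    qed simp
    then show False
      using nonsplit_size[OF eq _ Q _ _ 4, of 1] X by (simp add: power_numeral_reduce mult.assoc)
  qed (use eq Q X nonsplit_1_2[of Q X] nonsplit_1_3[of Q X] nonsplit_1_4[of Q X] in blast)+
qed

lemma nonsplit_2:
  fixes Q X :: int
  assumes eq: "(Q ^ g - 2) * X = (Q - 2) * (Q * (Q - 1) - 1) * (Q * (Q - 1) - 3)" and Q: "Q \<ge> 2" and X: "X \<ge> 11" and "g \<ge> 2"
  shows False
proof -
  consider "g = 2" | "g = 3" | "g = 4" | "g \<ge> 5" using \<open>g \<ge> 2\<close> by linarith
  then show False
  proof cases
    case 4
    have "Q = 2 \<or> Q \<ge> 3" using Q by auto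
    then have "(Q - 2) * ((Q * (Q - 1) - 1) * (Q * (Q - 1) - 3)) \<le> Q * ((Q * Q) * (Q * Q))"
    proof
      assume "Q \<ge> 3"
      then have "Q * (Q - 1) \<ge> 3 * 2" by (intro mult_mono) auto
      moreover have "Q * (Q - 1) \<le> Q * Q" using Q by (simp add: algebra_simps)
      ultimately show ?thesis using Q by (intro mult_mono mult_nonneg_nonneg; linarith)
    qed simp
    then show False
      using nonsplit_size[OF eq _ Q _ _ 4, of 1] X by (simp add: power_numeral_reduce mult.assoc)
  qed (use eq Q X nonsplit_2_2[of Q X] nonsplit_2_3[of Q X] nonsplit_2_4[of Q X] in blast)+
qed

lemma nonsplit_3:
  fixes Q X :: int
  assumes eq: "(Q ^ g - 2) * (16 * X) = 9 * (Q - 2) * (3 * Q * (Q - 1) - 2) * (3 * Q * (Q - 1) - 4)" and Q: "Q \<ge> 2" and X: "X \<ge> 11" and "g \<ge> 2"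
    and d3: "3 dvd Q + 1"
  shows False
proof -
  consider "g = 2" | "g = 3" | "g = 4" | "g \<ge> 5" using \<open>g \<ge> 2\<close> by linarith
  then show False
  proof cases
    case 4
    have "Q * (Q - 1) \<ge> 2 * 1" using Q by (intro mult_mono) auto
    moreover have "Q * (Q - 1) \<le> Q * Q" using Q by (simp add: algebra_simps)
    ultimately have "(Q - 2) * ((3 * (Q * (Q - 1)) - 2) * (3 * (Q * (Q - 1)) - 4)) \<le> Q * ((3 * (Q * Q)) * (3 * (Q * Q)))"
      using Q by (intro mult_mono mult_nonneg_nonneg; linarith)
    then have "9 * (Q - 2) * (3 * Q * (Q - 1) - 2) * (3 * Q * (Q - 1) - 4) \<le> 9 * (Q * ((3 * (Q * Q)) * (3 * (Q * Q))))"
      unfolding mult.assoc by (intro mult_left_mono) auto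
    also have "\<dots> = 81 * Q ^ 5" by Groebner_Basis.algebra
    finally show False using nonsplit_size[OF eq _ Q _ _ 4, of 81] X by linarith
  qed (use eq Q X d3 nonsplit_3_2[of Q X] nonsplit_3_3[of Q X] nonsplit_3_4[of Q X] in blast)+
qed

text \<open>For \<open>e = 4\<close> no factor cancels: modulo \<open>Q + 1\<close> the block size
  is 4, the right side is \<open>2 * 3 * 2 * 1 = 12\<close>, and so \<open>Q + 1\<close> divides
  12.\<close>

lemma nonsplit_4:
  fixes Q X :: int
  assumes eq: "X * (Q ^ g - 2) * (Q + 1) = 2 * ((2 * Q * (Q - 1) - 1) * (2 * Q * (Q - 1) - 2) * (2 * Q * (Q - 1) - 3))"
    and Q: "Q \<ge> 2" and X: "X \<ge> 11" and "g \<ge> 2"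
  shows False
proof -
  have "Q + 1 dvd 2 * ((2 * Q * (Q - 1) - 1) * (2 * Q * (Q - 1) - 2) * (2 * Q * (Q - 1) - 3))"
    unfolding eq[symmetric] by simp
  moreover have "2 * ((2 * Q * (Q - 1) - 1) * (2 * Q * (Q - 1) - 2) * (2 * Q * (Q - 1) - 3))
      = (Q + 1) * (16*Q^5 - 64*Q^4 + 64*Q^3 + 16*Q^2 - 20*Q - 24) + 12" by Groebner_Basis.algebra
  ultimately have "Q + 1 dvd 12" by (metis dvd_add_right_iff dvd_triv_left)
  then have dvd: "Q + 1 dvd 12" "Q \<le> 11" using zdvd_imp_le[of "Q + 1" 12] by auto
  have "Q = 2 \<or> Q = 3 \<or> Q = 4 \<or> Q = 5 \<or> Q = 6 \<or> Q = 7 \<or> Q = 8 \<or> Q = 9 \<or> Q = 10 \<or> Q = 11" using dvd(2) Q by presburger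
  then have cases: "Q = 2 \<or> Q = 3 \<or> Q = 5 \<or> Q = 11" using dvd(1) by auto
  \<comment> \<open>Replacing \<open>g\<close> by a smaller \<open>n\<close> weakens the left side;
    \<open>n = 5\<close> disposes of all large exponents at once.\<close>
  have bound: "11 * (Q ^ n - 2) \<le> c" if "X * (Q ^ g - 2) = c" "n \<le> g" "n \<ge> 1" for c n
  proof -
    have "Q ^ 1 \<le> Q ^ n" using that(3) Q by (intro power_increasing) auto
    then have "Q \<le> Q ^ n" by (simp only: power_one_right)
    then have "11 * (Q ^ n - 2) \<le> X * (Q ^ g - 2)"
      using power_minus_two_le[OF Q that(2)] X Q by (intro mult_mono; linarith)
    then show ?thesis using that by simp
  qed
  have gcases: "g = 2 \<or> g = 3 \<or> g = 4 \<or> g \<ge> 5" using \<open>g \<ge> 2\<close> by linarith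
  from cases show False
  proof (elim disjE)
    assume q: "Q = 2"
    have "X * (Q ^ g - 2) = 4" using eq q by simp
    from bound[OF this \<open>g \<ge> 2\<close>] show False using q by simp
  next
    assume q: "Q = 3"
    have e: "X * (Q ^ g - 2) = 495" using eq q by simp
    have dvd: "Q ^ g - 2 dvd 495" unfolding e[symmetric] by simp
    from gcases show False
    proof (elim disjE)
      assume "g \<ge> 5" then show False using bound[OF e, of 5] q by simp
    qed (use dvd q in simp_all)
  next
    assume q: "Q = 5"
    have e: "X * (Q ^ g - 2) = 18278" using eq q by simp
    have dvd: "Q ^ g - 2 dvd 18278" unfolding e[symmetric] by simp
    from gcases show False
    proof (elim disjE)
      assume "g \<ge> 5" then show False using bound[OF e, of 5] q by simp
    qed (use dvd q in simp_all)
  next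
    assume q: "Q = 11"
    have e: "X * (Q ^ g - 2) = 1726669" using eq q by simp
    have dvd: "Q ^ g - 2 dvd 1726669" unfolding e[symmetric] by simp
    from gcases show False
    proof (elim disjE)
      assume "g \<ge> 5" then show False using bound[OF e, of 5] q by simp
    qed (use dvd q in simp_all)
  qed
qed

text \<open>Here \<open>m\<close> is at least \<open>Q * (Q - 1) / 2\<close>, while
  \<open>k - 1\<close>, \<open>k - 2\<close>, \<open>k - 3\<close> are at most \<open>Q\<close>,
  \<open>Q - 1\<close>, \<open>Q - 2\<close>. So the left side is at most
  \<open>2 * m * (Q - 2)\<close> and the right side at least eleven times as large. The inequality
  for \<open>k * m\<close> serves both group orders.\<close>

lemma family_small:
  fixes Q g k m X :: nat
  assumes Q: "Q \<ge> 2" "g \<ge> 2" and k: "k \<le> Q + 1" "k > 4" and km: "2 * (k * m) \<ge> Q ^ 3 - Q"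
    and eq: "(k - 1) * (k - 2) * (k - 3) = X * (Q ^ g - 2) * m" and X: "X \<ge> 11"
  shows False
proof -
  have Q4: "Q \<ge> 4" using k by linarith
  have "Q ^ 3 - Q = (Q + 1) * (Q * (Q - 1))" by (cases Q) (auto simp: power3_eq_cube algebra_simps)
  moreover have "k * m \<le> (Q + 1) * m" using k by (intro mult_right_mono) auto
  ultimately have "(Q + 1) * (Q * (Q - 1)) \<le> (Q + 1) * (2 * m)" using km by (simp add: algebra_simps)
  then have m: "Q * (Q - 1) \<le> 2 * m" by (metis Suc_eq_plus1 Suc_mult_le_cancel1)
  have "Q ^ 2 \<le> Q ^ g" using Q by (intro power_increasing) auto
  moreover have "Q * 4 \<le> Q * Q" using Q4 by (intro mult_left_mono) auto
  ultimately have q: "Q ^ g - 2 \<ge> 2 * (Q - 2)" using Q4 unfolding power2_eq_square by linarith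
  have "11 * (2 * (Q - 2)) * m \<le> X * (Q ^ g - 2) * m" using q X by (intro mult_mono) auto
  also have "\<dots> \<le> Q * (Q - 1) * (Q - 2)" unfolding eq[symmetric] using k by (intro mult_mono) auto
  also have "\<dots> \<le> 2 * m * (Q - 2)" using m by (intro mult_right_mono) auto
  finally have "11 * (m * (Q - 2)) \<le> m * (Q - 2)" by (simp add: algebra_simps)
  moreover have "m * (Q - 2) > 0" using m Q4 by (cases m) auto
  ultimately show False by linarith
qed

text \<open>A divisor \<open>m\<close> of \<open>Q + 1\<close> that is at least half of it is
  \<open>Q + 1\<close> or \<open>(Q + 1) / 2\<close>. These lead to \<open>nonsplit_2\<close> and
  \<open>nonsplit_4\<close>, and \<open>m = 1\<close> leads to \<open>regular_full\<close>.\<close>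

lemma family_full:
  fixes Q g k m X :: nat
  assumes Q: "Q \<ge> 2" "g \<ge> 2" and km: "k * m = Q ^ 3 - Q" and k: "k \<le> Q ^ g" "k > 4"
    and eq: "(k - 1) * (k - 2) * (k - 3) = X * (Q ^ g - 2) * m" and X: "X \<ge> 11"
    and m: "k > Q + 1 \<Longrightarrow> m dvd Q + 1 \<and> (m = 1 \<or> Q + 1 \<le> 2 * m)"
  shows False
proof -
  have big: "k > Q + 1"
  proof (rule ccontr)
    assume "\<not> k > Q + 1"
    then show False using family_small[OF Q _ k(2) _ eq X] km by simp
  qed
  have q2: "Q ^ g \<ge> 2" using Q power_increasing[of 1 g Q] by simp
  have Q3: "Q ^ 3 \<ge> Q" using Q power_increasing[of 1 3 Q] by simp
  define x q :: int where "x = int k" and "q = int Q ^ g"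
  have eqi: "(x - 1) * (x - 2) * (x - 3) = int X * (q - 2) * int m"
  proof -
    have "int ((k - 1) * (k - 2) * (k - 3)) = int (X * (Q ^ g - 2) * m)" using eq by simp
    then show ?thesis using k q2 by (simp add: of_nat_diff x_def q_def)
  qed
  have kmi: "x * int m = int Q ^ 3 - int Q"
  proof -
    have "int (k * m) = int (Q ^ 3 - Q)" using km by simp
    then show ?thesis using Q3 by (simp add: of_nat_diff x_def)
  qed
  have Qi: "int Q \<ge> 2" and Xi: "int X \<ge> 11" using Q X by auto
  have fac: "int Q ^ 3 - int Q = int Q * (int Q - 1) * (int Q + 1)" by Groebner_Basis.algebra
  show False
  proof (cases "m = 1")
    case True
    \<comment> \<open>A regular action makes \<open>k = Q ^ 3 - Q\<close>, more than the
      \<open>Q ^ 2\<close> allowed for \<open>g = 2\<close>.\<close>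
    then have "g \<noteq> 2"
    proof -
      have "Q ^ 3 - Q > Q ^ 2 \<or> Q = 2"
      proof -
        have "Q * 2 \<le> Q * Q" using Q by (intro mult_left_mono) auto
        moreover have "Q * (Q * 3) \<le> Q * (Q * Q)" if "Q \<ge> 3" using that by (intro mult_left_mono) auto
        moreover have "Q ^ 3 = Q * (Q * Q)" "Q ^ 2 = Q * Q" by (simp_all add: power3_eq_cube power2_eq_square)
        ultimately show ?thesis using Q by (cases "Q = 2") linarith+
      qed
      then show ?thesis using True km k by auto
    qed
    then have "g \<ge> 3" using Q by linarith
    then show False using regular_full[of "int Q" g "int X"] eqi kmi True Qi Xi by (simp add: q_def ac_simps)
  next
    case False
    then have "m dvd Q + 1" and le: "Q + 1 \<le> 2 * m" using m[OF big] by blast+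
    then obtain e where e: "Q + 1 = m * e" by (elim dvdE)
    have m0: "m > 0" using e by (cases m) auto
    have "e = 1 \<or> e = 2"
    proof -
      have "m * e \<le> m * 2" using e le by linarith
      then have "e \<le> 2" using m0 by simp
      moreover have "e \<noteq> 0" using e by (cases e) auto
      ultimately show ?thesis by linarith
    qed
    then show False
    proof
      assume "e = 1"
      then have mi: "int m = int Q + 1" using e by simp
      have x: "x = int Q * (int Q - 1)" using kmi unfolding mi fac using Qi by simp
      have "(int Q + 1) * ((q - 2) * int X) = (x - 1) * (x - 2) * (x - 3)" using eqi mi by (simp add: ac_simps)
      also have "\<dots> = (int Q + 1) * ((int Q - 2) * (int Q * (int Q - 1) - 1) * (int Q * (int Q - 1) - 3))"
        unfolding x by Groebner_Basis.algebra
      finally have "(q - 2) * int X = (int Q - 2) * (int Q * (int Q - 1) - 1) * (int Q * (int Q - 1) - 3)"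
        using Qi by simp
      then show False unfolding q_def using nonsplit_2[OF _ Qi Xi Q(2)] by blast
    next
      assume "e = 2"
      then have mi: "2 * int m = int Q + 1" using e by simp
      have "x * (int Q + 1) = 2 * (x * int m)" using mi by simp
      also have "\<dots> = 2 * int Q * (int Q - 1) * (int Q + 1)" unfolding kmi by Groebner_Basis.algebra
      finally have x: "x = 2 * int Q * (int Q - 1)" using Qi by simp
      have "int X * (q - 2) * (int Q + 1) = 2 * ((x - 1) * (x - 2) * (x - 3))" unfolding eqi mi[symmetric] by simp
      then show False unfolding q_def x using nonsplit_4[OF _ Qi Xi Q(2)] by blast
    qed
  qed
qed

text \<open>The bound on \<open>m\<close> is weaker by a factor 2 than in
  \<open>family_full\<close>, so \<open>Q + 1 = m * e\<close> with \<open>e\<close> from 1 to 4;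
  each value has its own \<open>nonsplit\<close> lemma.\<close>

lemma family_half:
  fixes Q g k m X :: nat
  assumes Q: "Q \<ge> 2" "g \<ge> 2" and km: "2 * (k * m) = Q ^ 3 - Q" and k: "k \<le> Q ^ g" "k > 4"
    and eq: "(k - 1) * (k - 2) * (k - 3) = 2 * X * (Q ^ g - 2) * m" and X: "X \<ge> 11" and odd: "odd Q"
    and m: "k > Q + 1 \<Longrightarrow> m dvd Q + 1 \<and> (m = 1 \<or> Q + 1 \<le> 4 * m)"
  shows False
proof -
  have big: "k > Q + 1"
  proof (rule ccontr)
    assume "\<not> k > Q + 1"
    then show False using family_small[OF Q _ k(2) _ eq] km X by simp
  qed
  have q2: "Q ^ g \<ge> 2" using Q power_increasing[of 1 g Q] by simp
  have Q3: "Q ^ 3 \<ge> Q" using Q power_increasing[of 1 3 Q] by simp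
  define x q :: int where "x = int k" and "q = int Q ^ g"
  have eqi: "(x - 1) * (x - 2) * (x - 3) = 2 * int X * (q - 2) * int m"
  proof -
    have "int ((k - 1) * (k - 2) * (k - 3)) = int (2 * X * (Q ^ g - 2) * m)" using eq by simp
    then show ?thesis using k q2 by (simp add: of_nat_diff x_def q_def)
  qed
  have kmi: "2 * (x * int m) = int Q ^ 3 - int Q"
  proof -
    have "int (2 * (k * m)) = int (Q ^ 3 - Q)" using km by simp
    then show ?thesis using Q3 by (simp add: of_nat_diff x_def)
  qed
  have Qi: "int Q \<ge> 2" and Xi: "int X \<ge> 11" using Q X by auto
  have fac: "int Q ^ 3 - int Q = int Q * (int Q - 1) * (int Q + 1)" by Groebner_Basis.algebra
  show False
  proof (cases "m = 1")
    case True
    then have "g \<noteq> 2"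
    proof -
      have "Q ^ 3 - Q > 2 * Q ^ 2"
      proof -
        have "Q \<ge> 3" using Q odd by (cases "Q = 2") auto
        then have "Q * (Q * 3) \<le> Q * (Q * Q)" "Q * 3 \<le> Q * Q" by (intro mult_left_mono; simp)+
        moreover have "Q ^ 3 = Q * (Q * Q)" "Q ^ 2 = Q * Q" by (simp_all add: power3_eq_cube power2_eq_square)
        ultimately show ?thesis using \<open>Q \<ge> 3\<close> by linarith
      qed
      then show ?thesis using True km k by auto
    qed
    then have "g \<ge> 3" using Q by linarith
    have "8 * ((x - 1) * (x - 2) * (x - 3)) = (2 * x - 2) * (2 * x - 4) * (2 * x - 6)" by Groebner_Basis.algebra
    then have "8 * (2 * int X * (q - 2)) = (2 * x - 2) * (2 * x - 4) * (2 * x - 6)" using eqi True by simp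
    then have "(q - 2) * (16 * int X) = (2 * x - 2) * (2 * x - 4) * (2 * x - 6)" by (simp only: ac_simps)
    moreover have "2 * x = int Q ^ 3 - int Q" using kmi True by simp
    ultimately show False using regular_half[OF _ Qi Xi \<open>g \<ge> 3\<close>] unfolding q_def by presburger
  next
    case False
    then have "m dvd Q + 1" and le: "Q + 1 \<le> 4 * m" using m[OF big] by blast+
    then obtain e where e: "Q + 1 = m * e" by (elim dvdE)
    have m0: "m > 0" using e by (cases m) auto
    have "e = 1 \<or> e = 2 \<or> e = 3 \<or> e = 4"
    proof -
      have "m * e \<le> m * 4" using e le by linarith
      then have "e \<le> 4" using m0 by simp
      moreover have "e \<noteq> 0" using e by (cases e) auto
      ultimately show ?thesis by linarith
    qed
    have mi: "int e * int m = int Q + 1" using arg_cong[OF e(1), of int] by (simp add: ac_simps)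
    have "(2 * x) * (int Q + 1) = int e * (2 * (x * int m))" unfolding mi[symmetric] by simp
    also have "\<dots> = int e * int Q * (int Q - 1) * (int Q + 1)" unfolding kmi by Groebner_Basis.algebra
    finally have x: "2 * x = int e * int Q * (int Q - 1)" using Qi by simp
    \<comment> \<open>Doubling the three factors keeps everything integral, since it is
      \<open>2 * x\<close> that equals \<open>e * Q * (Q - 1)\<close>.\<close>
    have eq8: "16 * int X * (q - 2) * (int Q + 1) = int e * ((2 * x - 2) * (2 * x - 4) * (2 * x - 6))"
    proof -
      have "16 * int X * (q - 2) * (int Q + 1) = 8 * int e * (2 * int X * (q - 2) * int m)"
        unfolding mi[symmetric] by simp
      also have "\<dots> = int e * ((2 * x - 2) * (2 * x - 4) * (2 * x - 6))" unfolding eqi[symmetric] by Groebner_Basis.algebra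
      finally show ?thesis .
    qed
    show False using \<open>e = 1 \<or> e = 2 \<or> e = 3 \<or> e = 4\<close>
    proof (elim disjE)
      assume e: "e = 1"
      have "(int Q + 1) * ((q - 2) * (16 * int X)) = (int Q * (int Q - 1) - 2) * (int Q * (int Q - 1) - 4) * (int Q * (int Q - 1) - 6)"
        using eq8 unfolding x e by (simp add: ac_simps)
      also have "\<dots> = (int Q + 1) * ((int Q - 2) * (int Q * (int Q - 1) - 4) * (int Q * (int Q - 1) - 6))" by Groebner_Basis.algebra
      finally have "(q - 2) * (16 * int X) = (int Q - 2) * (int Q * (int Q - 1) - 4) * (int Q * (int Q - 1) - 6)"
        using Qi by simp
      then show False unfolding q_def using nonsplit_1[OF _ Qi Xi Q(2)] by blast
    next
      assume e: "e = 2"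
      then have x1: "x = int Q * (int Q - 1)" using x by simp
      have "(16 * (int Q + 1)) * ((q - 2) * int X) = 2 * ((2 * x - 2) * (2 * x - 4) * (2 * x - 6))"
        using eq8 unfolding e of_nat_numeral by (simp only: ac_simps)
      also have "\<dots> = (16 * (int Q + 1)) * ((int Q - 2) * (int Q * (int Q - 1) - 1) * (int Q * (int Q - 1) - 3))"
        unfolding x1 by Groebner_Basis.algebra
      finally have "(q - 2) * int X = (int Q - 2) * (int Q * (int Q - 1) - 1) * (int Q * (int Q - 1) - 3)"
        using Qi by simp
      then show False unfolding q_def using nonsplit_2[OF _ Qi Xi Q(2)] by blast
    next
      assume e: "e = 3"
      have "(int Q + 1) * ((q - 2) * (16 * int X)) = 3 * ((3 * int Q * (int Q - 1) - 2) * (3 * int Q * (int Q - 1) - 4) * (3 * int Q * (int Q - 1) - 6))"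
        using eq8 unfolding x e by (simp add: ac_simps)
      also have "\<dots> = (int Q + 1) * (9 * (int Q - 2) * (3 * int Q * (int Q - 1) - 2) * (3 * int Q * (int Q - 1) - 4))" by Groebner_Basis.algebra
      finally have "(q - 2) * (16 * int X) = 9 * (int Q - 2) * (3 * int Q * (int Q - 1) - 2) * (3 * int Q * (int Q - 1) - 4)"
        using Qi by simp
      moreover have "3 dvd int Q + 1" unfolding mi[symmetric] e by simp
      ultimately show False unfolding q_def using nonsplit_3[OF _ Qi Xi Q(2)] by blast
    next
      assume e: "e = 4"
      then have x1: "x = 2 * int Q * (int Q - 1)" using x by simp
      have "16 * (int X * (q - 2) * (int Q + 1)) = 4 * ((2 * x - 2) * (2 * x - 4) * (2 * x - 6))"
        using eq8 e by (simp add: ac_simps)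
      also have "\<dots> = 16 * (2 * ((x - 1) * (x - 2) * (x - 3)))" by Groebner_Basis.algebra
      finally have "int X * (q - 2) * (int Q + 1) = 2 * ((x - 1) * (x - 2) * (x - 3))"
        by (subst (asm) mult_cancel_left) simp
      then show False unfolding q_def x1 using nonsplit_4[OF _ Qi Xi Q(2)] by blast
    qed
  qed
qed

section \<open>Counting with group actions\<close>

lemma (in group_action) prime_power_fixed_point:
  assumes "prime p" and "order G = p ^ n" and "finite E" and "\<not> p dvd card E"
  shows "\<exists>x\<in>E. \<forall>g\<in>carrier G. \<phi> g x = x"
proof (rule ccontr)
  assume no_fix: "\<not> ?thesis"
  have "p dvd card orb" if orb: "orb \<in> orbits G E \<phi>" for orb
  proof -
    obtain x where x: "x \<in> E" "orb = orbit G \<phi> x" using orb by (auto simp: orbits_def)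
    obtain g where g: "g \<in> carrier G" "\<phi> g x \<noteq> x" using no_fix x by blast
    have "{x, \<phi> g x} \<subseteq> orb" using g x orbit_refl[OF x(1)] by (auto simp: orbit_def)
    moreover have "finite orb"
      using x element_image \<open>finite E\<close> by (auto simp: orbit_def intro: finite_subset[of _ E])
    ultimately have "card orb \<noteq> 1" using g by (auto simp: card_1_singleton_iff)
    moreover have "card orb dvd p ^ n"
      using orbit_stabilizer_theorem[OF x(1)] x assms(2) by (metis dvd_triv_left)
    ultimately show ?thesis
      using \<open>prime p\<close> divides_primepow_nat[of p "card orb" n] by (metis dvd_power not_gr0 power_0)
  qed
  then have "p dvd (\<Sum>orb\<in>orbits G E \<phi>. card orb)" by (rule dvd_sum)
  moreover have "(\<Sum>orb\<in>orbits G E \<phi>. card orb) = card E"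
    using disjoint_sum[OF \<open>finite E\<close>, of "\<lambda>_. 1::nat"] by simp
  ultimately show False using assms(4) by simp
qed

text \<open>\<open>f\<close> pairs off the elements it moves. This is the parity tool throughout:
  for blocks, for points and, in characteristic two, for field elements.\<close>

lemma odd_card_fixed_points:
  assumes "finite A" and "\<And>x. x \<in> A \<Longrightarrow> f x \<in> A" and "\<And>x. x \<in> A \<Longrightarrow> f (f x) = x" and "odd (card A)"
  shows "odd (card {x \<in> A. f x = x})"
proof -
  let ?M = "{x \<in> A. f x \<noteq> x}" and ?F = "{x \<in> A. f x = x}"
  let ?r = "{(x, y). x \<in> ?M \<and> y \<in> ?M \<and> (y = x \<or> y = f x)}"
  have "2 dvd card ?M"
  proof (rule equiv_imp_dvd_card)
    show "finite ?M" using assms by simp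
    show "equiv ?M ?r"
      by (rule equivI) (auto simp: refl_on_def sym_def trans_def assms)
    fix X assume "X \<in> ?M // ?r"
    then obtain x where "x \<in> ?M" "X = ?r `` {x}" by (rule quotientE)
    then have "X = {x, f x}" using assms by auto
    then show "2 dvd card X" using \<open>x \<in> ?M\<close> by auto
  qed
  moreover have "card A = card ?M + card ?F"
    using assms by (subst card_Un_disjoint[symmetric]) (auto intro: arg_cong[where f = card])
  ultimately show ?thesis using assms by auto
qed

text \<open>Stated for a plain function \<open>act\<close>, since the action on lines used later is
  given by arbitrarily chosen matrix lifts. Each orbit is a copy of the group because stabilizers
  are trivial.\<close>

lemma card_dvd_free_action:
  assumes "group G" and "finite E"
    and maps: "\<And>g x. g \<in> carrier G \<Longrightarrow> x \<in> E \<Longrightarrow> act g x \<in> E"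
    and comp: "\<And>g h x. g \<in> carrier G \<Longrightarrow> h \<in> carrier G \<Longrightarrow> x \<in> E \<Longrightarrow> act (g \<otimes>\<^bsub>G\<^esub> h) x = act g (act h x)"
    and free: "\<And>g x. g \<in> carrier G \<Longrightarrow> x \<in> E \<Longrightarrow> act g x = x \<longleftrightarrow> g = \<one>\<^bsub>G\<^esub>"
  shows "card (carrier G) dvd card E"
proof -
  interpret group G by fact
  have one: "act \<one>\<^bsub>G\<^esub> x = x" if "x \<in> E" for x using free that by simp
  let ?r = "{(x, y). x \<in> E \<and> (\<exists>g\<in>carrier G. y = act g x)}"
  show ?thesis
  proof (rule equiv_imp_dvd_card[OF \<open>finite E\<close>])
    show "equiv E ?r"
    proof (rule equivI)
      show "?r \<subseteq> E \<times> E" using maps by auto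
      show "refl_on E ?r"
      proof (rule refl_onI)
        fix x assume "x \<in> E"
        then show "(x, x) \<in> ?r" using one[of x] by (auto intro!: bexI[of _ "\<one>\<^bsub>G\<^esub>"])
      qed
      show "sym ?r"
        by (rule symI) (auto simp: maps comp[symmetric] one intro!: bexI[of _ "inv\<^bsub>G\<^esub> _"])
      show "trans ?r"
        by (rule transI) (auto simp: comp[symmetric] intro!: bexI[of _ "_ \<otimes>\<^bsub>G\<^esub> _"])
    qed
    fix X assume "X \<in> E // ?r"
    then obtain x where x: "x \<in> E" "X = ?r `` {x}" by (rule quotientE)
    then have X: "X = (\<lambda>g. act g x) ` carrier G" by auto
    have "inj_on (\<lambda>g. act g x) (carrier G)"
    proof (rule inj_onI)
      fix g h assume gh: "g \<in> carrier G" "h \<in> carrier G" "act g x = act h x"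
      then have "act (inv\<^bsub>G\<^esub> h \<otimes>\<^bsub>G\<^esub> g) x = act (inv\<^bsub>G\<^esub> h \<otimes>\<^bsub>G\<^esub> h) x"
        using x by (simp only: comp inv_closed)
      then have "inv\<^bsub>G\<^esub> h \<otimes>\<^bsub>G\<^esub> g = \<one>\<^bsub>G\<^esub>"
        using gh x free[of "inv\<^bsub>G\<^esub> h \<otimes>\<^bsub>G\<^esub> g" x] by (simp add: one)
      then show "g = h" using gh by (metis inv_equality inv_inv inv_closed)
    qed
    then show "card (carrier G) dvd card X" by (simp add: X card_image)
  qed
qed

section \<open>Finite fields and \<open>2 \<times> 2\<close> matrices\<close>

lemma finite_field_power_CARD:
  fixes x :: "'a::{field,finite}"
  shows "x ^ CARD('a) = x"
proof (cases "x = 0")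
  case False
  have "x * (\<Prod>y\<in>UNIV-{0}. x * y) = x * x ^ (CARD('a) - 1) * \<Prod>(UNIV-{0})"
    by (simp add: prod.distrib mult_ac)
  also have "x * x ^ (CARD('a) - 1) = x ^ CARD('a)"
    by (simp add: power_eq_if)
  also have "(\<Prod>y\<in>UNIV-{0}. x * y) = (\<Prod>y\<in>UNIV-{0}. y)"
    by (rule prod.reindex_bij_witness[of _ "\<lambda>y. y / x" "\<lambda>y. x * y"]) (use False in auto)
  finally show ?thesis by simp
qed simp

lemma finite_field_power_CARD_power:
  fixes x :: "'a::{field,finite}"
  shows "x ^ (CARD('a) ^ n) = x"
  by (induction n) (simp_all add: finite_field_power_CARD power_mult)

lemma of_nat_CARD_eq_0: "of_nat CARD('a::{field,finite}) = (0 :: 'a)"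
  using CHAR_dvd_CARD by (simp add: of_nat_eq_0_iff_char_dvd)

text \<open>For even field order the power map gives \<open>- 1 = 1\<close>. Conversely, if
  \<open>1 = - 1\<close>, then adding 1 is an involution of the field without fixed points.\<close>

lemma even_CARD_iff: "even CARD('a::{field,finite}) \<longleftrightarrow> (1 :: 'a) = - 1"
proof
  assume "even CARD('a)"
  then have "(-1 :: 'a) ^ CARD('a) = 1" by simp
  then show "(1 :: 'a) = - 1" by (metis finite_field_power_CARD)
next
  assume "(1 :: 'a) = - 1"
  then have two: "(1 :: 'a) + 1 = 0" by (metis add.right_inverse)
  have "{x \<in> UNIV. x + 1 = (x :: 'a)} = {}" by simp
  moreover have "x + 1 + 1 = x" for x :: 'a using two by (simp add: add.assoc)
  ultimately show "even CARD('a)"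
    using odd_card_fixed_points[of "UNIV :: 'a set" "\<lambda>x. x + 1"] by (metis (no_types, lifting) UNIV_I card.empty even_zero finite_class.finite_UNIV)
qed

lemma CARD_field_ge_2: "CARD('a::{field,finite}) \<ge> 2"
proof -
  have "card {0, 1 :: 'a} \<le> CARD('a)" by (rule card_mono) auto
  then show ?thesis by simp
qed

section \<open>Matrices and vectors in coordinates\<close>

definition m2 :: "'a \<Rightarrow> 'a \<Rightarrow> 'a \<Rightarrow> 'a \<Rightarrow> 'a::field ^ 2 ^ 2" where
  "m2 a b c d = (\<chi> i j. if i = 1 then (if j = 1 then a else b) else (if j = 1 then c else d))"

definition v2 :: "'a \<Rightarrow> 'a \<Rightarrow> 'a::field ^ 2" where
  "v2 x y = (\<chi> i. if i = 1 then x else y)"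

lemma m2_nth [simp]:
  "m2 a b c d $ 1 $ 1 = a" "m2 a b c d $ 1 $ 2 = b" "m2 a b c d $ 2 $ 1 = c" "m2 a b c d $ 2 $ 2 = d"
  by (simp_all add: m2_def)

lemma v2_nth [simp]: "v2 x y $ 1 = x" "v2 x y $ 2 = y"
  by (simp_all add: v2_def)

lemma m2_cases [cases type]: obtains a b c d where "A = m2 a b c d"
  by (rule that[of "A $ 1 $ 1" "A $ 1 $ 2" "A $ 2 $ 1" "A $ 2 $ 2"]) (simp add: vec_eq_iff forall_2)

lemma v2_cases: obtains x y where "v = v2 x y"
  by (rule that[of "v $ 1" "v $ 2"]) (simp add: vec_eq_iff forall_2)

lemma m2_eq_iff [simp]: "m2 a b c d = m2 a' b' c' d' \<longleftrightarrow> a = a' \<and> b = b' \<and> c = c' \<and> d = d'"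
  by (auto simp: vec_eq_iff forall_2)

lemma v2_eq_iff [simp]: "v2 x y = v2 x' y' \<longleftrightarrow> x = x' \<and> y = y'"
  by (auto simp: vec_eq_iff forall_2)

lemma zero_v2: "0 = v2 0 0"
  by (simp add: vec_eq_iff forall_2)

lemma m2_mult [simp]: "m2 a b c d ** m2 a' b' c' d' =
    m2 (a * a' + b * c') (a * b' + b * d') (c * a' + d * c') (c * b' + d * d')"
  by (simp add: vec_eq_iff forall_2 matrix_matrix_mult_def sum_2)

lemma m2_mult_v2 [simp]: "m2 a b c d *v v2 x y = v2 (a * x + b * y) (c * x + d * y)"
  by (simp add: vec_eq_iff forall_2 matrix_vector_mult_def sum_2)

lemma det_m2 [simp]: "det (m2 a b c d) = a * d - b * c"
  by (simp add: det_2)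

lemma mat_eq_m2: "mat c = m2 c 0 0 c"
  by (simp add: vec_eq_iff forall_2 mat_def)

lemma smult_v2 [simp]: "c *s v2 x y = v2 (c * x) (c * y)"
  by (simp add: vec_eq_iff forall_2)

lemma m2_in_SL2 [simp]: "m2 a b c d \<in> carrier SL2 \<longleftrightarrow> a * d - b * c = 1"
  by (simp add: SL2_def)

lemma m2_in_GL2 [simp]: "m2 a b c d \<in> carrier GL2 \<longleftrightarrow> a * d - b * c \<noteq> 0"
  by (simp add: GL2_def)

text \<open>Splitting off the diagonal matrix with entries \<open>det A\<close> and 1 identifies
  \<open>GL2\<close>, as a set, with the product of the nonzero scalars and
  \<open>SL2\<close>.\<close>

lemma card_GL2: "card (carrier (GL2 :: ('a::{field,finite} ^ 2 ^ 2) monoid)) = (CARD('a) - 1) * card (carrier (SL2 :: ('a ^ 2 ^ 2) monoid))"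
proof -
  let ?f = "\<lambda>(s, A). (m2 s 0 0 1 :: 'a ^ 2 ^ 2) ** A"
  have "bij_betw ?f ((UNIV - {0}) \<times> carrier SL2) (carrier GL2)"
  proof (rule bij_betw_byWitness[where f' = "\<lambda>A. (det A, m2 (inverse (det A)) 0 0 1 ** A)"])
    show "\<forall>x\<in>(UNIV - {0}) \<times> carrier SL2. (\<lambda>A. (det A, m2 (inverse (det A)) 0 0 1 ** A)) (?f x) = x"
      by (auto simp: det_mul SL2_def matrix_mul_assoc mat_eq_m2[symmetric])
    show "\<forall>A\<in>carrier GL2. ?f (det A, m2 (inverse (det A)) 0 0 1 ** A) = A"
      by (auto simp: GL2_def matrix_mul_assoc mat_eq_m2[symmetric])
  qed (auto simp: SL2_def GL2_def det_mul)
  then have "card (carrier (GL2 :: ('a ^ 2 ^ 2) monoid)) = card ((UNIV - {0 :: 'a}) \<times> carrier (SL2 :: ('a ^ 2 ^ 2) monoid))"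
    by (simp add: bij_betw_same_card)
  also have "\<dots> = (CARD('a) - 1) * card (carrier (SL2 :: ('a ^ 2 ^ 2) monoid))"
    by (simp add: card_cartesian_product card_Diff_singleton)
  finally show ?thesis .
qed

text \<open>If the upper left entry \<open>a\<close> is nonzero, \<open>b\<close> and
  \<open>c\<close> are free and determine the last entry. If it is 0, then \<open>b\<close> is
  nonzero and fixes \<open>c\<close>, and \<open>d\<close> is free.\<close>

lemma card_SL2: "card (carrier (SL2 :: ('a::{field,finite} ^ 2 ^ 2) monoid)) = CARD('a) * (CARD('a) ^ 2 - 1)"
proof -
  let ?q = "CARD('a)"
  let ?f = "\<lambda>(a, b, c). (m2 a b c ((1 + b * c) / a) :: 'a ^ 2 ^ 2)"
  let ?g = "\<lambda>(b, d). (m2 0 b (- inverse b) d :: 'a ^ 2 ^ 2)"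
  let ?X = "(UNIV - {0 :: 'a}) \<times> (UNIV :: 'a set) \<times> (UNIV :: 'a set)"
  let ?Y = "(UNIV - {0 :: 'a}) \<times> (UNIV :: 'a set)"
  have "carrier SL2 = ?f ` ?X \<union> ?g ` ?Y"
  proof (intro equalityI subsetI)
    fix A :: "'a ^ 2 ^ 2" assume A: "A \<in> carrier SL2"
    obtain a b c d where m: "A = m2 a b c d" by (cases A)
    show "A \<in> ?f ` ?X \<union> ?g ` ?Y"
    proof (cases "a = 0")
      case True
      with A m have "b * (- c) = 1" by simp
      then have "b \<noteq> 0" "inverse b = - c" by (auto intro: inverse_unique)
      then have "b \<noteq> 0" "c = - inverse b" by auto
      then have "A = ?g (b, d)" "(b, d) \<in> ?Y" using True m by auto
      then show ?thesis by blast
    next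
      case False
      with A m have "A = ?f (a, b, c)" "(a, b, c) \<in> ?X" by (auto simp: field_simps)
      then show ?thesis by blast
    qed
  qed (auto split: if_splits, metis right_inverse)
  moreover have "card (?f ` ?X \<union> ?g ` ?Y) = card (?f ` ?X) + card (?g ` ?Y)"
    by (rule card_Un_disjoint) auto
  moreover have "inj_on ?f ?X" "inj_on ?g ?Y" by (auto simp: inj_on_def)
  ultimately have "card (carrier (SL2 :: ('a ^ 2 ^ 2) monoid)) = card ?X + card ?Y"
    by (simp only: card_image)
  also have "\<dots> = (?q - 1) * (?q * ?q) + (?q - 1) * ?q"
    by (simp add: card_cartesian_product card_Diff_singleton)
  also have "\<dots> = ?q * (?q ^ 2 - 1)"
    using CARD_field_ge_2[where 'a = 'a] by (cases ?q) (auto simp: power2_eq_square algebra_simps)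
  finally show ?thesis .
qed

text \<open>The scalar \<open>c\<close> ranges over the whole field, since \<open>mat c\<close> lies
  in the carrier automatically once both matrices do. One statement serves \<open>SL2\<close> and
  \<open>GL2\<close>.\<close>

lemma scalar_coset_eq_iff:
  fixes S (structure)
  assumes S: "group S" "carrier S \<inter> range mat \<lhd> S" "mult S = (**)"
    and det: "\<And>A. A \<in> carrier S \<Longrightarrow> det A \<noteq> 0"
    and AB: "A \<in> carrier S" "B \<in> carrier S"
  shows "(carrier S \<inter> range mat) #> A = (carrier S \<inter> range mat) #> B \<longleftrightarrow> (\<exists>c. A = mat c ** (B :: 'a::field ^ 2 ^ 2))"
proof -
  interpret group S by fact
  interpret N: normal "carrier S \<inter> range mat" S by fact
  show ?thesis
  proof
    assume "(carrier S \<inter> range mat) #> A = (carrier S \<inter> range mat) #> B"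
    then have "A \<in> (carrier S \<inter> range mat) #> B" using AB rcos_self N.subgroup_axioms by metis
    then show "\<exists>c. A = mat c ** B" using S by (auto simp: r_coset_def)
  next
    assume "\<exists>c. A = mat c ** B"
    then obtain c where c: "A = mat c ** B" ..
    have "A \<otimes> inv B = mat c ** (B \<otimes> inv B)" by (simp add: c S matrix_mul_assoc)
    then have "A \<otimes> inv B = mat c ** \<one>" using AB by simp
    \<comment> \<open>The unit of \<open>S\<close> is not assumed to be \<open>mat 1\<close>; it is
      seen to act like it by cancelling the invertible \<open>B\<close>.\<close>
    moreover have "\<one> ** B = B" using AB l_one[of B] S(3) by simp
    moreover have "(mat c ** \<one>) ** B = mat c ** B" using calculation by (simp add: matrix_mul_assoc[symmetric])
    moreover have "invertible B" using det AB by (simp add: invertible_det_nz)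
    ultimately have "A \<otimes> inv B = mat c"
      by (metis (no_types, lifting) invertible_def matrix_mul_assoc matrix_mul_rid)
    moreover have "A \<otimes> inv B \<in> carrier S" using AB by (intro m_closed inv_closed)
    ultimately have "mat c \<in> carrier S" by simp
    then have "A \<in> (carrier S \<inter> range mat) #> B" using c S by (auto simp: r_coset_def)
    then show "(carrier S \<inter> range mat) #> A = (carrier S \<inter> range mat) #> B"
      using AB repr_independence N.subgroup_axioms by metis
  qed
qed

section \<open>Projection to the projective groups\<close>

definition psl :: "'a::field ^ 2 ^ 2 \<Rightarrow> ('a ^ 2 ^ 2) set" where
  "psl A = (carrier SL2 \<inter> range mat) #>\<^bsub>SL2\<^esub> A"

definition pgl :: "'a::field ^ 2 ^ 2 \<Rightarrow> ('a ^ 2 ^ 2) set" where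
  "pgl A = (carrier GL2 \<inter> range mat) #>\<^bsub>GL2\<^esub> A"

lemma psl_hom: "psl \<in> hom SL2 PSL2"
  using normal.r_coset_hom_Mod[OF scalars_normal_SL2] unfolding psl_def[abs_def] PSL2_def .

lemma pgl_hom: "pgl \<in> hom GL2 PGL2"
  using normal.r_coset_hom_Mod[OF scalars_normal_GL2] unfolding pgl_def[abs_def] PGL2_def .

lemma carrier_PSL2: "carrier PSL2 = psl ` carrier SL2"
  by (auto simp: PSL2_def FactGroup_def RCOSETS_def psl_def)

lemma carrier_PGL2: "carrier PGL2 = pgl ` carrier GL2"
  by (auto simp: PGL2_def FactGroup_def RCOSETS_def pgl_def)

lemma psl_eq_iff:
  assumes "A \<in> carrier SL2" "B \<in> carrier SL2"
  shows "psl A = psl B \<longleftrightarrow> (\<exists>c. A = mat c ** B)"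
  unfolding psl_def using assms
  by (intro scalar_coset_eq_iff group_SL2 scalars_normal_SL2) (auto simp: SL2_def)

lemma pgl_eq_iff:
  assumes "A \<in> carrier GL2" "B \<in> carrier GL2"
  shows "pgl A = pgl B \<longleftrightarrow> (\<exists>c. A = mat c ** B)"
  unfolding pgl_def using assms
  by (intro scalar_coset_eq_iff group_GL2 scalars_normal_GL2) (auto simp: GL2_def)

lemma card_SL2_scalars: "card (carrier SL2 \<inter> range (mat :: 'a \<Rightarrow> 'a::{field,finite} ^ 2 ^ 2)) = (if even CARD('a) then 1 else 2)"
proof -
  have "carrier SL2 \<inter> range (mat :: 'a \<Rightarrow> 'a ^ 2 ^ 2) = mat ` {1, - 1}"
    by (auto simp: mat_eq_m2 image_iff square_eq_1_iff)
  moreover have "card (mat ` {1, - 1 :: 'a} :: ('a ^ 2 ^ 2) set) = card {1, - 1 :: 'a}"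
    by (rule card_image) (auto simp: inj_on_def mat_eq_m2)
  moreover have "card {1, - 1 :: 'a} = (if (1 :: 'a) = - 1 then 1 else 2)"
    by (simp only: card_insert_if card.empty finite.intros insert_iff empty_iff) auto
  ultimately show ?thesis
    using even_CARD_iff[where 'a = 'a] by simp
qed

lemma card_GL2_scalars: "card (carrier GL2 \<inter> range (mat :: 'a \<Rightarrow> 'a::{field,finite} ^ 2 ^ 2)) = CARD('a) - 1"
proof -
  have "carrier GL2 \<inter> range (mat :: 'a \<Rightarrow> 'a ^ 2 ^ 2) = mat ` (UNIV - {0})"
    by (auto simp: mat_eq_m2 image_iff)
  moreover have "card (mat ` (UNIV - {0 :: 'a}) :: ('a ^ 2 ^ 2) set) = card (UNIV - {0 :: 'a})"
    by (rule card_image) (auto simp: inj_on_def mat_eq_m2)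
  ultimately show ?thesis by (simp add: card_Diff_singleton)
qed

lemma order_PSL2: "order (PSL2 :: ('a::{field,finite} ^ 2 ^ 2) set monoid) * (if even CARD('a) then 1 else 2) = CARD('a) * (CARD('a) ^ 2 - 1)"
proof -
  interpret group "SL2 :: ('a ^ 2 ^ 2) monoid" by (rule group_SL2)
  show ?thesis
    using lagrange[OF normal_imp_subgroup[OF scalars_normal_SL2]]
    by (simp add: order_def PSL2_def FactGroup_def card_SL2_scalars card_SL2 split: if_splits)
qed

lemma order_PGL2: "order (PGL2 :: ('a::{field,finite} ^ 2 ^ 2) set monoid) = CARD('a) * (CARD('a) ^ 2 - 1)"
proof -
  interpret group "GL2 :: ('a ^ 2 ^ 2) monoid" by (rule group_GL2)
  have "order (PGL2 :: ('a ^ 2 ^ 2) set monoid) * (CARD('a) - 1) = (CARD('a) - 1) * (CARD('a) * (CARD('a) ^ 2 - 1))"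
    using lagrange[OF normal_imp_subgroup[OF scalars_normal_GL2]]
    by (simp only: order_def PGL2_def FactGroup_def card_GL2_scalars card_GL2 card_SL2 partial_object.simps)
  then show ?thesis using CARD_field_ge_2[where 'a = 'a] by simp
qed

section \<open>The natural action\<close>

text \<open>The determinant of the matrix with columns \<open>v\<close> and \<open>w\<close>. It
  vanishes exactly on dependent vectors, so it compares points of the projective line without
  forming a quotient.\<close>

definition cross :: "'a::field ^ 2 \<Rightarrow> 'a ^ 2 \<Rightarrow> 'a" where
  "cross v w = v $ 1 * w $ 2 - v $ 2 * w $ 1"

lemma cross_v2 [simp]: "cross (v2 a b) (v2 c d) = a * d - b * c"
  by (simp add: cross_def)

lemma cross_self [simp]: "cross v v = 0"
  by (simp add: cross_def)

lemma cross_commute: "cross v w = 0 \<longleftrightarrow> cross w v = 0"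
  by (auto simp: cross_def algebra_simps)

lemma cross_matrix: "cross (A *v v) (A *v w) = det A * cross v w"
proof -
  obtain a b c d where "A = m2 a b c d" by (cases A)
  moreover obtain x y where "v = v2 x y" by (rule v2_cases)
  moreover obtain x' y' where "w = v2 x' y'" by (rule v2_cases)
  ultimately show ?thesis by (simp add: algebra_simps)
qed

lemma cross_eq_0D:
  assumes "cross v w = 0" and "v \<noteq> 0"
  obtains c where "w = c *s v"
proof -
  obtain x y where v: "v = v2 x y" by (rule v2_cases)
  obtain x' y' where w: "w = v2 x' y'" by (rule v2_cases)
  have eq: "x * y' = y * x'" using assms(1) v w by simp
  show thesis
  proof (cases "x = 0")
    case True
    then have "y \<noteq> 0" using assms(2) v by (simp add: zero_v2)
    then have "w = (y' / y) *s v" using True eq v w by (simp add: field_simps)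
    then show thesis by (rule that)
  next
    case False
    then have "w = (x' / x) *s v" using eq v w by (simp add: field_simps)
    then show thesis by (rule that)
  qed
qed

lemma basis_decomposition:
  assumes "cross v w \<noteq> 0"
  obtains a b where "u = a *s v + b *s w"
proof -
  obtain x y where v: "v = v2 x y" by (rule v2_cases)
  obtain x' y' where w: "w = v2 x' y'" by (rule v2_cases)
  obtain r s where u: "u = v2 r s" by (rule v2_cases)
  let ?d = "x * y' - y * x'"
  have d: "?d \<noteq> 0" using assms v w by simp
  have "r = (r * y' - s * x') / ?d * x + (x * s - y * r) / ?d * x'"
       "s = (r * y' - s * x') / ?d * y + (x * s - y * r) / ?d * y'"
    using d by (simp_all add: divide_simps) (simp_all add: algebra_simps)
  then have "u = ((r * y' - s * x') / ?d) *s v + ((x * s - y * r) / ?d) *s w"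
    unfolding u v w by (simp add: vec_eq_iff forall_2)
  then show thesis by (rule that)
qed

lemma matrix_eq_on_basis:
  fixes A B :: "'a::field ^ 2 ^ 2"
  assumes "A *v v = B *v v" "A *v w = B *v w" "cross v w \<noteq> 0"
  shows "A = B"
proof -
  have "A *v u = B *v u" for u
  proof -
    obtain a b where "u = a *s v + b *s w" using assms(3) by (rule basis_decomposition)
    then show ?thesis using assms by (simp add: matrix_vector_right_distrib vec.scale)
  qed
  then show ?thesis by (simp add: matrix_eq)
qed

lemma mat_mult_vector: "mat c *v v = c *s (v :: 'a::field ^ 2)"
  by (rule v2_cases[of v]) (simp add: mat_eq_m2)

lemma det_eq_eigenvalues:
  assumes "A *v v = a *s v" "A *v w = b *s w + c *s v" "cross v w \<noteq> 0"
  shows "det A = a * b"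
proof -
  have "det A * cross v w = a * b * cross v w"
    using cross_matrix[of A v w] assms(1,2) by (simp add: cross_def algebra_simps)
  then show ?thesis using assms(3) by simp
qed

text \<open>Domain of one-parameter groups such as \<open>m2 1 t 0 1\<close>: over a field of
  \<open>p\<close>-power order it is a \<open>p\<close>-group, to which
  \<open>prime_power_fixed_point\<close> applies.\<close>

definition additive_group :: "'a::ab_group_add monoid" where
  "additive_group = \<lparr>carrier = UNIV, mult = (+), one = 0\<rparr>"

lemma group_additive_group: "group (additive_group :: 'a::ab_group_add monoid)"
proof (rule groupI)
  fix x :: 'a
  show "\<exists>y\<in>carrier additive_group. y \<otimes>\<^bsub>additive_group\<^esub> x = \<one>\<^bsub>additive_group\<^esub>"
    by (rule bexI[of _ "- x"]) (auto simp: additive_group_def)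
qed (auto simp: additive_group_def add.assoc)

lemma (in group_action) action_via_hom:
  assumes "group K" and "h \<in> hom K G"
  shows "group_action K E (\<phi> \<circ> h)"
proof -
  have "\<phi> \<in> hom G (BijGroup E)" using group_hom group_hom.homh by blast
  then have "\<phi> \<circ> h \<in> hom K (BijGroup E)" using assms(2) Group.hom_compose by blast
  then show ?thesis
    using assms(1) group_BijGroup by (auto simp: group_action_def group_hom_def group_hom_axioms_def)
qed

lemma one_SL2 [simp]: "mat 1 \<in> carrier SL2" by (simp add: SL2_def)

lemma mult_SL2 [simp]: "A \<in> carrier SL2 \<Longrightarrow> B \<in> carrier SL2 \<Longrightarrow> A ** B \<in> carrier SL2"
  by (simp add: SL2_def det_mul)

lemma psl_mult: "A \<in> carrier SL2 \<Longrightarrow> B \<in> carrier SL2 \<Longrightarrow> psl (A ** B) = psl A \<otimes>\<^bsub>PSL2\<^esub> psl B"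
  using psl_hom by (auto simp: hom_def SL2_def)

lemma psl_one: "psl (mat 1) = \<one>\<^bsub>PSL2\<^esub>"
  using hom_one[OF psl_hom group_SL2 group_PSL2] by (simp add: SL2_def)

lemma psl_closed [simp]: "A \<in> carrier SL2 \<Longrightarrow> psl A \<in> carrier PSL2"
  by (auto simp: carrier_PSL2)

lemma psl_eq_one_iff: "A \<in> carrier SL2 \<Longrightarrow> psl A = \<one>\<^bsub>PSL2\<^esub> \<longleftrightarrow> A \<in> range mat"
  using psl_eq_iff[of A "mat 1"] by (auto simp: psl_one)

definition adj2 :: "'a::field ^ 2 ^ 2 \<Rightarrow> 'a ^ 2 ^ 2" where
  "adj2 A = m2 (A $ 2 $ 2) (- (A $ 1 $ 2)) (- (A $ 2 $ 1)) (A $ 1 $ 1)"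

lemma adj2_m2 [simp]: "adj2 (m2 a b c d) = m2 d (- b) (- c) a"
  by (simp add: adj2_def)

lemma adj2_SL2:
  assumes "A \<in> carrier SL2"
  shows "adj2 A \<in> carrier SL2" "adj2 A ** A = mat 1" "A ** adj2 A = mat 1"
  by (use assms in \<open>cases A, simp add: mat_eq_m2 algebra_simps\<close>)+

locale psl2_action = group_action "PSL2 :: ('a::{field,finite} ^ 2 ^ 2) set monoid" P \<phi>
  for P :: "'p set" and \<phi> +
  fixes p f :: nat
  assumes finite_points: "finite P" and card_points: "card P = CARD('a) + 1"
    and transitive: "\<And>x y. x \<in> P \<Longrightarrow> y \<in> P \<Longrightarrow> \<exists>g\<in>carrier (PSL2 :: ('a ^ 2 ^ 2) set monoid). \<phi> g x = y"
    and prime: "prime p" and CARD_eq: "CARD('a) = p ^ f"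
begin

sublocale group "PSL2 :: ('a ^ 2 ^ 2) set monoid" by (rule group_PSL2)

lemma CARD_mod: "\<not> p dvd card P"
proof -
  have "f \<noteq> 0" using CARD_eq CARD_field_ge_2[where 'a = 'a] by (metis numeral_le_one_iff power_0 semiring_norm(69))
  then have "p dvd CARD('a)" by (simp add: CARD_eq)
  then show ?thesis
    using prime card_points by (metis Suc_eq_plus1 dvd_add_right_iff nat_dvd_1_iff_1 not_prime_1)
qed

lemma act_one: "x \<in> P \<Longrightarrow> \<phi> \<one>\<^bsub>PSL2\<^esub> x = x"
  using id_eq_one by (metis restrict_apply')

text \<open>The field \<open>'b\<close> is independent of \<open>'a\<close>: once it is
  \<open>'a\<close> itself, for the upper triangular unipotents, and once the small field of a block
  stabilizer.\<close>

lemma additive_hom_fixed_point: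
  assumes "\<rho> \<in> hom (additive_group :: 'b::{field,finite} monoid) (PSL2 :: ('a ^ 2 ^ 2) set monoid)"
    and "CARD('b) = p ^ j"
  obtains x where "x \<in> P" "\<And>t. \<phi> (\<rho> t) x = x"
proof -
  interpret A: group_action "additive_group :: 'b monoid" P "\<phi> \<circ> \<rho>"
    by (rule action_via_hom[OF group_additive_group assms(1)])
  have "order (additive_group :: 'b monoid) = p ^ j"
    by (simp add: order_def additive_group_def assms(2))
  from A.prime_power_fixed_point[OF prime this finite_points CARD_mod] that
  show thesis by (auto simp: additive_group_def)
qed

lemma psl_act_mult:
  assumes "A \<in> carrier SL2" "B \<in> carrier SL2" "x \<in> P"
  shows "\<phi> (psl (A ** B)) x = \<phi> (psl A) (\<phi> (psl B) x)"
  using assms by (simp add: psl_mult composition_rule)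

lemma unipotent_fixed_point:
  obtains x where "x \<in> P" "\<And>t. \<phi> (psl (m2 1 t 0 1)) x = x"
proof -
  have "(\<lambda>t. psl (m2 1 t 0 1)) \<in> hom additive_group (PSL2 :: ('a ^ 2 ^ 2) set monoid)"
    by (auto simp: hom_def additive_group_def psl_mult[symmetric] add.commute)
  then show thesis using additive_hom_fixed_point[OF _ CARD_eq] that by blast
qed

lemma stabilizer_upper_triangular:
  assumes x: "x \<in> P" and U: "\<And>t. \<phi> (psl (m2 1 t 0 1)) x = x"
    and A: "A \<in> carrier SL2" "\<phi> (psl A) x = x"
  shows "A $ 2 $ 1 = 0"
proof (rule ccontr)
  assume nz: "A $ 2 $ 1 \<noteq> 0"
  define S where "S = {A \<in> carrier SL2. \<phi> (psl A) x = x}"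
  have mult: "A ** B \<in> S" if "A \<in> S" "B \<in> S" for A B
    using that x by (simp add: S_def psl_act_mult)
  have U: "m2 1 t 0 1 \<in> S" for t using U by (simp add: S_def)
  obtain a b c d where m: "A = m2 a b c d" by (cases A)
  have c: "c \<noteq> 0" and det: "a * d - b * c = 1" using nz m A by auto
  have "A \<in> S" using A by (simp add: S_def)
  \<comment> \<open>Row and column operations with unipotents clear the diagonal: the Bruhat
    decomposition yields a Weyl element.\<close>
  then have "m2 1 (- a / c) 0 1 ** A ** m2 1 (- d / c) 0 1 \<in> S" by (intro mult U)
  moreover have "m2 1 (- a / c) 0 1 ** A ** m2 1 (- d / c) 0 1 = m2 0 (- (1 / c)) c 0"
    using c det unfolding m by (simp add: field_simps)
  ultimately have W: "m2 0 (- (1 / c)) c 0 \<in> S" by simp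
  have L: "m2 1 0 s 1 \<in> S" for s
  proof -
    let ?W = "m2 0 (- (1 / c)) c 0"
    have "?W ** m2 1 (- s / (c * c)) 0 1 ** (?W ** ?W ** ?W) \<in> S" by (intro mult W U)
    \<comment> \<open>\<open>?W\<close> squares to minus the identity, so its cube is its inverse
      and this is a conjugation.\<close>
    also have "?W ** m2 1 (- s / (c * c)) 0 1 ** (?W ** ?W ** ?W) = m2 1 0 s 1"
      using c by (simp add: field_simps)
    finally show ?thesis .
  qed
  have big: "B \<in> S" if B: "B \<in> carrier SL2" "B $ 2 $ 1 \<noteq> 0" for B
  proof -
    obtain a b c d where m: "B = m2 a b c d" by (cases B)
    have c: "c \<noteq> 0" and det: "a * d - b * c = 1" using m B by auto
    have "m2 1 ((a - 1) / c) 0 1 ** m2 1 0 c 1 ** m2 1 ((d - 1) / c) 0 1 \<in> S" by (intro mult U L)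
    also have "m2 1 ((a - 1) / c) 0 1 ** m2 1 0 c 1 ** m2 1 ((d - 1) / c) 0 1 = B"
      using c det unfolding m by (simp add: field_simps)
    finally show ?thesis .
  qed
  have all: "B \<in> S" if B: "B \<in> carrier SL2" for B
  proof (cases "B $ 2 $ 1 = 0")
    case True
    obtain a b c d where m: "B = m2 a b c d" by (cases B)
    \<comment> \<open>Multiplication by a lower unipotent gives an upper triangular \<open>B\<close>
      a nonzero lower left entry; it is undone afterwards.\<close>
    have "B ** m2 1 0 1 1 \<in> S" using B True m by (intro big) (auto simp: algebra_simps)
    then have "B ** m2 1 0 1 1 ** m2 1 0 (- 1) 1 \<in> S" by (rule mult[OF _ L])
    moreover have "B ** m2 1 0 1 1 ** m2 1 0 (- 1) 1 = B" using m by simp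
    ultimately show ?thesis by metis
  qed (use big B in auto)
  have "P \<subseteq> {x}"
  proof
    fix y assume "y \<in> P"
    then obtain g where "g \<in> carrier PSL2" "\<phi> g x = y" using transitive x by blast
    then obtain B where "B \<in> carrier SL2" "\<phi> (psl B) x = y" by (auto simp: carrier_PSL2)
    then show "y \<in> {x}" using all by (auto simp: S_def)
  qed
  then have "card P \<le> 1" using card_mono[of "{x}" P] by simp
  then show False using card_points by simp
qed

text \<open>Both sides of the inclusion in \<open>stabilizer_upper_triangular\<close> have
  \<open>q * (q - 1)\<close> elements, the stabilizer by transitivity on \<open>q + 1\<close>
  points.\<close>

lemma stabilizer_eq_upper_triangular:
  assumes x: "x \<in> P" and U: "\<And>t. \<phi> (psl (m2 1 t 0 1)) x = x"
    and A: "A \<in> carrier SL2"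
  shows "\<phi> (psl A) x = x \<longleftrightarrow> A $ 2 $ 1 = 0"
proof -
  let ?S = "{A \<in> carrier SL2. \<phi> (psl A) x = x}" and ?T = "{A \<in> carrier SL2. A $ 2 $ 1 = (0 :: 'a)}"
  let ?q = "CARD('a)"
  interpret S: group_action "SL2 :: ('a ^ 2 ^ 2) monoid" P "\<phi> \<circ> psl"
    by (rule action_via_hom[OF group_SL2 psl_hom])
  have "orbit SL2 (\<phi> \<circ> psl) x = P"
  proof
    show "orbit SL2 (\<phi> \<circ> psl) x \<subseteq> P" using S.element_image x by (auto simp: orbit_def)
    show "P \<subseteq> orbit SL2 (\<phi> \<circ> psl) x"
    proof
      fix y assume "y \<in> P"
      then obtain g where "g \<in> carrier PSL2" "\<phi> g x = y" using transitive x by blast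
      then show "y \<in> orbit SL2 (\<phi> \<circ> psl) x" by (auto simp: orbit_def carrier_PSL2)
    qed
  qed
  moreover have "stabilizer SL2 (\<phi> \<circ> psl) x = ?S" by (auto simp: stabilizer_def)
  ultimately have "(?q + 1) * card ?S = ?q * (?q ^ 2 - 1)"
    using S.orbit_stabilizer_theorem[OF x] by (simp add: card_points order_def card_SL2)
  also have "\<dots> = (?q + 1) * (?q * (?q - 1))"
    by (cases ?q) (auto simp: power2_eq_square algebra_simps)
  finally have S: "card ?S = ?q * (?q - 1)" by (simp only: mult_cancel1) simp
  have "?T = (\<lambda>(a, b). m2 a b 0 (inverse a)) ` ((UNIV - {0}) \<times> UNIV)"
  proof (intro equalityI subsetI)
    fix A :: "'a ^ 2 ^ 2" assume T: "A \<in> ?T"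
    obtain a b c d where m: "A = m2 a b c d" by (cases A)
    then have "c = 0" "a * d = 1" using T by auto
    then have "a \<noteq> 0" "inverse a = d" by (auto intro: inverse_unique)
    then show "A \<in> (\<lambda>(a, b). m2 a b 0 (inverse a)) ` ((UNIV - {0}) \<times> UNIV)"
      using m \<open>c = 0\<close> by (auto simp: image_iff)
  qed auto
  moreover have "inj_on (\<lambda>(a, b). m2 a b 0 (inverse a)) ((UNIV - {0 :: 'a}) \<times> UNIV)"
    by (auto simp: inj_on_def)
  ultimately have "card ?T = ?q * (?q - 1)"
    by (simp add: card_image card_cartesian_product card_Diff_singleton)
  moreover have "?S \<subseteq> ?T" using stabilizer_upper_triangular[OF x U] by auto
  ultimately have "?S = ?T" using S by (intro card_subset_eq) auto
  then show ?thesis using A by auto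
qed

text \<open>
  Transitivity is the only information about the action used here: the unipotent upper triangular
  matrices form a \<open>p\<close>-group and hence fix one of the \<open>q + 1\<close> points, and any stabilizer containing
  them and a matrix that is not upper triangular is everything.  So the action is the one on the
  projective line; \<open>L y\<close> spans the line of the point \<open>y\<close>.
\<close>

lemma natural_action:
  obtains L :: "'p \<Rightarrow> 'a ^ 2" where
    "\<And>y. y \<in> P \<Longrightarrow> L y \<noteq> 0"
    "\<And>y z. y \<in> P \<Longrightarrow> z \<in> P \<Longrightarrow> cross (L y) (L z) = 0 \<Longrightarrow> y = z"
    "\<And>A y. A \<in> carrier SL2 \<Longrightarrow> y \<in> P \<Longrightarrow> cross (A *v L y) (L (\<phi> (psl A) y)) = 0"
proof -
  obtain x where x: "x \<in> P" and U: "\<And>t. \<phi> (psl (m2 1 t 0 1)) x = x"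
    using unipotent_fixed_point by blast
  let ?e = "v2 1 0 :: 'a ^ 2"
  \<comment> \<open>\<open>adj2 B\<close> inverts \<open>B\<close> in \<open>SL2\<close>, and the
    lower left entry of \<open>adj2 B ** A\<close> is, up to sign, the \<open>cross\<close> of the
    first columns. So \<open>A\<close> and \<open>B\<close> send \<open>x\<close> to the same point
    exactly if their first columns are proportional.\<close>
  have key: "cross (A *v ?e) (B *v ?e) = 0 \<longleftrightarrow> \<phi> (psl A) x = \<phi> (psl B) x"
    if AB: "A \<in> carrier SL2" "B \<in> carrier SL2" for A B
  proof -
    have "(adj2 B ** A) $ 2 $ 1 = - cross (B *v ?e) (A *v ?e) \<or> (adj2 B ** A) $ 2 $ 1 = cross (B *v ?e) (A *v ?e)"
      by (cases A, cases B) (simp add: algebra_simps)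
    then have "cross (B *v ?e) (A *v ?e) = 0 \<longleftrightarrow> (adj2 B ** A) $ 2 $ 1 = 0" by auto
    then have "cross (A *v ?e) (B *v ?e) = 0 \<longleftrightarrow> (adj2 B ** A) $ 2 $ 1 = 0"
      by (subst cross_commute)
    also have "\<dots> \<longleftrightarrow> \<phi> (psl (adj2 B ** A)) x = x"
      by (rule stabilizer_eq_upper_triangular[OF x U, symmetric]) (intro mult_SL2 adj2_SL2(1) AB)
    also have "\<dots> \<longleftrightarrow> \<phi> (psl A) x = \<phi> (psl B) x"
    proof
      assume "\<phi> (psl (adj2 B ** A)) x = x"
      then have "\<phi> (psl B) (\<phi> (psl (adj2 B ** A)) x) = \<phi> (psl B) x" by simp
      then show "\<phi> (psl A) x = \<phi> (psl B) x"
        using AB adj2_SL2[OF AB(2)] x by (simp add: psl_act_mult[symmetric] matrix_mul_assoc)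
    next
      assume "\<phi> (psl A) x = \<phi> (psl B) x"
      then have "\<phi> (psl (adj2 B ** A)) x = \<phi> (psl (adj2 B ** B)) x"
        using AB adj2_SL2(1)[OF AB(2)] x by (simp only: psl_act_mult)
      then show "\<phi> (psl (adj2 B ** A)) x = x"
        using AB adj2_SL2[OF AB(2)] x by (simp add: psl_one act_one)
    qed
    finally show ?thesis .
  qed
  have "\<exists>A. A \<in> carrier SL2 \<and> \<phi> (psl A) x = y" if "y \<in> P" for y
    using transitive[OF x that] by (auto simp: carrier_PSL2)
  \<comment> \<open>\<open>M y\<close> is any matrix taking \<open>x\<close> to \<open>y\<close>;
    its first column will span the line of \<open>y\<close>.\<close>
  then obtain M where M: "\<And>y. y \<in> P \<Longrightarrow> M y \<in> carrier SL2 \<and> \<phi> (psl (M y)) x = y" by metis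
  show thesis
  proof (rule that[of "\<lambda>y. M y *v ?e"])
    fix y assume y: "y \<in> P"
    show "M y *v ?e \<noteq> 0"
      by (cases "M y") (use M[OF y] in \<open>auto simp: zero_v2\<close>)
    fix z assume z: "z \<in> P" and "cross (M y *v ?e) (M z *v ?e) = 0"
    then show "y = z" using key M[OF y] M[OF z] by simp
  next
    fix A :: "'a ^ 2 ^ 2" and y assume A: "A \<in> carrier SL2" and y: "y \<in> P"
    let ?z = "\<phi> (psl A) y"
    have z: "?z \<in> P" using A y element_image psl_closed by blast
    have "cross (A ** M y *v ?e) (M ?z *v ?e) = 0"
      using A M[OF y] M[OF z] x y by (subst key) (auto simp: psl_act_mult)
    then show "cross (A *v (M y *v ?e)) (M ?z *v ?e) = 0"
      by (simp only: matrix_vector_mul_assoc)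
  qed
qed

section \<open>Fixed points and eigenvectors\<close>

lemma pow_SL2_eigenvector:
  assumes "A \<in> carrier SL2" "A *v v = a *s v"
  shows "(A [^]\<^bsub>SL2\<^esub> (n::nat)) *v v = a ^ n *s v"
proof (induction n)
  case (Suc n)
  have "(A [^]\<^bsub>SL2\<^esub> Suc n) *v v = (A [^]\<^bsub>SL2\<^esub> n) *v (A *v v)"
    by (simp add: nat_pow_def SL2_def matrix_vector_mul_assoc)
  also have "\<dots> = a *s ((A [^]\<^bsub>SL2\<^esub> n) *v v)" using assms by (simp add: vec.scale)
  also have "\<dots> = a ^ Suc n *s v" using Suc by (simp add: vector_smult_assoc)
  finally show ?case .
qed (simp add: nat_pow_def SL2_def)

text \<open>Powers of \<open>A\<close> act on \<open>v\<close> by powers of \<open>a\<close>, and a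
  power of \<open>A\<close> is a scalar with square 1. So \<open>a * a\<close> is a root of unity of
  \<open>p\<close>-power order, hence 1 in characteristic \<open>p\<close>. The eigenvalue itself
  may be \<open>- 1\<close>, because a lift is determined only up to sign.\<close>

lemma eigenvalue_of_p_element:
  assumes A: "A \<in> carrier SL2" "psl A [^]\<^bsub>PSL2\<^esub> (p ^ j) = \<one>\<^bsub>PSL2\<^esub>" and v: "A *v v = a *s v" "v \<noteq> (0 :: 'a ^ 2)"
  shows "a * a = 1"
proof -
  interpret S: group "SL2 :: ('a ^ 2 ^ 2) monoid" by (rule group_SL2)
  interpret h: group_hom SL2 PSL2 "psl :: 'a ^ 2 ^ 2 \<Rightarrow> _"
    by (intro group_hom.intro group_SL2 group_PSL2 group_hom_axioms.intro psl_hom)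
  let ?B = "A [^]\<^bsub>SL2\<^esub> (p ^ j)"
  have B: "?B \<in> carrier SL2" using A by simp
  have "psl ?B = \<one>\<^bsub>PSL2\<^esub>" using A h.hom_nat_pow[of A "p ^ j"] by simp
  then obtain c where c: "?B = mat c" using psl_eq_one_iff[OF B] by auto
  then have "c * c = 1" using B by (simp add: mat_eq_m2)
  have "c *s v = a ^ (p ^ j) *s v"
    using pow_SL2_eigenvector[OF A(1) v(1), of "p ^ j"] c by (simp add: mat_mult_vector)
  then have "c = a ^ (p ^ j)" using v(2) by (simp add: vec.scale_right_imp_eq)
  then have "(a * a) ^ (p ^ j) = 1" using \<open>c * c = 1\<close> by (simp add: power_mult_distrib)
  \<comment> \<open>Completing the exponent to \<open>CARD('a) ^ j\<close>, whose power map is the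
    identity on the field, removes the exponent \<open>p ^ j\<close>.\<close>
  moreover have "(p ^ j) * p ^ (j * (f - 1)) = CARD('a) ^ j"
  proof -
    have "f \<noteq> 0" using CARD_eq CARD_field_ge_2[where 'a = 'a] by (metis numeral_le_one_iff power_0 semiring_norm(69))
    then have "j + j * (f - 1) = f * j" by (cases f) auto
    then show ?thesis by (simp add: CARD_eq power_mult[symmetric] power_add[symmetric])
  qed
  ultimately show ?thesis
    using finite_field_power_CARD_power[of "a * a" j] by (metis power_mult power_one)
qed

lemma fixed_point_eigenvector:
  obtains L :: "'p \<Rightarrow> 'a ^ 2" where
    "\<And>y. y \<in> P \<Longrightarrow> L y \<noteq> 0"
    "\<And>y z. y \<in> P \<Longrightarrow> z \<in> P \<Longrightarrow> y \<noteq> z \<Longrightarrow> cross (L y) (L z) \<noteq> 0"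
    "\<And>A y. A \<in> carrier SL2 \<Longrightarrow> y \<in> P \<Longrightarrow> \<phi> (psl A) y = y \<Longrightarrow> \<exists>a. A *v L y = a *s L y"
proof -
  obtain L :: "'p \<Rightarrow> 'a ^ 2" where L: "\<And>y. y \<in> P \<Longrightarrow> L y \<noteq> 0"
    "\<And>y z. y \<in> P \<Longrightarrow> z \<in> P \<Longrightarrow> cross (L y) (L z) = 0 \<Longrightarrow> y = z"
    "\<And>A y. A \<in> carrier SL2 \<Longrightarrow> y \<in> P \<Longrightarrow> cross (A *v L y) (L (\<phi> (psl A) y)) = 0"
    by (rule natural_action) blast
  show thesis
  proof (rule that[of L])
    fix A y assume "A \<in> carrier SL2" "y \<in> P" "\<phi> (psl A) y = y"
    then have "cross (L y) (A *v L y) = 0" using L(3) cross_commute by metis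
    then show "\<exists>a. A *v L y = a *s L y" using L(1) \<open>y \<in> P\<close> by (metis cross_eq_0D)
  qed (use L in blast)+
qed

text \<open>Three pairwise independent eigenvectors in a plane share their eigenvalue, so the lift
  is scalar.\<close>

lemma three_fixed_points:
  assumes g: "g \<in> carrier PSL2" and "x \<in> P" "y \<in> P" "z \<in> P" "x \<noteq> y" "x \<noteq> z" "y \<noteq> z"
    and fixed: "\<phi> g x = x" "\<phi> g y = y" "\<phi> g z = z"
  shows "g = \<one>\<^bsub>PSL2\<^esub>"
proof -
  obtain L :: "'p \<Rightarrow> 'a ^ 2" where L: "\<And>y. y \<in> P \<Longrightarrow> L y \<noteq> 0"
    "\<And>y z. y \<in> P \<Longrightarrow> z \<in> P \<Longrightarrow> y \<noteq> z \<Longrightarrow> cross (L y) (L z) \<noteq> 0"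
    "\<And>A y. A \<in> carrier SL2 \<Longrightarrow> y \<in> P \<Longrightarrow> \<phi> (psl A) y = y \<Longrightarrow> \<exists>a. A *v L y = a *s L y"
    using fixed_point_eigenvector by blast
  obtain A where A: "A \<in> carrier SL2" "g = psl A" using g by (auto simp: carrier_PSL2)
  obtain a where a: "A *v L x = a *s L x" using L(3)[of A x] A assms by auto
  obtain b where b: "A *v L y = b *s L y" using L(3)[of A y] A assms by auto
  obtain c where c: "A *v L z = c *s L z" using L(3)[of A z] A assms by auto
  have xy: "cross (L x) (L y) \<noteq> 0" using L assms by auto
  obtain r s where rs: "L z = r *s L x + s *s L y" using basis_decomposition[OF xy] .
  have "cross (L x) (L z) = s * cross (L x) (L y)" "cross (L y) (L z) = - (r * cross (L x) (L y))"
    unfolding rs by (simp_all add: cross_def algebra_simps)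
  then have "s \<noteq> 0" "r \<noteq> 0" using L(2)[of x z] L(2)[of y z] assms by auto
  have "A *v L z = (r * a) *s L x + (s * b) *s L y"
    unfolding rs by (simp add: matrix_vector_right_distrib vec.scale a b vector_smult_assoc)
  then have eq: "(r * a) *s L x + (s * b) *s L y = (c * r) *s L x + (c * s) *s L y"
    using c unfolding rs by (simp add: vector_add_ldistrib vector_smult_assoc)
  have "cross (L x) ((r * a) *s L x + (s * b) *s L y) = s * b * cross (L x) (L y)"
    "cross (L x) ((c * r) *s L x + (c * s) *s L y) = c * s * cross (L x) (L y)"
    "cross ((r * a) *s L x + (s * b) *s L y) (L y) = r * a * cross (L x) (L y)"
    "cross ((c * r) *s L x + (c * s) *s L y) (L y) = c * r * cross (L x) (L y)"
    by (simp_all add: cross_def algebra_simps)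
  then have "b = c" "a = c" using eq xy \<open>s \<noteq> 0\<close> \<open>r \<noteq> 0\<close> by auto
  then have "A = mat c" using a b xy by (intro matrix_eq_on_basis[of _ "L x" _ "L y"]) (auto simp: mat_mult_vector)
  then show ?thesis using A psl_eq_one_iff by auto
qed

lemma two_fixed_points_commute:
  assumes "g \<in> carrier PSL2" "h \<in> carrier PSL2" and "x \<in> P" "y \<in> P" "x \<noteq> y"
    and "\<phi> g x = x" "\<phi> g y = y" "\<phi> h x = x" "\<phi> h y = y"
  shows "g \<otimes>\<^bsub>PSL2\<^esub> h = h \<otimes>\<^bsub>PSL2\<^esub> g"
proof -
  obtain L :: "'p \<Rightarrow> 'a ^ 2" where L: "\<And>y. y \<in> P \<Longrightarrow> L y \<noteq> 0"
    "\<And>y z. y \<in> P \<Longrightarrow> z \<in> P \<Longrightarrow> y \<noteq> z \<Longrightarrow> cross (L y) (L z) \<noteq> 0"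
    "\<And>A y. A \<in> carrier SL2 \<Longrightarrow> y \<in> P \<Longrightarrow> \<phi> (psl A) y = y \<Longrightarrow> \<exists>a. A *v L y = a *s L y"
    using fixed_point_eigenvector by blast
  obtain A where A: "A \<in> carrier SL2" "g = psl A" using assms by (auto simp: carrier_PSL2)
  obtain B where B: "B \<in> carrier SL2" "h = psl B" using assms by (auto simp: carrier_PSL2)
  obtain a b where ab: "A *v L x = a *s L x" "A *v L y = b *s L y" using L(3)[of A] A assms by metis
  obtain c d where cd: "B *v L x = c *s L x" "B *v L y = d *s L y" using L(3)[of B] B assms by metis
  have "A ** B = B ** A"
    using L(2)[of x y] assms ab cd
    by (intro matrix_eq_on_basis[of _ "L x" _ "L y"])
      (auto simp: matrix_vector_mul_assoc[symmetric] vec.scale vector_smult_assoc mult.commute)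
  then show ?thesis using A B by (simp add: psl_mult[symmetric])
qed

text \<open>The two eigenvalues satisfy \<open>a * a = 1\<close> and \<open>a * b = 1\<close>, so
  they agree and the lift is scalar.\<close>

lemma p_element_two_fixed_points:
  assumes g: "g \<in> carrier PSL2" "g [^]\<^bsub>PSL2\<^esub> (p ^ j) = \<one>\<^bsub>PSL2\<^esub>" and "x \<in> P" "y \<in> P" "x \<noteq> y"
    and "\<phi> g x = x" "\<phi> g y = y"
  shows "g = \<one>\<^bsub>PSL2\<^esub>"
proof -
  obtain L :: "'p \<Rightarrow> 'a ^ 2" where L: "\<And>y. y \<in> P \<Longrightarrow> L y \<noteq> 0"
    "\<And>y z. y \<in> P \<Longrightarrow> z \<in> P \<Longrightarrow> y \<noteq> z \<Longrightarrow> cross (L y) (L z) \<noteq> 0"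
    "\<And>A y. A \<in> carrier SL2 \<Longrightarrow> y \<in> P \<Longrightarrow> \<phi> (psl A) y = y \<Longrightarrow> \<exists>a. A *v L y = a *s L y"
    using fixed_point_eigenvector by blast
  obtain A where A: "A \<in> carrier SL2" "g = psl A" using assms by (auto simp: carrier_PSL2)
  obtain a b where ab: "A *v L x = a *s L x" "A *v L y = b *s L y" using L(3)[of A] A assms by metis
  have xy: "cross (L x) (L y) \<noteq> 0" using L(2) assms by auto
  have "a * a = 1" using eigenvalue_of_p_element[OF A(1) _ ab(1)] A g L assms by auto
  moreover have "a * b = 1" using det_eq_eigenvalues[of A "L x" a "L y" b 0] ab xy A by (simp add: SL2_def)
  ultimately have "a = b" by (metis mult_cancel_left mult_zero_left zero_neq_one)
  then have "A = mat a" using ab xy by (intro matrix_eq_on_basis[of _ "L x" _ "L y"]) (auto simp: mat_mult_vector)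
  then show ?thesis using A psl_eq_one_iff by auto
qed

text \<open>In a basis beginning with the common eigenvector both lifts are, up to sign, upper
  unipotent, and such matrices commute.\<close>

lemma p_elements_common_fixed_point_commute:
  assumes g: "g \<in> carrier PSL2" "g [^]\<^bsub>PSL2\<^esub> (p ^ j) = \<one>\<^bsub>PSL2\<^esub>"
    and h: "h \<in> carrier PSL2" "h [^]\<^bsub>PSL2\<^esub> (p ^ j) = \<one>\<^bsub>PSL2\<^esub>"
    and "x \<in> P" "\<phi> g x = x" "\<phi> h x = x"
  shows "g \<otimes>\<^bsub>PSL2\<^esub> h = h \<otimes>\<^bsub>PSL2\<^esub> g"
proof -
  obtain L :: "'p \<Rightarrow> 'a ^ 2" where L: "\<And>y. y \<in> P \<Longrightarrow> L y \<noteq> 0"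
    "\<And>y z. y \<in> P \<Longrightarrow> z \<in> P \<Longrightarrow> y \<noteq> z \<Longrightarrow> cross (L y) (L z) \<noteq> 0"
    "\<And>A y. A \<in> carrier SL2 \<Longrightarrow> y \<in> P \<Longrightarrow> \<phi> (psl A) y = y \<Longrightarrow> \<exists>a. A *v L y = a *s L y"
    using fixed_point_eigenvector by blast
  have Lx: "L x \<noteq> 0" using L assms by auto
  obtain A where A: "A \<in> carrier SL2" "g = psl A" using assms by (auto simp: carrier_PSL2)
  obtain B where B: "B \<in> carrier SL2" "h = psl B" using assms by (auto simp: carrier_PSL2)
  obtain a where a: "A *v L x = a *s L x" using L(3)[of A] A assms by metis
  obtain b where b: "B *v L x = b *s L x" using L(3)[of B] B assms by metis
  have aa: "a * a = 1" using eigenvalue_of_p_element[OF A(1) _ a Lx] A g by auto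
  have bb: "b * b = 1" using eigenvalue_of_p_element[OF B(1) _ b Lx] B h by auto
  obtain w where w: "cross (L x) w \<noteq> 0"
  proof -
    obtain r s where "L x = v2 r s" by (rule v2_cases)
    then have "cross (L x) (v2 0 1) \<noteq> 0 \<or> cross (L x) (v2 1 0) \<noteq> 0" using Lx by (auto simp: zero_v2)
    then show thesis using that by blast
  qed
  have step: "\<exists>r. M *v w = m *s w + r *s L x"
    if "M \<in> carrier SL2" "M *v L x = m *s L x" "m * m = 1" for M m
  proof -
    obtain r s where rs: "M *v w = r *s L x + s *s w" using basis_decomposition[OF w] .
    then have "det M = m * s" using that w by (intro det_eq_eigenvalues[of M "L x" m w s r]) (auto simp: add.commute)
    then have "m * s = m * m" using that by (simp add: SL2_def)
    moreover have "m \<noteq> 0" using that by auto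
    ultimately show ?thesis using rs by (auto simp: add.commute)
  qed
  obtain r where r: "A *v w = a *s w + r *s L x" using step[OF A(1) a aa] ..
  obtain s where s: "B *v w = b *s w + s *s L x" using step[OF B(1) b bb] ..
  have "A ** B = B ** A"
    using w a b r s
    by (intro matrix_eq_on_basis[of _ "L x" _ w])
      (auto simp: matrix_vector_mul_assoc[symmetric] vec.scale vector_smult_assoc mult.commute
        matrix_vector_right_distrib vector_add_ldistrib add_ac)
  then show ?thesis using A B by (simp add: psl_mult[symmetric])
qed

end

section \<open>Flag-transitive \<open>4\<close>-designs\<close>

text \<open>The restriction is forced by \<open>BijGroup\<close>, whose elements are extensional
  functions.\<close>

lemma group_actionI:
  assumes "group G" and maps: "\<And>g x. g \<in> carrier G \<Longrightarrow> x \<in> E \<Longrightarrow> act g x \<in> E"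
    and one: "\<And>x. x \<in> E \<Longrightarrow> act \<one>\<^bsub>G\<^esub> x = x"
    and comp: "\<And>g h x. g \<in> carrier G \<Longrightarrow> h \<in> carrier G \<Longrightarrow> x \<in> E \<Longrightarrow> act (g \<otimes>\<^bsub>G\<^esub> h) x = act g (act h x)"
  shows "group_action G E (\<lambda>g. restrict (act g) E)"
proof -
  interpret group G by fact
  have Bij: "restrict (act g) E \<in> Bij E" if g: "g \<in> carrier G" for g
  proof -
    have "bij_betw (restrict (act g) E) E E"
      by (rule bij_betw_byWitness[where f' = "act (inv\<^bsub>G\<^esub> g)"])
        (use g maps in \<open>auto simp: comp[symmetric] one\<close>)
    then show ?thesis by (simp add: Bij_def)
  qed
  moreover have "restrict (act (g \<otimes>\<^bsub>G\<^esub> h)) E = restrict (act g) E \<otimes>\<^bsub>BijGroup E\<^esub> restrict (act h) E"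
    if "g \<in> carrier G" "h \<in> carrier G" for g h
    using that Bij by (auto simp: BijGroup_def compose_def fun_eq_iff maps comp)
  ultimately have "(\<lambda>g. restrict (act g) E) \<in> hom G (BijGroup E)"
    by (auto simp: hom_def BijGroup_def)
  then show ?thesis
    using \<open>group G\<close> group_BijGroup by (auto simp: group_action_def group_hom_def group_hom_axioms_def)
qed

section \<open>Double counting\<close>

lemma card_le_fibres:
  assumes "finite B" and "\<And>a. a \<in> A \<Longrightarrow> f a \<in> B" and "\<And>b. b \<in> B \<Longrightarrow> card {a \<in> A. f a = b} \<le> n"
  shows "card A \<le> n * card B"
proof -
  have "A = (\<Union>b\<in>B. {a \<in> A. f a = b})" using assms by auto
  then have "card A = card (\<Union>b\<in>B. {a \<in> A. f a = b})" by simp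
  also have "\<dots> \<le> (\<Sum>b\<in>B. card {a \<in> A. f a = b})" using assms(1) by (rule card_UN_le)
  also have "\<dots> \<le> (\<Sum>b\<in>B. n)" by (intro sum_mono assms)
  finally show ?thesis by (simp add: mult.commute)
qed

lemma choose_four: "(n choose 4) * 24 = n * (n - 1) * (n - 2) * (n - 3)"
proof (cases "n \<ge> 4")
  case True
  then obtain m where n: "n = Suc (Suc (Suc (Suc m)))" by (metis add_2_eq_Suc le_Suc_ex numeral_Bit0 add.assoc)
  have "fact 4 * fact (n - 4) * (n choose 4) = (fact n :: nat)" using True by (rule binomial_fact_lemma)
  then have "(n choose 4) * 24 * fact m = n * (n - 1) * (n - 2) * (n - 3) * fact m"
    unfolding n by (simp add: fact_numeral algebra_simps eval_nat_numeral)
  then show ?thesis by (metis fact_nonzero mult_right_cancel)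
next
  case False
  then have "n = 0 \<or> n = 1 \<or> n = 2 \<or> n = 3" by auto
  then show ?thesis by auto
qed

lemma choose_four_eq:
  assumes "b * (k choose 4) = l * (v choose 4)"
  shows "b * (k * (k - 1) * (k - 2) * (k - 3)) = l * (v * (v - 1) * (v - 2) * (v - 3))"
  using assms by (metis choose_four mult.assoc)

lemma t_design_count:
  assumes "t_design t v k l P \<B>"
  shows "card \<B> * (k choose t) = l * (v choose t)"
proof -
  have fin: "finite P" "card P = v" and blocks: "\<And>B. B \<in> \<B> \<Longrightarrow> B \<subseteq> P \<and> card B = k"
    and lam: "\<And>T. T \<subseteq> P \<Longrightarrow> card T = t \<Longrightarrow> card {B \<in> \<B>. T \<subseteq> B} = l"
    using assms by (auto simp: t_design_def)
  have "finite \<B>" using blocks fin by (intro finite_subset[of \<B> "Pow P"]) auto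
  let ?S = "{T. T \<subseteq> P \<and> card T = t}"
  have "finite ?S" using fin by simp
  have "card \<B> * (k choose t) = (\<Sum>B\<in>\<B>. card {T \<in> ?S. T \<subseteq> B})"
  proof -
    have "card {T \<in> ?S. T \<subseteq> B} = k choose t" if "B \<in> \<B>" for B
    proof -
      have "{T \<in> ?S. T \<subseteq> B} = {T. T \<subseteq> B \<and> card T = t}" using blocks[OF that] by auto
      then show ?thesis using n_subsets[of B t] blocks[OF that] fin by (metis finite_subset)
    qed
    then show ?thesis by simp
  qed
  also have "\<dots> = (\<Sum>B\<in>\<B>. \<Sum>T\<in>?S. if T \<subseteq> B then 1 else 0)"
    using \<open>finite ?S\<close> by (intro sum.cong refl) (simp add: sum.If_cases Int_def)
  also have "\<dots> = (\<Sum>T\<in>?S. \<Sum>B\<in>\<B>. if T \<subseteq> B then 1 else 0)" by (rule sum.swap)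
  also have "\<dots> = (\<Sum>T\<in>?S. card {B \<in> \<B>. T \<subseteq> B})"
    using \<open>finite \<B>\<close> by (intro sum.cong refl) (simp add: sum.If_cases Int_def)
  also have "\<dots> = (\<Sum>T\<in>?S. l)" using lam by (intro sum.cong) auto
  also have "\<dots> = l * (v choose t)" using n_subsets[OF fin(1), of t] fin(2) by simp
  finally show ?thesis .
qed

text \<open>A Klein four-group together with an ordered pair of its involutions. Each group is
  counted six times, so the bounds 6, 24 and 30 below stand for one, four and five Klein
  four-groups.\<close>

definition klein_pairs :: "('g, 'm) monoid_scheme \<Rightarrow> 'g set \<Rightarrow> ('g \<times> 'g) set" where
  "klein_pairs G S = {(u, v). u \<in> S \<and> v \<in> S \<and> u \<noteq> \<one>\<^bsub>G\<^esub> \<and> v \<noteq> \<one>\<^bsub>G\<^esub> \<and> u \<noteq> v \<and>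
     u \<otimes>\<^bsub>G\<^esub> u = \<one>\<^bsub>G\<^esub> \<and> v \<otimes>\<^bsub>G\<^esub> v = \<one>\<^bsub>G\<^esub> \<and> u \<otimes>\<^bsub>G\<^esub> v = v \<otimes>\<^bsub>G\<^esub> u}"

locale psl2_design =
  fixes P :: "'p set" and \<B> :: "'p set set"
    and \<phi> :: "('a::{field,finite} ^ 2 ^ 2) set \<Rightarrow> 'p \<Rightarrow> 'p" and p f q k l :: nat
  assumes design: "t_design 4 (q + 1) k l P \<B>"
    and automorphisms: "acts_by_automorphisms (PSL2 :: ('a ^ 2 ^ 2) set monoid) P \<B> \<phi>"
    and flag_trans: "flag_transitive (PSL2 :: ('a ^ 2 ^ 2) set monoid) \<B> \<phi>"
    and prime_p: "prime p" and q_eq: "q = p ^ f" and q_ge: "q \<ge> 4"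
    and CARD_q: "CARD('a) = q"
    and l_gt: "l > 10" and k_le: "k \<le> q" and k_gt: "k > 4"
begin

abbreviation "G \<equiv> (PSL2 :: ('a ^ 2 ^ 2) set monoid)"
abbreviation "G\<^sub>b C \<equiv> {g \<in> carrier G. \<phi> g ` C = C}"

lemma block: "C \<in> \<B> \<Longrightarrow> C \<subseteq> P" "C \<in> \<B> \<Longrightarrow> card C = k"
  and finite_P: "finite P" and card_P: "card P = q + 1"
  and lambda: "T \<subseteq> P \<Longrightarrow> card T = 4 \<Longrightarrow> card {C \<in> \<B>. T \<subseteq> C} = l"
  using design by (auto simp: t_design_def)

lemma finite_blocks: "finite \<B>"
  using block finite_P by (intro finite_subset[of \<B> "Pow P"]) auto

lemma action: "group_action G P \<phi>"
  and block_image: "g \<in> carrier G \<Longrightarrow> C \<in> \<B> \<Longrightarrow> \<phi> g ` C \<in> \<B>"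
  using automorphisms by (auto simp: acts_by_automorphisms_def)

lemma point_in_block:
  assumes "x \<in> P"
  obtains C where "C \<in> \<B>" "x \<in> C"
proof -
  obtain S where S: "S \<subseteq> P - {x}" "card S = 3"
    using obtain_subset_with_card_n[of 3 "P - {x}"] card_P q_ge assms finite_P
    by (auto simp: card_Diff_singleton)
  then have "finite S" using finite_P by (metis finite_Diff finite_subset)
  then have "card (insert x S) = 4" using S by (subst card_insert_disjoint) auto
  then have "card {C \<in> \<B>. insert x S \<subseteq> C} = l" using S assms by (intro lambda) auto
  then have "{C \<in> \<B>. insert x S \<subseteq> C} \<noteq> {}" using l_gt by (metis card.empty not_less_zero)
  then show thesis using that by auto
qed

lemma flag_transE:
  assumes "C \<in> \<B>" "x \<in> C" "D \<in> \<B>" "y \<in> D"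
  obtains g where "g \<in> carrier G" "\<phi> g x = y" "\<phi> g ` C = D"
  using flag_trans assms by (fastforce simp: flag_transitive_def flags_def)

sublocale psl2_action P \<phi> p f
proof -
  interpret group_action G P \<phi> by (rule action)
  show "psl2_action P \<phi> p f"
  proof unfold_locales
    fix x y assume "x \<in> P" "y \<in> P"
    then obtain C D where "C \<in> \<B>" "x \<in> C" "D \<in> \<B>" "y \<in> D" using point_in_block by metis
    then show "\<exists>g\<in>carrier G. \<phi> g x = y" using flag_transE by metis
  qed (use finite_P card_P prime_p q_eq CARD_q in auto)
qed

lemma block_nonempty: "C \<in> \<B> \<Longrightarrow> \<exists>x. x \<in> C"
  using block(2)[of C] k_gt by (cases "C = {}") auto

lemma image_mult: "g \<in> carrier G \<Longrightarrow> h \<in> carrier G \<Longrightarrow> C \<subseteq> P \<Longrightarrow> \<phi> (g \<otimes>\<^bsub>G\<^esub> h) ` C = \<phi> g ` \<phi> h ` C"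
  by (auto simp: composition_rule image_image subset_iff intro!: image_cong)

lemma image_one: "C \<subseteq> P \<Longrightarrow> \<phi> \<one>\<^bsub>G\<^esub> ` C = C"
  by (auto simp: act_one subset_iff image_iff)

lemma subgroup_block_stabilizer:
  assumes "C \<in> \<B>"
  shows "subgroup (G\<^sub>b C) G"
proof (rule subgroupI)
  have C: "C \<subseteq> P" using block assms by auto
  show "G\<^sub>b C \<noteq> {}" using image_one[OF C] by auto
  fix g assume g: "g \<in> G\<^sub>b C"
  then have "\<phi> (inv\<^bsub>G\<^esub> g) ` C = \<phi> (inv\<^bsub>G\<^esub> g) ` \<phi> g ` C" by simp
  also have "\<dots> = C" using g C by (subst image_mult[symmetric]) (auto simp: image_one)
  finally show "inv\<^bsub>G\<^esub> g \<in> G\<^sub>b C" using g by simp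
  fix h assume "h \<in> G\<^sub>b C"
  then show "g \<otimes>\<^bsub>G\<^esub> h \<in> G\<^sub>b C" using g C by (simp add: image_mult)
qed auto

lemma card_blocks:
  assumes "B \<in> \<B>"
  shows "card \<B> * card (G\<^sub>b B) = order G"
proof -
  interpret I: group_action G \<B> "\<lambda>g. restrict (\<lambda>C. \<phi> g ` C) \<B>"
  proof (rule group_actionI[OF group_PSL2])
    show "\<phi> \<one>\<^bsub>G\<^esub> ` C = C" if "C \<in> \<B>" for C using image_one block that by auto
    show "\<phi> (g \<otimes>\<^bsub>G\<^esub> h) ` C = \<phi> g ` \<phi> h ` C" if "g \<in> carrier G" "h \<in> carrier G" "C \<in> \<B>" for g h C
      using image_mult block that by auto
  qed (use block_image in auto)
  have "orbit G (\<lambda>g. restrict (\<lambda>C. \<phi> g ` C) \<B>) B = \<B>"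
  proof
    show "\<B> \<subseteq> orbit G (\<lambda>g. restrict (\<lambda>C. \<phi> g ` C) \<B>) B"
    proof
      fix C assume "C \<in> \<B>"
      then obtain g where "g \<in> carrier G" "\<phi> g ` B = C"
        using flag_transE assms block_nonempty by metis
      then show "C \<in> orbit G (\<lambda>g. restrict (\<lambda>C. \<phi> g ` C) \<B>) B" using assms by (auto simp: orbit_def)
    qed
  qed (use assms block_image in \<open>auto simp: orbit_def\<close>)
  moreover have "stabilizer G (\<lambda>g. restrict (\<lambda>C. \<phi> g ` C) \<B>) B = G\<^sub>b B"
    using assms by (auto simp: stabilizer_def)
  ultimately show ?thesis using I.orbit_stabilizer_theorem[OF assms] by simp
qed

lemma card_block_stabilizer:
  assumes "B \<in> \<B>" "x \<in> B"
  shows "k * card {g \<in> G\<^sub>b B. \<phi> g x = x} = card (G\<^sub>b B)"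
proof -
  let ?H = "G\<lparr>carrier := G\<^sub>b B\<rparr>"
  have B: "B \<subseteq> P" using assms block by auto
  interpret I: group_action ?H B "\<lambda>g. restrict (\<phi> g) B"
  proof (rule group_actionI)
    show "group ?H" using subgroup_block_stabilizer[OF assms(1)] by (rule subgroup_imp_group)
    show "\<phi> \<one>\<^bsub>?H\<^esub> x = x" if "x \<in> B" for x using act_one that B by auto
    show "\<phi> (g \<otimes>\<^bsub>?H\<^esub> h) x = \<phi> g (\<phi> h x)" if "g \<in> carrier ?H" "h \<in> carrier ?H" "x \<in> B" for g h x
      using composition_rule that B by auto
  qed auto
  have "orbit ?H (\<lambda>g. restrict (\<phi> g) B) x = B"
  proof
    show "B \<subseteq> orbit ?H (\<lambda>g. restrict (\<phi> g) B) x"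
    proof
      fix y assume "y \<in> B"
      then obtain g where "g \<in> carrier G" "\<phi> g x = y" "\<phi> g ` B = B"
        using flag_transE assms by metis
      then show "y \<in> orbit ?H (\<lambda>g. restrict (\<phi> g) B) x" using assms by (auto simp: orbit_def)
    qed
  qed (use assms in \<open>auto simp: orbit_def\<close>)
  moreover have "stabilizer ?H (\<lambda>g. restrict (\<phi> g) B) x = {g \<in> G\<^sub>b B. \<phi> g x = x}"
    using assms by (auto simp: stabilizer_def)
  ultimately show ?thesis
    using I.orbit_stabilizer_theorem[OF assms(2)] block assms by (simp add: order_def)
qed

lemma card_point_stabilizer:
  assumes "x \<in> P"
  shows "(q + 1) * card {g \<in> carrier G. \<phi> g x = x} = order G"
proof -
  have "orbit G \<phi> x = P"
    using transitive[OF assms] element_image assms by (auto simp: orbit_def)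
  moreover have "stabilizer G \<phi> x = {g \<in> carrier G. \<phi> g x = x}" by (auto simp: stabilizer_def)
  ultimately show ?thesis using orbit_stabilizer_theorem[OF assms] card_P by simp
qed

definition d :: nat where "d = (if even q then 1 else 2)"

lemma order_G: "order G * d = q * (q ^ 2 - 1)"
  using order_PSL2[where 'a = 'a] by (simp add: d_def CARD_q)

text \<open>The number of blocks is eliminated between
  \<open>card \<B> * card (G\<^sub>b B) = order G\<close> and the count of pairs of a four-set and a
  block through it.\<close>

lemma parameter_equation:
  assumes "B \<in> \<B>"
  shows "k * (k - 1) * (k - 2) * (k - 3) = l * d * (q - 2) * card (G\<^sub>b B)"
proof -
  have "q * (q ^ 2 - 1) = (q + 1) * (q * (q - 1))"
    by (cases q) (auto simp: power2_eq_square algebra_simps)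
  then have "(q + 1) * (q * (q - 1)) = card \<B> * card (G\<^sub>b B) * d"
    using order_G card_blocks[OF assms] by simp
  moreover have "card \<B> * (k * (k - 1) * (k - 2) * (k - 3)) = l * ((q + 1) * q * (q - 1) * (q - 2))"
    using choose_four_eq[OF t_design_count[OF design]] by simp
  moreover have "l * ((q + 1) * q * (q - 1) * (q - 2)) = l * (q - 2) * ((q + 1) * (q * (q - 1)))"
    by (simp only: mult_ac)
  ultimately have "card \<B> * (k * (k - 1) * (k - 2) * (k - 3)) = l * (q - 2) * (card \<B> * card (G\<^sub>b B) * d)"
    by simp
  then have "card \<B> * (k * (k - 1) * (k - 2) * (k - 3)) = card \<B> * (l * d * (q - 2) * card (G\<^sub>b B))"
    by (simp only: mult_ac)
  moreover have "card \<B> \<noteq> 0" using assms finite_blocks by auto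
  ultimately show ?thesis by simp
qed

text \<open>Flag-transitivity makes all block stabilizers conjugate. The isomorphism type is assumed
  for one block, but the count of Klein groups runs over all of them.\<close>

lemma conj_block_stabilizer:
  assumes "B \<in> \<B>" "C \<in> \<B>" and \<psi>: "\<psi> \<in> iso (G\<lparr>carrier := G\<^sub>b B\<rparr>) K" and "group K"
  obtains \<psi>' where "\<psi>' \<in> iso (G\<lparr>carrier := G\<^sub>b C\<rparr>) K"
proof -
  obtain g where g: "g \<in> carrier G" "\<phi> g ` C = B"
    using assms block_nonempty flag_transE by metis
  have C: "C \<subseteq> P" and B: "B \<subseteq> P" using assms block by auto
  have gB: "\<phi> (inv\<^bsub>G\<^esub> g) ` B = C"
    using g C by (simp add: g(2)[symmetric] image_mult[symmetric] image_one)
  let ?c = "\<lambda>h. g \<otimes>\<^bsub>G\<^esub> h \<otimes>\<^bsub>G\<^esub> inv\<^bsub>G\<^esub> g"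
  have cancel: "g \<otimes>\<^bsub>G\<^esub> (inv\<^bsub>G\<^esub> g \<otimes>\<^bsub>G\<^esub> a) = a" "inv\<^bsub>G\<^esub> g \<otimes>\<^bsub>G\<^esub> (g \<otimes>\<^bsub>G\<^esub> a) = a" if "a \<in> carrier G" for a
    using g that by (simp_all add: m_assoc[symmetric])
  have cC: "?c h \<in> G\<^sub>b B" if "h \<in> G\<^sub>b C" for h
    using that g B C gB by (simp add: image_mult)
  have cB: "inv\<^bsub>G\<^esub> g \<otimes>\<^bsub>G\<^esub> h \<otimes>\<^bsub>G\<^esub> g \<in> G\<^sub>b C" if "h \<in> G\<^sub>b B" for h
    using that g B C gB by (simp add: image_mult)
  have "?c \<in> iso (G\<lparr>carrier := G\<^sub>b C\<rparr>) (G\<lparr>carrier := G\<^sub>b B\<rparr>)"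
  proof (rule isoI)
    show "?c \<in> hom (G\<lparr>carrier := G\<^sub>b C\<rparr>) (G\<lparr>carrier := G\<^sub>b B\<rparr>)"
    proof (rule homI)
      fix h h' assume "h \<in> carrier (G\<lparr>carrier := G\<^sub>b C\<rparr>)" "h' \<in> carrier (G\<lparr>carrier := G\<^sub>b C\<rparr>)"
      then have "h \<in> carrier G" "h' \<in> carrier G" by auto
      then show "?c (h \<otimes>\<^bsub>G\<lparr>carrier := G\<^sub>b C\<rparr>\<^esub> h') = ?c h \<otimes>\<^bsub>G\<lparr>carrier := G\<^sub>b B\<rparr>\<^esub> ?c h'"
        using g by (simp add: m_assoc cancel)
    qed (use cC in auto)
    show "bij_betw ?c (carrier (G\<lparr>carrier := G\<^sub>b C\<rparr>)) (carrier (G\<lparr>carrier := G\<^sub>b B\<rparr>))"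
    proof (rule bij_betw_byWitness[where f' = "\<lambda>h. inv\<^bsub>G\<^esub> g \<otimes>\<^bsub>G\<^esub> h \<otimes>\<^bsub>G\<^esub> g"])
      show "\<forall>h\<in>carrier (G\<lparr>carrier := G\<^sub>b C\<rparr>). inv\<^bsub>G\<^esub> g \<otimes>\<^bsub>G\<^esub> ?c h \<otimes>\<^bsub>G\<^esub> g = h"
        using g by (simp add: m_assoc cancel)
      show "\<forall>h\<in>carrier (G\<lparr>carrier := G\<^sub>b B\<rparr>). ?c (inv\<^bsub>G\<^esub> g \<otimes>\<^bsub>G\<^esub> h \<otimes>\<^bsub>G\<^esub> g) = h"
        using g by (simp add: m_assoc cancel)
    qed (use cB cC in \<open>simp_all add: image_subset_iff\<close>)
  qed
  then have "\<psi> \<circ> ?c \<in> iso (G\<lparr>carrier := G\<^sub>b C\<rparr>) K" using \<psi> iso_set_trans by blast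
  then show thesis by (rule that)
qed

text \<open>\<open>u\<close> acts as an involution on the \<open>l\<close> blocks through
  \<open>T\<close>, and \<open>v\<close> on those fixed by \<open>u\<close>; both times an odd
  number is fixed. The alternative that \<open>v\<close> squares to \<open>u\<close> admits cyclic
  groups of order four beside Klein groups.\<close>

lemma invariant_block:
  assumes "odd l" and uv: "u \<in> carrier G" "v \<in> carrier G" "u \<otimes>\<^bsub>G\<^esub> u = \<one>\<^bsub>G\<^esub>" "v \<otimes>\<^bsub>G\<^esub> v = \<one>\<^bsub>G\<^esub> \<or> v \<otimes>\<^bsub>G\<^esub> v = u"
      "u \<otimes>\<^bsub>G\<^esub> v = v \<otimes>\<^bsub>G\<^esub> u"
    and T: "T \<subseteq> P" "card T = 4" "\<phi> u ` T = T" "\<phi> v ` T = T"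
  obtains C where "C \<in> \<B>" "T \<subseteq> C" "u \<in> G\<^sub>b C" "v \<in> G\<^sub>b C"
proof -
  let ?X = "{C \<in> \<B>. T \<subseteq> C}"
  let ?Y = "{C \<in> ?X. \<phi> u ` C = C}"
  have closed: "\<phi> g ` C \<in> ?X" if "g \<in> carrier G" "\<phi> g ` T = T" "C \<in> ?X" for g C
    using that block_image by (auto intro: image_mono simp: subset_image_iff)
  have P: "C \<subseteq> P" if "C \<in> ?X" for C using that block by auto
  have "odd (card ?Y)"
  proof (rule odd_card_fixed_points)
    show "finite ?X" using finite_blocks by simp
    show "odd (card ?X)" using lambda T \<open>odd l\<close> by simp
    show "\<phi> u ` C \<in> ?X" if "C \<in> ?X" for C using closed uv T that by simp
    show "\<phi> u ` \<phi> u ` C = C" if "C \<in> ?X" for C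
      using uv P[OF that] by (simp add: image_mult[symmetric] image_one)
  qed
  then have "odd (card {C \<in> ?Y. \<phi> v ` C = C})"
  proof (rule odd_card_fixed_points[rotated -1])
    show "finite ?Y" using finite_blocks by simp
    fix C assume C: "C \<in> ?Y"
    have "\<phi> u ` \<phi> v ` C = \<phi> (u \<otimes>\<^bsub>G\<^esub> v) ` C" "\<phi> v ` \<phi> u ` C = \<phi> (v \<otimes>\<^bsub>G\<^esub> u) ` C"
      using uv C P[of C] image_mult[of u v C] image_mult[of v u C] by auto
    then have "\<phi> u ` \<phi> v ` C = \<phi> v ` \<phi> u ` C" using uv by simp
    then show "\<phi> v ` C \<in> ?Y" using closed[of v C] uv T C by simp
    have "\<phi> v ` \<phi> v ` C = \<phi> (v \<otimes>\<^bsub>G\<^esub> v) ` C" using uv C P[of C] by (simp add: image_mult)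
    then show "\<phi> v ` \<phi> v ` C = C" using uv(4) C P[of C] image_one[of C] by (elim disjE) simp_all
  qed
  then have "{C \<in> ?Y. \<phi> v ` C = C} \<noteq> {}" by (metis card.empty even_zero)
  then show thesis using that uv by auto
qed

end

section \<open>Klein four-subgroups\<close>

text \<open>More than half of the field elements are squares, and equally many have the form
  \<open>- 1 - b * b\<close>, so the two sets meet.\<close>

lemma sum_two_squares_eq_minus_one:
  assumes "odd CARD('a::{field,finite})"
  obtains a b :: "'a::{field,finite}" where "a * a + b * b = - 1"
proof -
  let ?S = "range (\<lambda>x :: 'a. x * x)" and ?T = "(\<lambda>x :: 'a. - 1 - x) ` range (\<lambda>x :: 'a. x * x)"
  have "card (UNIV - {0 :: 'a}) \<le> 2 * card (?S - {0})"
  proof (rule card_le_fibres[where f = "\<lambda>x. x * x"])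
    fix b :: 'a
    show "card {x \<in> UNIV - {0}. x * x = b} \<le> 2"
    proof (cases "\<exists>x. x * x = b")
      case True
      then obtain x where "x * x = b" ..
      then have "{x \<in> UNIV - {0}. x * x = b} \<subseteq> {x, - x}" by (auto simp: square_eq_iff)
      then have "card {x \<in> UNIV - {0}. x * x = b} \<le> card {x, - x}" by (rule card_mono[rotated]) simp
      also have "\<dots> \<le> 2" by (simp add: card_insert_if)
      finally show ?thesis .
    qed auto
  qed auto
  moreover have "card ?S = Suc (card (?S - {0}))"
    by (rule card_Suc_Diff1[symmetric]) (simp, metis mult_zero_left rangeI)
  moreover have "CARD('a) = Suc (card (UNIV - {0 :: 'a}))"
    by (rule card_Suc_Diff1[symmetric]) simp_all
  ultimately have S: "CARD('a) + 1 \<le> 2 * card ?S" by linarith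
  have T: "card ?T = card ?S" by (rule card_image) (auto simp: inj_on_def)
  have "?S \<inter> ?T \<noteq> {}"
  proof
    assume "?S \<inter> ?T = {}"
    then have "card (?S \<union> ?T) = card ?S + card ?T" by (intro card_Un_disjoint) auto
    moreover have "card (?S \<union> ?T) \<le> CARD('a)" by (rule card_mono) auto
    ultimately show False using S T by simp
  qed
  then obtain a b :: 'a where "a * a = - 1 - b * b" by auto
  then have "a * a + b * b = - 1" by simp
  then show thesis by (rule that)
qed

lemma mat_left_commute: "A ** (mat c ** B) = mat c ** (A ** (B :: 'a::field ^ 2 ^ 2))"
proof -
  have "A ** (mat c ** B) = (A ** mat c) ** B" by (rule matrix_mul_assoc)
  also have "\<dots> = (mat c ** A) ** B" by (simp only: mat_mult_commute)
  also have "\<dots> = mat c ** (A ** B)" by (rule matrix_mul_assoc[symmetric])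
  finally show ?thesis .
qed

lemma mult_GL2: "mult GL2 = (**)" and mult_SL2_eq: "mult SL2 = (**)"
  by (simp_all add: GL2_def SL2_def)

lemma one_GL2: "one GL2 = mat 1"
  by (simp add: GL2_def)

text \<open>Pairs in \<open>R\<close> generate quaternion groups in \<open>SL2\<close>; their images
  are Klein pairs with at most four preimages, two signs for each matrix. One such pair has only
  scalars in its centralizer, so its \<open>GL2\<close>-conjugates already number
  \<open>q * (q ^ 2 - 1)\<close>, twice the order of \<open>PSL2\<close>.\<close>

lemma card_klein_pairs_PSL2:
  assumes odd: "odd CARD('a::{field,finite})"
  shows "order (PSL2 :: ('a ^ 2 ^ 2) set monoid) \<le> 2 * card (klein_pairs PSL2 (carrier (PSL2 :: ('a ^ 2 ^ 2) set monoid)))"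
proof -
  let ?q = "CARD('a)"
  interpret GL: group "GL2 :: ('a ^ 2 ^ 2) monoid" by (rule group_GL2)
  have "(1 :: 'a) \<noteq> - 1" using odd even_CARD_iff[where 'a = 'a] by blast
  then have two: "(2 :: 'a) \<noteq> 0" by (metis add_eq_0_iff one_add_one)
  obtain a b :: 'a where ab: "a * a + b * b = - 1" using sum_two_squares_eq_minus_one[OF odd] .
  \<comment> \<open>\<open>A\<close> and \<open>B\<close> anticommute and square to
    \<open>mat (- 1)\<close>; for \<open>B\<close> the latter is the equation
    \<open>a * a + b * b = - 1\<close>.\<close>
  define A where "A = m2 0 1 (- 1) (0 :: 'a)"
  define B where "B = m2 a b b (- a)"
  have A: "A \<in> carrier GL2" "det A = 1" "A ** A = mat (- 1)" by (simp_all add: A_def mat_eq_m2)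
  have "- (a * a) - b * b = 1" using ab by (metis add.inverse_inverse minus_add_distrib uminus_add_conv_diff add.commute diff_conv_add_uminus)
  then have B: "B \<in> carrier GL2" "det B = 1" "B ** B = mat (- 1)"
    using ab by (simp_all add: B_def mat_eq_m2 algebra_simps)
  have AB: "A ** B = mat (- 1) ** (B ** A)" by (simp add: A_def B_def mat_eq_m2)
  have comm: "X \<in> range mat" if X: "X ** A = A ** X" "X ** B = B ** X" for X
  proof -
    obtain x y z w where m: "X = m2 x y z w" by (cases X)
    have "(X ** A) $ 1 $ 1 = (A ** X) $ 1 $ 1" "(X ** A) $ 1 $ 2 = (A ** X) $ 1 $ 2" using X by simp_all
    then have e: "- y = z" "x = w" by (simp_all add: m A_def)
    have zw: "z = - y" "w = x" by (simp_all only: e)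
    have "(X ** B) $ 1 $ 1 = (B ** X) $ 1 $ 1" "(X ** B) $ 1 $ 2 = (B ** X) $ 1 $ 2" using X by simp_all
    then have e: "x * a + y * b = a * x + b * - y" "x * b + y * - a = a * y + b * x"
      by (simp_all add: m B_def zw)
    have "2 * (b * y) = (x * a + y * b) - (a * x + b * - y)" "2 * (a * y) = (a * y + b * x) - (x * b + y * - a)"
      by (simp_all add: algebra_simps)
    then have "2 * (b * y) = 0" "2 * (a * y) = 0" unfolding e by simp_all
    then have "y = 0 \<or> (a = 0 \<and> b = 0)" using two by auto
    then have "y = 0" using ab by auto
    then show ?thesis using m zw by (simp add: mat_eq_m2)
  qed
  have half: "c = 0" if "mat (- c) = (mat c :: 'a ^ 2 ^ 2)" for c
  proof -
    have "- c = c" using that by (simp add: mat_eq_m2)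
    then have "c + c = 0" by (metis add.left_inverse)
    then have "2 * c = 0" by (simp only: mult_2)
    then show ?thesis using two by simp
  qed
  let ?c = "\<lambda>X M. X ** M ** inv\<^bsub>GL2\<^esub> X"
  have inv: "X ** inv\<^bsub>GL2\<^esub> X = mat 1" "inv\<^bsub>GL2\<^esub> X ** X = mat 1" if "X \<in> carrier GL2" for X :: "'a ^ 2 ^ 2"
    using GL.r_inv[OF that] GL.l_inv[OF that] by (simp_all add: mult_GL2 one_GL2)
  have cancel: "X ** (inv\<^bsub>GL2\<^esub> X ** M) = M" "inv\<^bsub>GL2\<^esub> X ** (X ** M) = M" if "X \<in> carrier GL2" for X M :: "'a ^ 2 ^ 2"
    using inv[OF that] by (simp_all add: matrix_mul_assoc)
  have conj_mult: "?c X M ** ?c X N = ?c X (M ** N)" if "X \<in> carrier GL2" for X M N :: "'a ^ 2 ^ 2"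
    using that by (simp add: matrix_mul_assoc[symmetric] cancel)
  have conj_smult: "?c X (mat c ** M) = mat c ** ?c X M" for X M :: "'a ^ 2 ^ 2" and c
    by (simp add: matrix_mul_assoc[symmetric] mat_left_commute)
  have conj_mat: "?c X (mat c) = mat c" if "X \<in> carrier GL2" for X :: "'a ^ 2 ^ 2" and c
    using conj_smult[of X c "mat 1"] inv[OF that] by simp
  have conj_det: "det (?c X M) = det M" if "X \<in> carrier GL2" for X M :: "'a ^ 2 ^ 2"
  proof -
    have "det X * det (inv\<^bsub>GL2\<^esub> X) = 1" using inv(1)[OF that] by (metis det_I det_mul)
    then show ?thesis by (simp add: det_mul)
  qed
  define R where "R = {(M, N). M \<in> carrier SL2 \<and> N \<in> carrier SL2 \<and> M ** M = mat (- 1) \<and> N ** N = mat (- 1) \<and> M ** N = mat (- 1) ** (N ** M :: 'a ^ 2 ^ 2)}"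
  have "finite R" by simp
  have "card (carrier (GL2 :: ('a ^ 2 ^ 2) monoid)) \<le> (?q - 1) * card R"
  proof (rule card_le_fibres[OF \<open>finite R\<close>, where f = "\<lambda>X. (?c X A, ?c X B)"])
    fix X :: "'a ^ 2 ^ 2" assume X: "X \<in> carrier GL2"
    have "?c X A ** ?c X A = mat (- 1)" "?c X B ** ?c X B = mat (- 1)"
      using X by (simp_all only: conj_mult A B conj_mat)
    moreover have "?c X A ** ?c X B = mat (- 1) ** (?c X B ** ?c X A)"
      using X by (simp only: conj_mult conj_smult AB)
    ultimately show "(?c X A, ?c X B) \<in> R"
      using A B conj_det[OF X] by (simp add: R_def SL2_def)
  next
    fix r
    show "card {X \<in> carrier GL2. (?c X A, ?c X B) = r} \<le> ?q - 1"
    proof (cases "{X \<in> carrier GL2. (?c X A, ?c X B) = r} = {}")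
      case False
      then obtain Y where Y: "Y \<in> carrier GL2" "(?c Y A, ?c Y B) = r" by auto
      \<comment> \<open>Two conjugators with the same effect on \<open>A\<close> and
        \<open>B\<close> differ by an element of the centralizer of the pair.\<close>
      have "{X \<in> carrier GL2. (?c X A, ?c X B) = r} \<subseteq> (\<lambda>Z. Y ** Z) ` (carrier GL2 \<inter> range mat)"
      proof
        fix X assume "X \<in> {X \<in> carrier GL2. (?c X A, ?c X B) = r}"
        then have X: "X \<in> carrier GL2" "?c X A = ?c Y A" "?c X B = ?c Y B" using Y by auto
        let ?Z = "inv\<^bsub>GL2\<^esub> Y ** X"
        have comm': "?Z ** M = M ** ?Z" if "?c X M = ?c Y M" for M
        proof -
          have "?Z ** M = inv\<^bsub>GL2\<^esub> Y ** (?c X M) ** X"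
            using inv[OF X(1)] by (simp add: matrix_mul_assoc[symmetric])
          also have "\<dots> = inv\<^bsub>GL2\<^esub> Y ** (?c Y M) ** X" using that by simp
          also have "\<dots> = M ** ?Z"
            using Y(1) by (simp add: matrix_mul_assoc[symmetric] cancel)
          finally show ?thesis .
        qed
        have "?Z \<in> range mat" using comm comm' X by blast
        moreover have "?Z \<in> carrier GL2"
          using X(1) Y(1) GL.m_closed[of "inv\<^bsub>GL2\<^esub> Y" X] by (simp add: mult_GL2)
        moreover have "X = Y ** ?Z" using Y(1) by (simp add: cancel)
        ultimately show "X \<in> (\<lambda>Z. Y ** Z) ` (carrier GL2 \<inter> range mat)" by blast
      qed
      then have "card {X \<in> carrier GL2. (?c X A, ?c X B) = r} \<le> card ((\<lambda>Z. Y ** Z) ` (carrier GL2 \<inter> range mat))"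
        by (rule card_mono[rotated]) simp
      also have "\<dots> \<le> card (carrier GL2 \<inter> range (mat :: 'a \<Rightarrow> 'a ^ 2 ^ 2))" by (rule card_image_le) simp
      finally show ?thesis by (simp add: card_GL2_scalars)
    next
      case True
      show ?thesis unfolding True by simp
    qed
  qed
  then have "(?q - 1) * card (carrier (SL2 :: ('a ^ 2 ^ 2) monoid)) \<le> (?q - 1) * card R"
    by (simp only: card_GL2)
  moreover have "?q - 1 > 0" using CARD_field_ge_2[where 'a = 'a] by simp
  ultimately have 1: "?q * (?q ^ 2 - 1) \<le> card R" by (simp add: card_SL2)
  have "card R \<le> 4 * card (klein_pairs PSL2 (carrier (PSL2 :: ('a ^ 2 ^ 2) set monoid)))"
  proof (rule card_le_fibres[where f = "\<lambda>(M, N). (psl M, psl N)"])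
    fix r assume "r \<in> R"
    then obtain M N :: "'a ^ 2 ^ 2" where r: "r = (M, N)" and MN: "M \<in> carrier SL2" "N \<in> carrier SL2"
      "M ** M = mat (- 1)" "N ** N = mat (- 1)" "M ** N = mat (- 1) ** (N ** M)"
      by (auto simp: R_def)
    have m1: "mat (- 1 :: 'a) \<in> carrier SL2" by (simp add: mat_eq_m2)
    have pm1: "psl (mat (- 1 :: 'a)) = \<one>\<^bsub>PSL2\<^esub>" using psl_eq_one_iff[OF m1] by simp
    \<comment> \<open>Proportional matrices commute. In odd characteristic they can anticommute as
      well only if the factor \<open>c\<close> is 0, since \<open>M'\<close> squares to
      \<open>mat (-1)\<close>.\<close>
    have ns: False if "mat c ** M' = N'" "M' ** N' = mat (- 1) ** (N' ** M')" "M' ** M' = mat (-1)" "N' \<in> carrier SL2" for c and M' N' :: "'a ^ 2 ^ 2"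
    proof -
      have "M' ** N' = mat c ** mat (- 1)" "N' ** M' = mat c ** mat (- 1)"
        unfolding that(1)[symmetric] using that(3) by (simp_all add: mat_left_commute matrix_mul_assoc[symmetric])
      then have "mat (- c) = (mat c :: 'a ^ 2 ^ 2)" using that(2) by (simp add: mat_mult_mat)
      then have "c = 0" by (rule half)
      then have "N' = m2 0 0 0 0" using that(1) by (cases M') (auto simp: mat_eq_m2)
      then show False using that(4) by simp
    qed
    have sq: "psl M \<noteq> \<one>\<^bsub>PSL2\<^esub>" "psl N \<noteq> \<one>\<^bsub>PSL2\<^esub>" "psl M \<noteq> psl N"
    proof -
      have s1: False if XY: "psl X = \<one>\<^bsub>PSL2\<^esub>" "X \<in> carrier SL2" "Y \<in> carrier SL2" "X ** Y = mat (- 1) ** (Y ** X)" for X Y :: "'a ^ 2 ^ 2"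
      proof -
        obtain c where c: "X = mat c" using XY(1,2) psl_eq_one_iff[of X] by auto
        have "mat c ** Y = mat (- c) ** Y"
          using XY(4) unfolding c mat_mult_commute[of c Y, symmetric] by (simp add: matrix_mul_assoc mat_mult_mat)
        then have "mat c ** (Y ** adj2 Y) = mat (- c) ** (Y ** adj2 Y)" by (simp add: matrix_mul_assoc)
        then have "mat c = (mat (- c) :: 'a ^ 2 ^ 2)" using adj2_SL2(3)[OF XY(3)] by simp
        then have "c = 0" by (intro half) (rule sym)
        then show False using XY(2) c by (simp add: mat_eq_m2)
      qed
      have "N ** M = mat (- 1) ** (M ** N)" unfolding MN(5) by (simp add: matrix_mul_assoc mat_mult_mat)
      then show "psl M \<noteq> \<one>\<^bsub>PSL2\<^esub>" "psl N \<noteq> \<one>\<^bsub>PSL2\<^esub>" using s1 MN by blast+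
      show "psl M \<noteq> psl N"
      proof
        assume "psl M = psl N"
        then obtain c where "N = mat c ** M" using psl_eq_iff[OF MN(2,1)] by auto
        then show False using ns[of c M N] MN by auto
      qed
    qed
    moreover have "psl M \<otimes>\<^bsub>PSL2\<^esub> psl M = \<one>\<^bsub>PSL2\<^esub>" "psl N \<otimes>\<^bsub>PSL2\<^esub> psl N = \<one>\<^bsub>PSL2\<^esub>"
      using MN pm1 by (simp_all add: psl_mult[symmetric])
    moreover have "psl M \<otimes>\<^bsub>PSL2\<^esub> psl N = psl N \<otimes>\<^bsub>PSL2\<^esub> psl M"
    proof -
      have "psl (M ** N) = psl (N ** M)"
        using psl_eq_iff[OF mult_SL2[OF MN(1,2)] mult_SL2[OF MN(2,1)]] MN(5) by blast
      then show ?thesis using MN(1,2) by (simp only: psl_mult)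
    qed
    ultimately show "(case r of (M, N) \<Rightarrow> (psl M, psl N)) \<in> klein_pairs PSL2 (carrier PSL2)"
      using MN by (simp add: r klein_pairs_def)
  next
    fix s
    show "card {r \<in> R. (case r of (M, N) \<Rightarrow> (psl M, psl N)) = s} \<le> 4"
    proof (cases "{r \<in> R. (case r of (M, N) \<Rightarrow> (psl M, psl N)) = s} = {}")
      case False
      then obtain M N :: "'a ^ 2 ^ 2" where MN: "(M, N) \<in> R" "(psl M, psl N) = s" by auto
      let ?Z = "carrier SL2 \<inter> range (mat :: 'a \<Rightarrow> 'a ^ 2 ^ 2)"
      have sc: "X \<in> (\<lambda>Z. Z ** Y) ` ?Z" if XY: "X \<in> carrier SL2" "Y \<in> carrier SL2" "psl X = psl Y" for X Y
      proof -
        obtain c where c: "X = mat c ** Y" using psl_eq_iff XY by blast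
        then have "det X = c * c * det Y" by (simp add: det_mul det_mat2)
        then have "mat c \<in> carrier (SL2 :: ('a ^ 2 ^ 2) monoid)" using XY by (simp add: SL2_def det_mat2)
        then show ?thesis using c by auto
      qed
      have "{r \<in> R. (case r of (M, N) \<Rightarrow> (psl M, psl N)) = s} \<subseteq> ((\<lambda>Z. Z ** M) ` ?Z) \<times> ((\<lambda>Z. Z ** N) ` ?Z)"
        using MN sc by (auto simp: R_def)
      then have "card {r \<in> R. (case r of (M, N) \<Rightarrow> (psl M, psl N)) = s} \<le> card (((\<lambda>Z. Z ** M) ` ?Z) \<times> ((\<lambda>Z. Z ** N) ` ?Z))"
        by (rule card_mono[rotated]) simp
      also have "\<dots> = card ((\<lambda>Z. Z ** M) ` ?Z) * card ((\<lambda>Z. Z ** N) ` ?Z)" by (rule card_cartesian_product)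
      also have "\<dots> \<le> card ?Z * card ?Z" by (intro mult_mono card_image_le) auto
      also have "\<dots> = 4" using odd by (simp add: card_SL2_scalars)
      finally show ?thesis .
    next
      case True
      show ?thesis unfolding True by simp
    qed
  qed (auto simp: klein_pairs_def intro: finite_subset[of _ "UNIV"])
  then show ?thesis using 1 order_PSL2[where 'a = 'a] odd by simp
qed

context psl2_design
begin

lemma act_closed: "g \<in> carrier G \<Longrightarrow> x \<in> P \<Longrightarrow> \<phi> g x \<in> P"
  by (rule element_image) auto

text \<open>
  The Klein group permutes the \<open>l\<close> blocks through a regular orbit, and \<open>l\<close> is odd.
\<close>

lemma klein_orbit_fixed_block:
  assumes "odd l" and uv: "(u, v) \<in> klein_pairs G (carrier G)"
    and x: "x \<in> P" "\<phi> u x \<noteq> x" "\<phi> v x \<noteq> x" "\<phi> (u \<otimes>\<^bsub>G\<^esub> v) x \<noteq> x"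
  obtains C where "C \<in> \<B>" "x \<in> C" "u \<in> G\<^sub>b C" "v \<in> G\<^sub>b C"
proof -
  have uv': "u \<in> carrier G" "v \<in> carrier G" "u \<otimes>\<^bsub>G\<^esub> u = \<one>\<^bsub>G\<^esub>" "v \<otimes>\<^bsub>G\<^esub> v = \<one>\<^bsub>G\<^esub>" "u \<otimes>\<^bsub>G\<^esub> v = v \<otimes>\<^bsub>G\<^esub> u"
    using uv by (auto simp: klein_pairs_def)
  define y where "y = \<phi> u x"
  define z where "z = \<phi> v x"
  define w where "w = \<phi> u z"
  have P: "y \<in> P" "z \<in> P" "w \<in> P" using act_closed uv'(1,2) x(1) by (simp_all add: y_def z_def w_def)
  have uu: "\<phi> u (\<phi> u a) = a" and vv: "\<phi> v (\<phi> v a) = a" and vu: "\<phi> v (\<phi> u a) = \<phi> u (\<phi> v a)" if "a \<in> P" for a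
    using composition_rule[OF that uv'(1,1)] composition_rule[OF that uv'(2,2)] composition_rule[OF that uv'(2,1)]
      composition_rule[OF that uv'(1,2)] uv'(3-5) act_one[OF that] by simp_all
  have "w = \<phi> (u \<otimes>\<^bsub>G\<^esub> v) x" using composition_rule[OF x(1) uv'(1,2)] by (simp add: w_def z_def)
  then have "w \<noteq> x" using x by simp
  have ne: "x \<noteq> y" "x \<noteq> z" "x \<noteq> w" using x \<open>w \<noteq> x\<close> by (auto simp: y_def z_def)
  have uz: "\<phi> u z = w" "\<phi> u y = x" "\<phi> u w = z" "\<phi> u x = y" using uu[OF x(1)] uu[OF P(2)] by (simp_all add: y_def w_def)
  have vz: "\<phi> v x = z" "\<phi> v z = x" "\<phi> v y = w" "\<phi> v w = y"
    using vv[OF x(1)] vu[OF x(1)] vu[OF P(2)] by (simp_all add: y_def z_def w_def)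
  have "y \<noteq> z" "y \<noteq> w" "z \<noteq> w" using uz vz ne by metis+
  with ne have T: "card {x, y, z, w} = 4" by simp
  have Tu: "\<phi> u ` {x, y, z, w} = {x, y, z, w}" and Tv: "\<phi> v ` {x, y, z, w} = {x, y, z, w}"
    by (simp_all only: image_insert image_empty uz vz) blast+
  have "{x, y, z, w} \<subseteq> P" using P x(1) by simp
  then obtain C where C: "C \<in> \<B>" "{x, y, z, w} \<subseteq> C" "u \<in> G\<^sub>b C" "v \<in> G\<^sub>b C"
    by (rule invariant_block[OF \<open>odd l\<close> uv'(1,2,3) disjI1[OF uv'(4)] uv'(5) _ T Tu Tv])
  show thesis by (rule that[of C]) (use C in auto)
qed

lemma card_fixed_points_le:
  assumes "g \<in> carrier G" "g \<noteq> \<one>\<^bsub>G\<^esub>"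
  shows "card {x \<in> P. \<phi> g x = x} \<le> 2"
proof (rule ccontr)
  assume "\<not> ?thesis"
  then have "3 \<le> card {x \<in> P. \<phi> g x = x}" by simp
  then obtain S where S: "S \<subseteq> {x \<in> P. \<phi> g x = x}" "card S = 3" "finite S"
    by (rule obtain_subset_with_card_n)
  then obtain x y z where "S = {x, y, z}" "x \<noteq> y" "x \<noteq> z" "y \<noteq> z"
    using card_3_iff[of S] by blast
  with S have "{x, y, z} \<subseteq> {x \<in> P. \<phi> g x = x}" "x \<noteq> y" "x \<noteq> z" "y \<noteq> z" by simp_all
  then show False using three_fixed_points[of g x y z] assms by auto
qed

text \<open>
  A Klein four-group moves all but at most six points regularly, so the blocks it fixes cover
  at least \<open>q - 5\<close> points; the bound is a double count of pairs of a Klein group and a block fixed by it.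
\<close>

lemma klein_counting_bound:
  assumes "odd l" "odd q" "B \<in> \<B>" and N: "\<And>C. C \<in> \<B> \<Longrightarrow> card (klein_pairs G (G\<^sub>b C)) \<le> N"
  shows "(q - 5) * card (G\<^sub>b B) \<le> 2 * k * N"
proof -
  let ?K = "klein_pairs G (carrier G)"
  let ?F = "\<lambda>uv. {C \<in> \<B>. fst uv \<in> G\<^sub>b C \<and> snd uv \<in> G\<^sub>b C}"
  have "finite ?K" by (rule finite_subset[of _ UNIV]) auto
  have cover: "q - 5 \<le> k * card (?F uv)" if "uv \<in> ?K" for uv
  proof -
    obtain u v where uv: "uv = (u, v)" by (cases uv)
    have K: "(u, v) \<in> ?K" using that uv by simp
    then have g: "u \<in> carrier G" "v \<in> carrier G" "u \<noteq> \<one>\<^bsub>G\<^esub>" "v \<noteq> \<one>\<^bsub>G\<^esub>" "u \<otimes>\<^bsub>G\<^esub> u = \<one>\<^bsub>G\<^esub>" "u \<noteq> v"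
      by (simp_all add: klein_pairs_def)
    then have uv1: "u \<otimes>\<^bsub>G\<^esub> v \<noteq> \<one>\<^bsub>G\<^esub>" by (metis Units_eq Units_l_cancel)
    let ?fix = "\<lambda>g. {x \<in> P. \<phi> g x = x}"
    have "P - (?fix u \<union> ?fix v \<union> ?fix (u \<otimes>\<^bsub>G\<^esub> v)) \<subseteq> \<Union> (?F uv)"
    proof
      fix x assume "x \<in> P - (?fix u \<union> ?fix v \<union> ?fix (u \<otimes>\<^bsub>G\<^esub> v))"
      then obtain C where "C \<in> \<B>" "x \<in> C" "u \<in> G\<^sub>b C" "v \<in> G\<^sub>b C"
        using klein_orbit_fixed_block[OF \<open>odd l\<close> K, of x] by auto
      then show "x \<in> \<Union> (?F uv)" using uv by auto
    qed
    moreover have "finite (\<Union> (?F uv))"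
      using block(1) by (intro finite_subset[OF _ finite_P]) blast
    ultimately have "card (P - (?fix u \<union> ?fix v \<union> ?fix (u \<otimes>\<^bsub>G\<^esub> v))) \<le> card (\<Union> (?F uv))"
      by (metis (no_types, lifting) card_mono)
    also have "\<dots> \<le> (\<Sum>C\<in>?F uv. card C)" by (rule card_Union_le_sum_card)
    also have "\<dots> = k * card (?F uv)" using block by simp
    finally have "card (P - (?fix u \<union> ?fix v \<union> ?fix (u \<otimes>\<^bsub>G\<^esub> v))) \<le> k * card (?F uv)" .
    moreover have "card (P - (?fix u \<union> ?fix v \<union> ?fix (u \<otimes>\<^bsub>G\<^esub> v))) \<ge> card P - card (?fix u \<union> ?fix v \<union> ?fix (u \<otimes>\<^bsub>G\<^esub> v))"
      by (rule diff_card_le_card_Diff) (use finite_P in simp)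
    moreover have "card (?fix u \<union> ?fix v \<union> ?fix (u \<otimes>\<^bsub>G\<^esub> v)) \<le> 6"
      using card_Un_le[of "?fix u \<union> ?fix v" "?fix (u \<otimes>\<^bsub>G\<^esub> v)"] card_Un_le[of "?fix u" "?fix v"]
        card_fixed_points_le[of u] card_fixed_points_le[of v] card_fixed_points_le[OF m_closed[OF g(1,2)] uv1] g by linarith
    ultimately show ?thesis using card_P by linarith
  qed
  have "(q - 5) * card ?K = (\<Sum>uv\<in>?K. q - 5)" by simp
  also have "\<dots> \<le> (\<Sum>uv\<in>?K. k * card (?F uv))" using cover by (rule sum_mono)
  also have "\<dots> = k * (\<Sum>uv\<in>?K. card (?F uv))" by (simp add: sum_distrib_left)
  also have "(\<Sum>uv\<in>?K. card (?F uv)) = (\<Sum>uv\<in>?K. \<Sum>C\<in>\<B>. if fst uv \<in> G\<^sub>b C \<and> snd uv \<in> G\<^sub>b C then 1 else 0)"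
    using finite_blocks by (intro sum.cong refl) (simp add: sum.If_cases Int_def)
  also have "\<dots> = (\<Sum>C\<in>\<B>. \<Sum>uv\<in>?K. if fst uv \<in> G\<^sub>b C \<and> snd uv \<in> G\<^sub>b C then 1 else 0)" by (rule sum.swap)
  also have "\<dots> = (\<Sum>C\<in>\<B>. card (klein_pairs G (G\<^sub>b C)))"
  proof (rule sum.cong[OF refl])
    fix C
    have "klein_pairs G (G\<^sub>b C) = {uv \<in> ?K. fst uv \<in> G\<^sub>b C \<and> snd uv \<in> G\<^sub>b C}"
      by (auto simp: klein_pairs_def)
    then show "(\<Sum>uv\<in>?K. if fst uv \<in> G\<^sub>b C \<and> snd uv \<in> G\<^sub>b C then 1 else 0) = card (klein_pairs G (G\<^sub>b C))"
      using \<open>finite ?K\<close> by (simp add: sum.If_cases Int_def)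
  qed
  also have "\<dots> \<le> (\<Sum>C\<in>\<B>. N)" using N by (rule sum_mono)
  finally have "(q - 5) * card ?K \<le> k * (card \<B> * N)" by simp
  then have "(q - 5) * (2 * card ?K) \<le> 2 * k * (card \<B> * N)" by simp
  moreover have "(q - 5) * order G \<le> (q - 5) * (2 * card ?K)"
    using card_klein_pairs_PSL2[where 'a = 'a] \<open>odd q\<close> CARD_q by (intro mult_left_mono) auto
  ultimately have "(q - 5) * (card \<B> * card (G\<^sub>b B)) \<le> 2 * k * (card \<B> * N)"
    unfolding card_blocks[OF \<open>B \<in> \<B>\<close>] by linarith
  then have "card \<B> * ((q - 5) * card (G\<^sub>b B)) \<le> card \<B> * (2 * k * N)" by (simp only: mult_ac)
  moreover have "card \<B> > 0" using \<open>B \<in> \<B>\<close> finite_blocks by (auto simp: card_gt_0_iff)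
  ultimately show ?thesis by simp
qed

end

section \<open>Block stabilizers \<open>A\<^sub>4\<close>, \<open>S\<^sub>4\<close> and \<open>A\<^sub>5\<close>\<close>

text \<open>An involution that moves only \<open>a\<close> and \<open>u a\<close> is a
  transposition, hence odd.\<close>

lemma even_involution_moves_four:
  assumes "permutation u" "evenperm u" "u \<circ> u = id" "u \<noteq> id"
  obtains S where "card S = 4" "\<forall>x\<in>S. u x \<noteq> x"
proof -
  have uu: "u (u x) = x" for x using assms(3) by (metis comp_apply id_apply)
  obtain a where a: "u a \<noteq> a" using assms(4) by (auto simp: fun_eq_iff)
  have "\<exists>c. c \<noteq> a \<and> c \<noteq> u a \<and> u c \<noteq> c"
  proof (rule ccontr)
    assume "\<not> ?thesis"
    then have "u = Transposition.transpose a (u a)" using uu by (auto simp: fun_eq_iff Transposition.transpose_def)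
    then have "\<not> evenperm u" using a evenperm_swap[of a "u a"] by simp
    then show False using assms by simp
  qed
  then obtain c where c: "c \<noteq> a" "c \<noteq> u a" "u c \<noteq> c" by blast
  have "card {a, u a, c, u c} = 4" using a c uu by (auto simp: card_insert_if) (metis uu)+
  moreover have "\<forall>x\<in>{a, u a, c, u c}. u x \<noteq> x" using a c uu by (metis insert_iff empty_iff)
  ultimately show thesis by (rule that)
qed

text \<open>Involutions with support exactly \<open>S\<close>; for four elements these are the
  products of two disjoint transpositions.\<close>

definition double_transpositions :: "'a set \<Rightarrow> ('a \<Rightarrow> 'a) set" where
  "double_transpositions S = {u. u \<circ> u = id \<and> (\<forall>x. x \<in> S \<longleftrightarrow> u x \<noteq> x)}"

text \<open>\<open>u\<close> is determined by the image of one point \<open>a\<close>, which is one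
  of the three other points of \<open>S\<close>.\<close>

lemma card_double_transpositions:
  assumes "card S = 4"
  shows "finite (double_transpositions S)" "card (double_transpositions S) \<le> 3"
proof -
  obtain a b c e where S: "S = {a, b, c, e}" "distinct [a, b, c, e]"
    using assms by (auto simp: card_Suc_eq numeral_eq_Suc)
  have inj: "inj_on (\<lambda>u. u a) (double_transpositions S)"
  proof (rule inj_onI)
    fix u v assume u: "u \<in> double_transpositions S" and v: "v \<in> double_transpositions S" and eq: "u a = v a"
    have uu: "u (u x) = x" and vv: "v (v x) = x" for x
      using u v unfolding double_transpositions_def by (metis (mono_tags, lifting) comp_apply id_apply mem_Collect_eq)+
    have mu: "x \<in> S \<longleftrightarrow> u x \<noteq> x" and mv: "x \<in> S \<longleftrightarrow> v x \<noteq> x" for x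
      using u v by (auto simp: double_transpositions_def)
    have cu: "u x \<in> S" and cv: "v x \<in> S" if "x \<in> S" for x using that uu vv mu mv by metis+
    show "u = v"
    proof
      fix x
      show "u x = v x"
      proof (cases "x \<in> S")
        case True
        \<comment> \<open>Beside \<open>a\<close> and \<open>u a\<close> two points remain, and they
          must be exchanged.\<close>
        have rest: "u x = v x" if x: "x \<in> S" "x \<noteq> a" "x \<noteq> u a"
        proof -
          have "u x \<in> S - {a, u a, x}" "v x \<in> S - {a, u a, x}"
            using x cu cv mu mv uu vv eq by (metis DiffI insertE empty_iff)+
          moreover have "card (S - {a, u a, x}) = 1"
            using x mu[of a] cu[of a] S assms by (subst card_Diff_subset) (auto simp: card_insert_if)
          ultimately show ?thesis by (metis card_1_singletonE singletonD)
        qed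
        then show ?thesis using True eq uu vv by metis
      next
        case False
        then have "u x = x" "v x = x" using mu mv by blast+
        then show ?thesis by simp
      qed
    qed
  qed
  have img: "(\<lambda>u. u a) ` double_transpositions S \<subseteq> S - {a}"
  proof
    fix y assume "y \<in> (\<lambda>u. u a) ` double_transpositions S"
    then obtain u where u: "u \<in> double_transpositions S" "y = u a" by blast
    then have "u (u a) = a" "\<And>x. x \<in> S \<longleftrightarrow> u x \<noteq> x"
      unfolding double_transpositions_def by (auto simp: fun_eq_iff)
    then show "y \<in> S - {a}" using u S by (metis DiffI insertI1 singletonD)
  qed
  have "finite (S - {a})" "card (S - {a}) = 3" using S assms by auto
  then show "finite (double_transpositions S)" "card (double_transpositions S) \<le> 3"
    using inj img by (metis finite_imageD finite_subset, metis card_image card_mono)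
qed

lemma card_distinct_pairs:
  assumes "finite D" "card D \<le> 3"
  shows "card {(u, v). u \<in> D \<and> v \<in> D \<and> u \<noteq> v} \<le> 6"
proof -
  have "{(u, v). u \<in> D \<and> v \<in> D \<and> u \<noteq> v} = D \<times> D - (\<lambda>u. (u, u)) ` D" by auto
  also have "card \<dots> = card D * card D - card D"
    using assms by (subst card_Diff_subset) (auto simp: card_image inj_on_def card_cartesian_product)
  also have "\<dots> \<le> 6"
  proof -
    have "card D = 0 \<or> card D = 1 \<or> card D = 2 \<or> card D = 3" using assms by linarith
    then show ?thesis by auto
  qed
  finally show ?thesis .
qed

text \<open>Every involution of A4 moves all four points, so there are at most three of them and six
  ordered pairs.\<close>

lemma klein_pairs_alt_4: "card (klein_pairs (alt_group 4) (carrier (alt_group 4))) \<le> 6"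
proof -
  let ?D = "double_transpositions {1..4::nat}"
  have D: "u \<in> ?D" if u: "u \<in> carrier (alt_group 4)" "u \<noteq> id" "u \<circ> u = id" for u
  proof -
    obtain S where S: "card S = 4" "\<forall>x\<in>S. u x \<noteq> x"
      using even_involution_moves_four u alt_group_carrier' alt_group_carrier by metis
    have out: "u x = x" if "x \<notin> {1..4}" for x using u that by (auto simp: alt_group_carrier permutes_def)
    then have "S \<subseteq> {1..4}" using S by blast
    then have "S = {1..4}" using S by (intro card_subset_eq) auto
    then show ?thesis using S out u by (auto simp: double_transpositions_def)
  qed
  have "klein_pairs (alt_group 4) (carrier (alt_group 4)) \<subseteq> {(u, v). u \<in> ?D \<and> v \<in> ?D \<and> u \<noteq> v}"
    using D by (auto simp: klein_pairs_def alt_group_mult alt_group_one)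
  moreover have D3: "finite ?D" "card ?D \<le> 3" by (rule card_double_transpositions, simp)+
  moreover have "finite {(u, v). u \<in> ?D \<and> v \<in> ?D \<and> u \<noteq> v}"
    by (rule finite_subset[OF _ finite_cartesian_product[OF D3(1) D3(1)]]) blast
  ultimately show ?thesis by (blast intro: order.trans[OF card_mono card_distinct_pairs])
qed

text \<open>Every involution of A5 fixes exactly one of the five points, and commuting involutions
  fix the same one; that leaves at most six pairs for each point.\<close>

lemma klein_pairs_alt_5: "card (klein_pairs (alt_group 5) (carrier (alt_group 5))) \<le> 30"
proof -
  let ?D = "\<lambda>i. double_transpositions ({1..5::nat} - {i})"
  let ?R = "\<lambda>i. {(u, v). u \<in> ?D i \<and> v \<in> ?D i \<and> u \<noteq> v}"
  have D: "\<exists>i\<in>{1..5}. u \<in> ?D i" if u: "u \<in> carrier (alt_group 5)" "u \<noteq> id" "u \<circ> u = id" for u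
  proof -
    obtain S where S: "card S = 4" "\<forall>x\<in>S. u x \<noteq> x"
      using even_involution_moves_four u alt_group_carrier' alt_group_carrier by metis
    have perm: "u permutes {1..5}" using u by (simp add: alt_group_carrier)
    have out: "u x = x" if "x \<notin> {1..5}" for x using perm that by (auto simp: permutes_def)
    have "odd (card {x \<in> {1..5}. u x = x})"
    proof (rule odd_card_fixed_points)
      show "u x \<in> {1..5}" if "x \<in> {1..5}" for x using permutes_in_image[OF perm] that by blast
      show "u (u x) = x" for x using u(3) by (metis comp_apply id_apply)
    qed simp_all
    then have "{x \<in> {1..5}. u x = x} \<noteq> {}" by (metis card.empty even_zero)
    then obtain i where i: "i \<in> {1..5}" "u i = i" by auto
    have "S \<subseteq> {1..5} - {i}" using S out i by blast
    then have "S = {1..5} - {i}" using S i by (intro card_subset_eq) (auto simp: card_Diff_singleton)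
    then have "u \<in> ?D i" using S out u i by (auto simp: double_transpositions_def)
    then show ?thesis using i by blast
  qed
  have "klein_pairs (alt_group 5) (carrier (alt_group 5)) \<subseteq> (\<Union>i\<in>{1..5}. ?R i)"
  proof
    fix r assume "r \<in> klein_pairs (alt_group 5) (carrier (alt_group 5))"
    then obtain u v where r: "r = (u, v)" and uv: "u \<in> carrier (alt_group 5)" "v \<in> carrier (alt_group 5)"
      "u \<noteq> id" "v \<noteq> id" "u \<noteq> v" "u \<circ> u = id" "v \<circ> v = id" "u \<circ> v = v \<circ> u"
      by (auto simp: klein_pairs_def alt_group_mult alt_group_one)
    obtain i where i: "i \<in> {1..5}" "u \<in> ?D i" using D uv by blast
    obtain j where j: "j \<in> {1..5}" "v \<in> ?D j" using D uv by blast
    have ui: "u x = x \<longleftrightarrow> x \<notin> {1..5} - {i}" for x using i by (auto simp: double_transpositions_def)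
    have vj: "v x = x \<longleftrightarrow> x \<notin> {1..5} - {j}" for x using j by (auto simp: double_transpositions_def)
    \<comment> \<open>\<open>v\<close> maps fixed points of \<open>u\<close> to fixed points of
      \<open>u\<close>, and within \<open>{1..5}\<close> only \<open>i\<close> is fixed.\<close>
    have "u (v i) = v i" using uv(8) ui[of i] by (metis DiffE comp_apply singletonI)
    moreover have "v i \<in> {1..5}" using permutes_in_image[of v "{1..5}"] uv(2) i alt_group_carrier by blast
    ultimately have "v i = i" using ui[of "v i"] by blast
    then have "i = j" using vj[of i] i by blast
    then show "r \<in> (\<Union>i\<in>{1..5}. ?R i)" using r uv i j by auto
  qed
  moreover have D3: "finite (?D i)" "card (?D i) \<le> 3" if "i \<in> {1..5}" for i
    by (rule card_double_transpositions, use that in \<open>simp add: card_Diff_singleton\<close>)+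
  moreover have fin: "finite (?R i)" if "i \<in> {1..5}" for i
    by (rule finite_subset[OF _ finite_cartesian_product[OF D3(1) D3(1)]]) (use that in blast)+
  ultimately have "card (klein_pairs (alt_group 5) (carrier (alt_group 5))) \<le> card (\<Union>i\<in>{1..5}. ?R i)"
    by (intro card_mono finite_UN_I) auto
  also have "\<dots> \<le> (\<Sum>i\<in>{1..5}. card (?R i))" by (rule card_UN_le) simp
  also have "\<dots> \<le> (\<Sum>i\<in>{1..5::nat}. 6)" by (intro sum_mono card_distinct_pairs D3) auto
  finally show ?thesis by simp
qed

text \<open>A permutation of \<open>{1, 2, 3, 4}\<close> is coded by the quadruple of its values.\<close>

fun quad_apply :: "nat \<times> nat \<times> nat \<times> nat \<Rightarrow> nat \<Rightarrow> nat" where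
  "quad_apply (a, b, c, e) i = (if i = 1 then a else if i = 2 then b else if i = 3 then c else e)"

definition involution_quads :: "(nat \<times> nat \<times> nat \<times> nat) list" where
  "involution_quads = filter (\<lambda>t. list_all (\<lambda>i. quad_apply t (quad_apply t i) = i) [1, 2, 3, 4] \<and> t \<noteq> (1, 2, 3, 4))
    (List.product [1, 2, 3, 4] (List.product [1, 2, 3, 4] (List.product [1, 2, 3, 4] [1, 2, 3, 4])))"

definition klein_quads :: "((nat \<times> nat \<times> nat \<times> nat) \<times> (nat \<times> nat \<times> nat \<times> nat)) list" where
  "klein_quads = filter (\<lambda>(s, t). s \<noteq> t \<and> list_all (\<lambda>i. quad_apply s (quad_apply t i) = quad_apply t (quad_apply s i)) [1, 2, 3, 4])
    (List.product involution_quads involution_quads)"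

lemma involution_quads_eq: "involution_quads =
    [(1, 2, 4, 3), (1, 3, 2, 4), (1, 4, 3, 2), (2, 1, 3, 4), (2, 1, 4, 3), (3, 2, 1, 4), (3, 4, 1, 2), (4, 2, 3, 1), (4, 3, 2, 1)]"
  unfolding involution_quads_def by simp

lemma length_klein_quads: "length klein_quads = 24"
  unfolding klein_quads_def involution_quads_eq by simp

text \<open>In S4 transpositions occur too, as in the three Klein four-groups that are not normal.
  The support of an involution no longer controls the pairs, so they are enumerated.\<close>

lemma klein_pairs_sym_4: "card (klein_pairs (sym_group 4) (carrier (sym_group 4))) \<le> 24"
proof -
  let ?K = "klein_pairs (sym_group 4) (carrier (sym_group 4))"
  let ?t = "\<lambda>u :: nat \<Rightarrow> nat. (u 1, u 2, u 3, u 4)"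
  have cases4: "i = 1 \<or> i = 2 \<or> i = 3 \<or> i = 4" if "i \<in> {1..4}" for i :: nat using that by auto
  have ap: "quad_apply (?t u) i = u i" if "i \<in> {1..4}" for u i using cases4[OF that] by auto
  have inj: "u = v" if "u permutes {1..4}" "v permutes {1..4}" "?t u = ?t v" for u v
  proof
    fix x show "u x = v x"
      using that cases4[of x] by (cases "x \<in> {1..4}") (auto simp: permutes_def)
  qed
  have "inj_on (\<lambda>(u, v). (?t u, ?t v)) ?K"
    using inj by (auto simp: inj_on_def klein_pairs_def sym_group_carrier)
  moreover have "(\<lambda>(u, v). (?t u, ?t v)) ` ?K \<subseteq> set klein_quads"
  proof
    fix r assume "r \<in> (\<lambda>(u, v). (?t u, ?t v)) ` ?K"
    then obtain u v where r: "r = (?t u, ?t v)" and uv: "u permutes {1..4}" "v permutes {1..4}"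
      "u \<noteq> id" "v \<noteq> id" "u \<noteq> v" "u \<circ> u = id" "v \<circ> v = id" "u \<circ> v = v \<circ> u"
      by (auto simp: klein_pairs_def sym_group_mult sym_group_one sym_group_carrier)
    have mem: "?t w \<in> set involution_quads" if w: "w permutes {1..4}" "w \<noteq> id" "w \<circ> w = id" for w
    proof -
      have in4: "w i \<in> {1..4}" if "i \<in> {1..4}" for i using permutes_in_image[OF w(1)] that by simp
      have "w 1 \<in> {1..4}" "w 2 \<in> {1..4}" "w 3 \<in> {1..4}" "w 4 \<in> {1..4}" by (rule in4, simp)+
      then have 1: "w 1 \<in> set [1, 2, 3, 4]" "w 2 \<in> set [1, 2, 3, 4]" "w 3 \<in> set [1, 2, 3, 4]" "w 4 \<in> set [1, 2, 3, 4]"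
        using cases4 by (metis list.set_intros)+
      have 2: "quad_apply (?t w) (quad_apply (?t w) i) = i" if "i \<in> {1..4}" for i
        using ap[OF that] ap[OF in4[OF that]] w(3) by (metis comp_apply id_apply)
      have "?t w \<noteq> ?t id" using inj[OF w(1) permutes_id] w(2) by blast
      then have 3: "?t w \<noteq> (1, 2, 3, 4)" by simp
      show ?thesis
      proof -
        have "?t w \<in> set [1, 2, 3, 4] \<times> set [1, 2, 3, 4] \<times> set [1, 2, 3, 4] \<times> set [1, 2, 3, 4]"
          using 1 by (simp only: mem_Times_iff fst_conv snd_conv simp_thms)
        moreover have "\<forall>i\<in>set [1, 2, 3, 4]. quad_apply (?t w) (quad_apply (?t w) i) = i"
          using 2 by (simp del: quad_apply.simps)
        ultimately show ?thesis
          unfolding involution_quads_def set_filter set_product mem_Collect_eq list_all_iff using 3 by blast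
      qed
    qed
    have in4: "v i \<in> {1..4}" "u i \<in> {1..4}" if "i \<in> {1..4}" for i
      using permutes_in_image[OF uv(1)] permutes_in_image[OF uv(2)] that by simp_all
    have "quad_apply (?t u) (quad_apply (?t v) i) = quad_apply (?t v) (quad_apply (?t u) i)" if "i \<in> {1..4}" for i
      using ap[OF that] ap[OF in4(1)[OF that]] ap[OF in4(2)[OF that]] uv(8) by (metis comp_apply)
    then have "\<forall>i\<in>set [1, 2, 3, 4]. quad_apply (?t u) (quad_apply (?t v) i) = quad_apply (?t v) (quad_apply (?t u) i)"
      by (simp del: quad_apply.simps)
    moreover have "?t u \<noteq> ?t v" using inj uv by blast
    ultimately show "r \<in> set klein_quads"
      using mem[OF uv(1,3,6)] mem[OF uv(2,4,7)]
      unfolding r klein_quads_def set_filter set_product mem_Collect_eq list_all_iff prod.case by blast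
  qed
  ultimately have "card ?K \<le> card (set klein_quads)" by (rule card_inj_on_le) simp
  also have "\<dots> \<le> 24" using card_length[of klein_quads] length_klein_quads by simp
  finally show ?thesis .
qed

text \<open>If \<open>h \<circ> h\<close> moved a point, \<open>h\<close> would be a four-cycle, a
  product of three transpositions and hence odd.\<close>

lemma alt_4_no_element_of_order_4:
  assumes "h \<in> carrier (alt_group 4)" "h \<circ> h \<circ> h \<circ> h = id"
  shows "h \<circ> h = id"
proof (rule ccontr)
  assume "h \<circ> h \<noteq> id"
  then obtain x where x: "h (h x) \<noteq> x" by (auto simp: fun_eq_iff)
  have perm: "h permutes {1..4}" and even: "evenperm h" using assms by (auto simp: alt_group_carrier)
  have h4: "h (h (h (h y))) = y" for y using assms(2) by (metis comp_apply id_apply)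
  let ?y = "h x" and ?z = "h (h x)" and ?w = "h (h (h x))"
  have ne: "?y \<noteq> x" "?z \<noteq> x" "?w \<noteq> x" "?z \<noteq> ?y" "?w \<noteq> ?y" "?w \<noteq> ?z" using x h4 by metis+
  have mem: "x \<in> {1..4}" "?y \<in> {1..4}" "?z \<in> {1..4}" "?w \<in> {1..4}"
    using x perm by (metis permutes_in_image permutes_not_in)+
  have "{x, ?y, ?z, ?w} = {1..4}" using ne mem by (intro card_subset_eq) (auto simp: card_insert_if)
  then have fixed: "h i = i" if "i \<notin> {x, ?y, ?z, ?w}" for i using that perm by (metis permutes_not_in)
  have "h = Transposition.transpose x ?w \<circ> Transposition.transpose x ?z \<circ> Transposition.transpose x ?y"
  proof
    fix i
    show "h i = (Transposition.transpose x ?w \<circ> Transposition.transpose x ?z \<circ> Transposition.transpose x ?y) i"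
    proof -
      consider "i = x" | "i = ?y" | "i = ?z" | "i = ?w" | "i \<noteq> x \<and> i \<noteq> ?y \<and> i \<noteq> ?z \<and> i \<noteq> ?w" by blast
      then show ?thesis
        by cases (use ne ne[symmetric] h4[of x] fixed[of i] in \<open>simp_all add: Transposition.transpose_def\<close>)
    qed
  qed
  then have "evenperm (Transposition.transpose x ?w \<circ> Transposition.transpose x ?z \<circ> Transposition.transpose x ?y)" using even by simp
  then show False using ne by (simp add: evenperm_comp evenperm_swap permutation_compose permutation_swap_id)
qed

text \<open>The three-cycles (1 2 3) and (2 3 4). They refute \<open>k = q - 1\<close> for all three
  groups, since there elements of order 3 in the stabilizer would commute.\<close>

lemma noncommuting_three_cycles:
  fixes a b :: "nat \<Rightarrow> nat"
  defines "a \<equiv> Transposition.transpose 1 2 \<circ> Transposition.transpose 2 3" and "b \<equiv> Transposition.transpose 2 3 \<circ> Transposition.transpose 3 4"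
  shows "a \<circ> a \<circ> a = id" "b \<circ> b \<circ> b = id" "a \<circ> b \<noteq> b \<circ> a" "a \<noteq> id"
    and "n \<ge> 4 \<Longrightarrow> a permutes {1..n} \<and> b permutes {1..n}" "evenperm a" "evenperm b"
proof -
  show "a \<circ> a \<circ> a = id" "b \<circ> b \<circ> b = id" by (auto simp: a_def b_def fun_eq_iff Transposition.transpose_def)
  show "a \<circ> b \<noteq> b \<circ> a" by (auto simp: a_def b_def fun_eq_iff Transposition.transpose_def intro!: exI[of _ 1])
  show "a \<noteq> id" by (auto simp: a_def fun_eq_iff Transposition.transpose_def intro!: exI[of _ 1])
  show "n \<ge> 4 \<Longrightarrow> a permutes {1..n} \<and> b permutes {1..n}"
    unfolding a_def b_def by (auto intro!: permutes_compose permutes_swap_id)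
  show "evenperm a" "evenperm b"
    unfolding a_def b_def by (simp_all add: evenperm_comp evenperm_swap permutation_swap_id)
qed

section \<open>Numerical conditions for A4, S4 and A5\<close>

lemma power_two_bound:
  fixes l f c :: nat
  assumes "l * (2 ^ f - 2) = c" "l > 10" "c < 360426"
  shows "f < 15" "2 ^ f - 2 dvd c" "11 * (2 ^ f - 2) \<le> c"
proof -
  show dvd: "2 ^ f - 2 dvd c" using assms(1) by (metis dvd_triv_right)
  show le: "11 * (2 ^ f - 2) \<le> c" using assms(1,2) by (metis Suc_leI mult_le_mono1 numeral_eq_Suc pred_numeral_simps(3) BitM.simps(1) eval_nat_numeral(3))
  show "f < 15"
  proof (rule ccontr)
    assume "\<not> f < 15"
    \<comment> \<open>The constant 360426 is \<open>11 * (2 ^ 15 - 2)\<close>. It exceeds every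
      value of \<open>c\<close> that occurs, so a short list of exponents \<open>f\<close> remains
      to be tested.\<close>
    then have "(2::nat) ^ 15 \<le> 2 ^ f" by (intro power_increasing) auto
    then have "11 * (2 ^ 15 - 2) \<le> 11 * (2 ^ f - 2 :: nat)" by (intro mult_le_mono diff_le_mono) auto
    then show False using le assms(3) by simp
  qed
qed

text \<open>Divisibility leaves \<open>k = 12\<close> and \<open>k = 6\<close>, the second too small
  for \<open>l > 10\<close>. For odd \<open>q\<close> the product \<open>l * (q - 2)\<close> is 495,
  so \<open>l\<close> is odd and the Klein bound gives \<open>q \<le> 17\<close>; this removes
  \<open>q = 47\<close>, for instance.\<close>

lemma parameters_A4:
  fixes k l d q f :: nat
  assumes eq: "k * (k - 1) * (k - 2) * (k - 3) = l * d * (q - 2) * 12" and "k dvd 12" "k > 4" "k \<le> q" "l > 10"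
    and even: "even q \<Longrightarrow> d = 1 \<and> q = 2 ^ f" and odd: "odd q \<Longrightarrow> d = 2"
    and bound: "odd q \<Longrightarrow> odd l \<Longrightarrow> (q - 5) * 12 \<le> 2 * k * 6" and "q \<noteq> 15"
  shows "k = 12 \<and> (q = 13 \<or> (q = 17 \<and> odd l) \<or> q = 32)"
proof -
  obtain m where m: "12 = k * m" using \<open>k dvd 12\<close> by (elim dvdE)
  have "5 * m \<le> k * m" using \<open>k > 4\<close> by (intro mult_le_mono1) simp
  then have "m \<le> 2" using m by linarith
  then have "m = 1 \<or> m = 2" using m by (cases m) auto
  then have k: "k = 12 \<or> k = 6" using m by auto
  show ?thesis
  proof (cases "even q")
    case True
    then have d: "d = 1" "q = 2 ^ f" using even by auto
    from k show ?thesis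
    proof
      assume "k = 12"
      then have eq': "l * (2 ^ f - 2) = 990" using eq d by simp
      note b = power_two_bound[OF eq' \<open>l > 10\<close>, simplified]
      have "f \<in> set [0..<15]" using b by simp
      then show ?thesis using b d \<open>k = 12\<close> \<open>k \<le> q\<close> by (simp add: upt_rec[of _ 15]) (elim disjE; simp)
    next
      assume "k = 6"
      then have eq': "l * (2 ^ f - 2) = 30" using eq d by simp
      then show ?thesis using power_two_bound(3)[OF eq' \<open>l > 10\<close>] d \<open>k = 6\<close> \<open>k \<le> q\<close> by simp
    qed
  next
    case False
    then have d: "d = 2" using odd by auto
    from k show ?thesis
    proof
      assume "k = 12"
      then have eq': "l * (q - 2) = 495" using eq d by simp
      then have "odd (l * (q - 2))" by simp
      then have "odd l" by simp
      then have "q \<le> 17" using bound False \<open>k = 12\<close> by simp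
      then have "q \<in> {12, 13, 14, 15, 16, 17}" using \<open>k \<le> q\<close> \<open>k = 12\<close> by auto
      then show ?thesis using False \<open>q \<noteq> 15\<close> \<open>odd l\<close> \<open>k = 12\<close> by auto
    next
      assume "k = 6"
      then have eq': "l * (q - 2) = 15" using eq d by simp
      have "11 * (q - 2) \<le> l * (q - 2)" using \<open>l > 10\<close> by (intro mult_le_mono1) simp
      then show ?thesis using eq' \<open>k = 6\<close> \<open>k \<le> q\<close> by simp
    qed
  qed
qed

text \<open>The value \<open>q = 35\<close> with \<open>k = 24\<close> and \<open>l = 161\<close>
  passes both the equation and the Klein bound; it is excluded only because it is not a prime
  power.\<close>

lemma parameters_S4:
  fixes k l d q f :: nat
  assumes eq: "k * (k - 1) * (k - 2) * (k - 3) = l * d * (q - 2) * 24" and "k dvd 24" "k > 4" "k \<le> q" "l > 10"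
    and even: "even q \<Longrightarrow> d = 1 \<and> q = 2 ^ f" and odd: "odd q \<Longrightarrow> d = 2"
    and bound: "odd q \<Longrightarrow> odd l \<Longrightarrow> (q - 5) * 24 \<le> 2 * k * 24" and "q \<noteq> 35"
  shows "k = 24 \<and> q = 25"
proof -
  obtain m where m: "24 = k * m" using \<open>k dvd 24\<close> by (elim dvdE)
  have "5 * m \<le> k * m" using \<open>k > 4\<close> by (intro mult_le_mono1) simp
  then have "m \<le> 4" using m by linarith
  then have "m \<in> {0, 1, 2, 3, 4}" by auto
  then have k: "k = 24 \<or> k = 12 \<or> k = 8 \<or> k = 6" using m by auto
  have l11: "11 * (q - 2) \<le> l * (q - 2)" using \<open>l > 10\<close> by (intro mult_le_mono1) simp
  show ?thesis
  proof (cases "even q")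
    case True
    then have d: "d = 1" "q = 2 ^ f" using even by auto
    have False if eq': "l * (2 ^ f - 2) = c" and c: "c \<in> {10626, 495, 70, 15}" "c = 10626 \<Longrightarrow> 24 \<le> q" "c = 495 \<Longrightarrow> 12 \<le> q"
      "c = 70 \<Longrightarrow> 8 \<le> q" "c = 15 \<Longrightarrow> 6 \<le> q" for c
    proof -
      have "c < 360426" using c by auto
      note b = power_two_bound[OF eq' \<open>l > 10\<close> this]
      have "f \<in> set [0..<15]" using b by simp
      then show False using b c d by (simp add: upt_rec[of _ 15]) (elim disjE; simp)
    qed
    then show ?thesis using k eq d \<open>k \<le> q\<close> by (elim disjE) force+
  next
    case False
    then have d: "d = 2" using odd by auto
    from k show ?thesis
    proof (elim disjE)
      assume "k = 24"
      then have eq': "l * (q - 2) = 5313" using eq d by simp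
      then have "odd (l * (q - 2))" by simp
      then have "odd l" by simp
      then have "q \<le> 53" using bound False \<open>k = 24\<close> by simp
      then have "q \<in> set [24..<54]" using \<open>k \<le> q\<close> \<open>k = 24\<close> unfolding set_upt by simp
      moreover have "q - 2 dvd 5313" using eq' by (metis dvd_triv_right)
      ultimately show ?thesis using False \<open>q \<noteq> 35\<close> \<open>k = 24\<close> by (simp add: upt_rec[of _ 54]) (elim disjE; simp)
    next
      assume "k = 12"
      then have "2 * (l * (q - 2)) = 495" using eq d by simp
      then show ?thesis by presburger
    next
      assume "k = 8"
      then have eq': "l * (q - 2) = 35" using eq d by simp
      then show ?thesis using l11 \<open>k = 8\<close> \<open>k \<le> q\<close> by simp
    next
      assume "k = 6"
      then have "2 * (l * (q - 2)) = 15" using eq d by simp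
      then show ?thesis by presburger
    qed
  qed
qed

text \<open>The pairs \<open>k = 15\<close>, \<open>q = 15\<close> and \<open>k = 20\<close>,
  \<open>q = 21\<close> satisfy all numerical conditions and are excluded only because these
  \<open>q\<close> are not prime powers.\<close>

lemma parameters_A5:
  fixes k l d q f :: nat
  assumes eq: "k * (k - 1) * (k - 2) * (k - 3) = l * d * (q - 2) * 60" and "k dvd 60" "k > 4" "k \<le> q" "l > 10"
    and even: "even q \<Longrightarrow> d = 1 \<and> q = 2 ^ f" and odd: "odd q \<Longrightarrow> d = 2"
    and bound: "odd q \<Longrightarrow> odd l \<Longrightarrow> (q - 5) * 60 \<le> 2 * k * 30" and "q \<noteq> 15" "q \<noteq> 21"
  shows "(k = 15 \<and> q = 16) \<or> (k = 60 \<and> q = 61) \<or> (k = 30 \<and> (q = 31 \<or> q = 128))"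
proof -
  obtain m where m: "60 = k * m" using \<open>k dvd 60\<close> by (elim dvdE)
  have "5 * m \<le> k * m" using \<open>k > 4\<close> by (intro mult_le_mono1) simp
  then have "m \<le> 12" using m by linarith
  then have "m = 0 \<or> m = 1 \<or> m = 2 \<or> m = 3 \<or> m = 4 \<or> m = 5 \<or> m = 6 \<or> m = 7 \<or> m = 8 \<or> m = 9 \<or> m = 10 \<or> m = 11 \<or> m = 12"
    by presburger
  then have k: "k = 60 \<or> k = 30 \<or> k = 20 \<or> k = 15 \<or> k = 12 \<or> k = 10 \<or> k = 6 \<or> k = 5"
    using m by (elim disjE) (simp_all, presburger+)
  have l11: "11 * (q - 2) \<le> l * (q - 2)" using \<open>l > 10\<close> by (intro mult_le_mono1) simp
  \<comment> \<open>For these \<open>k\<close> the product \<open>l * d * (q - 2)\<close> is too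
    small for \<open>l > 10\<close> and \<open>q \<ge> k\<close>; only \<open>k = 12\<close> with
    even \<open>q\<close> needs a look at the powers of two.\<close>
  have small: "k \<noteq> 12" "k \<noteq> 10" "k \<noteq> 6" "k \<noteq> 5"
  proof -
    have "11 * (d * (q - 2)) \<le> l * (d * (q - 2))" using \<open>l > 10\<close> by (intro mult_le_mono1) simp
    then have b: "11 * (d * (q - 2)) \<le> l * d * (q - 2)" by (simp add: mult.assoc)
    have "d \<ge> 1" using even odd by (cases "even q") auto
    then have "1 * (q - 2) \<le> d * (q - 2)" by (intro mult_le_mono1)
    then have b': "11 * (q - 2) \<le> l * d * (q - 2)" using b by linarith
    show "k \<noteq> 10" "k \<noteq> 6" "k \<noteq> 5"
    proof -
      define X where "X = l * d * (q - 2)"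
      have "11 * (q - 2) \<le> X" "k * (k - 1) * (k - 2) * (k - 3) = X * 60" using b' eq unfolding X_def by simp_all
      then show "k \<noteq> 10" "k \<noteq> 6" "k \<noteq> 5" using \<open>k \<le> q\<close> by auto
    qed
    show "k \<noteq> 12"
    proof
      assume k12: "k = 12"
      show False
      proof (cases "even q")
        case True
        then have d: "d = 1" "q = 2 ^ f" using even by auto
        have eq': "l * (2 ^ f - 2) = 198" using eq d k12 by simp
        note b = power_two_bound[OF eq' \<open>l > 10\<close>, simplified]
        have "f \<in> set [0..<15]" using b by simp
        then show False using b d k12 \<open>k \<le> q\<close> by (simp add: upt_rec[of _ 15]) (elim disjE; simp)
      next
        case False
        then have "d = 2" using odd by simp
        then have "l * (q - 2) = 99" using eq k12 by simp
        then have "11 * (q - 2) \<le> 99" using l11 by linarith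
        then show False using \<open>k \<le> q\<close> k12 by linarith
      qed
    qed
  qed
  then have k: "k = 60 \<or> k = 30 \<or> k = 20 \<or> k = 15" using k by blast
  show ?thesis
  proof (cases "even q")
    case True
    then have d: "d = 1" "q = 2 ^ f" using even by auto
    from k show ?thesis
    proof (elim disjE)
      assume k: "k = 60"
      have eq': "l * (2 ^ f - 2) = 195054" using eq d k by simp
      note b = power_two_bound[OF eq' \<open>l > 10\<close>, simplified]
      have "f \<in> set [0..<15]" using b by simp
      then show ?thesis using b d k \<open>k \<le> q\<close> by (simp add: upt_rec[of _ 15]) (elim disjE; simp)
    next
      assume k: "k = 30"
      have eq': "l * (2 ^ f - 2) = 10962" using eq d k by simp
      note b = power_two_bound[OF eq' \<open>l > 10\<close>, simplified]
      have "f \<in> set [0..<15]" using b by simp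
      then show ?thesis using b d k \<open>k \<le> q\<close> by (simp add: upt_rec[of _ 15]) (elim disjE; simp)
    next
      assume k: "k = 20"
      have eq': "l * (2 ^ f - 2) = 1938" using eq d k by simp
      note b = power_two_bound[OF eq' \<open>l > 10\<close>, simplified]
      have "f \<in> set [0..<15]" using b by simp
      then show ?thesis using b d k \<open>k \<le> q\<close> by (simp add: upt_rec[of _ 15]) (elim disjE; simp)
    next
      assume k: "k = 15"
      have eq': "l * (2 ^ f - 2) = 546" using eq d k by simp
      note b = power_two_bound[OF eq' \<open>l > 10\<close>, simplified]
      have "f \<in> set [0..<15]" using b by simp
      then show ?thesis using b d k \<open>k \<le> q\<close> by (simp add: upt_rec[of _ 15]) (elim disjE; simp)
    qed
  next
    case False
    then have d: "d = 2" using odd by auto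
    have step: "odd l" if "l * (q - 2) = c" "odd c" for c using that by auto
    from k show ?thesis
    proof (elim disjE)
      assume k: "k = 60"
      have eq': "l * (q - 2) = 97527" using eq d k by simp
      have "q \<le> 65" using bound[OF False step[OF eq']] k by simp
      then have "q \<in> {60, 61, 62, 63, 64, 65}" using \<open>k \<le> q\<close> k by auto
      moreover have "q - 2 dvd 97527" using eq' by (metis dvd_triv_right)
      ultimately show ?thesis using False k by auto
    next
      assume k: "k = 30"
      have eq': "l * (q - 2) = 5481" using eq d k by simp
      have "q \<le> 35" using bound[OF False step[OF eq']] k by simp
      then have "q \<in> {30, 31, 32, 33, 34, 35}" using \<open>k \<le> q\<close> k by auto
      moreover have "q - 2 dvd 5481" using eq' by (metis dvd_triv_right)
      ultimately show ?thesis using False k by auto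
    next
      assume k: "k = 20"
      have eq': "l * (q - 2) = 969" using eq d k by simp
      have "q \<le> 25" using bound[OF False step[OF eq']] k by simp
      then have "q \<in> {20, 21, 22, 23, 24, 25}" using \<open>k \<le> q\<close> k by auto
      moreover have "q - 2 dvd 969" using eq' by (metis dvd_triv_right)
      ultimately show ?thesis using False k \<open>q \<noteq> 21\<close> by auto
    next
      assume k: "k = 15"
      have eq': "l * (q - 2) = 273" using eq d k by simp
      have "q \<le> 20" using bound[OF False step[OF eq']] k by simp
      then have "q \<in> {15, 16, 17, 18, 19, 20}" using \<open>k \<le> q\<close> k by auto
      moreover have "q - 2 dvd 273" using eq' by (metis dvd_triv_right)
      ultimately show ?thesis using False k \<open>q \<noteq> 15\<close> by auto
    qed
  qed
qed

lemma not_prime_power: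
  fixes p q f r s :: nat
  assumes "prime p" "q = p ^ f" "prime r" "prime s" "r \<noteq> s" "r dvd q"
  shows "\<not> s dvd q"
  using assms prime_dvd_power[of r p f] prime_dvd_power[of s p f] primes_dvd_imp_eq by metis

section \<open>The surviving parameters for A4, S4 and A5\<close>

context psl2_design
begin

lemma q_not: "q \<noteq> 15" "q \<noteq> 21" "q \<noteq> 35"
proof -
  have primes: "prime (3::nat)" "prime (5::nat)" "prime (7::nat)" by simp_all
  show "q \<noteq> 15" using not_prime_power[OF prime_p q_eq primes(1,2)] by auto
  show "q \<noteq> 21" using not_prime_power[OF prime_p q_eq primes(1,3)] by auto
  show "q \<noteq> 35" using not_prime_power[OF prime_p q_eq primes(2,3)] by auto
qed

lemma even_q: "even q \<Longrightarrow> p = 2"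
  using prime_p q_eq by (metis prime_dvd_power primes_dvd_imp_eq two_is_prime_nat)

lemma d_cases: "even q \<Longrightarrow> d = 1 \<and> q = 2 ^ f" "odd q \<Longrightarrow> d = 2"
  unfolding d_def using even_q q_eq by simp_all

lemma klein_pairs_iso:
  assumes "C \<in> \<B>" and \<psi>: "\<psi> \<in> iso (G\<lparr>carrier := G\<^sub>b C\<rparr>) K" and "group K" and "finite (carrier K)"
  shows "card (klein_pairs G (G\<^sub>b C)) \<le> card (klein_pairs K (carrier K))"
proof (rule card_inj_on_le[where f = "\<lambda>(u, v). (\<psi> u, \<psi> v)"])
  let ?H = "G\<lparr>carrier := G\<^sub>b C\<rparr>"
  have H: "group ?H" using subgroup_block_stabilizer[OF assms(1)] by (rule subgroup_imp_group)
  interpret h: group_hom ?H K \<psi>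
    using H assms by (simp add: group_hom_def group_hom_axioms_def iso_def)
  have inj: "inj_on \<psi> (G\<^sub>b C)" using \<psi> by (simp add: iso_def bij_betw_def)
  have one: "\<psi> \<one>\<^bsub>G\<^esub> = \<one>\<^bsub>K\<^esub>" using h.hom_one by simp
  have one_in: "\<one>\<^bsub>G\<^esub> \<in> G\<^sub>b C" using subgroup.one_closed[OF subgroup_block_stabilizer[OF assms(1)]] .
  have mult: "\<psi> (u \<otimes>\<^bsub>G\<^esub> v) = \<psi> u \<otimes>\<^bsub>K\<^esub> \<psi> v" if "u \<in> G\<^sub>b C" "v \<in> G\<^sub>b C" for u v
    using h.hom_mult[of u v] that by simp
  have closed: "\<psi> u \<in> carrier K" if "u \<in> G\<^sub>b C" for u using h.hom_closed[of u] that by simp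
  show "inj_on (\<lambda>(u, v). (\<psi> u, \<psi> v)) (klein_pairs G (G\<^sub>b C))"
  proof (rule inj_onI, clarify)
    fix u v u' v' assume "(u, v) \<in> klein_pairs G (G\<^sub>b C)" "(u', v') \<in> klein_pairs G (G\<^sub>b C)" "\<psi> u = \<psi> u'" "\<psi> v = \<psi> v'"
    then show "u = u' \<and> v = v'" using inj unfolding klein_pairs_def by (metis (no_types, lifting) case_prodD inj_onD mem_Collect_eq)
  qed
  show "(\<lambda>(u, v). (\<psi> u, \<psi> v)) ` klein_pairs G (G\<^sub>b C) \<subseteq> klein_pairs K (carrier K)"
  proof clarify
    fix u v assume uv: "(u, v) \<in> klein_pairs G (G\<^sub>b C)"
    then have m: "u \<in> G\<^sub>b C" "v \<in> G\<^sub>b C" and r: "u \<noteq> \<one>\<^bsub>G\<^esub>" "v \<noteq> \<one>\<^bsub>G\<^esub>" "u \<noteq> v"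
      "u \<otimes>\<^bsub>G\<^esub> u = \<one>\<^bsub>G\<^esub>" "v \<otimes>\<^bsub>G\<^esub> v = \<one>\<^bsub>G\<^esub>" "u \<otimes>\<^bsub>G\<^esub> v = v \<otimes>\<^bsub>G\<^esub> u"
      unfolding klein_pairs_def by blast+
    have "\<psi> u \<noteq> \<one>\<^bsub>K\<^esub>" "\<psi> v \<noteq> \<one>\<^bsub>K\<^esub>" "\<psi> u \<noteq> \<psi> v"
      using inj_onD[OF inj _ m(1) one_in] inj_onD[OF inj _ m(2) one_in] inj_onD[OF inj _ m] one r by metis+
    moreover have "\<psi> u \<otimes>\<^bsub>K\<^esub> \<psi> u = \<one>\<^bsub>K\<^esub>" "\<psi> v \<otimes>\<^bsub>K\<^esub> \<psi> v = \<one>\<^bsub>K\<^esub>" "\<psi> u \<otimes>\<^bsub>K\<^esub> \<psi> v = \<psi> v \<otimes>\<^bsub>K\<^esub> \<psi> u"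
      using mult[OF m(1,1)] mult[OF m(2,2)] mult[OF m] mult[OF m(2,1)] r one by simp_all
    ultimately show "(\<psi> u, \<psi> v) \<in> klein_pairs K (carrier K)"
      using closed[OF m(1)] closed[OF m(2)] unfolding klein_pairs_def by blast
  qed
  show "finite (klein_pairs K (carrier K))"
    by (rule finite_subset[OF _ finite_cartesian_product[OF assms(4) assms(4)]]) (auto simp: klein_pairs_def)
qed

lemma klein_bound_iso:
  assumes "odd q" "odd l" "B \<in> \<B>" and \<psi>: "\<psi> \<in> iso (G\<lparr>carrier := G\<^sub>b B\<rparr>) K" and K: "group K" "finite (carrier K)"
    and N: "card (klein_pairs K (carrier K)) \<le> N"
  shows "(q - 5) * order K \<le> 2 * k * N"
proof -
  have "card (G\<^sub>b B) = order K" using iso_same_card[OF is_isoI[OF \<psi>]] by (simp add: order_def)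
  moreover have "(q - 5) * card (G\<^sub>b B) \<le> 2 * k * N"
  proof (rule klein_counting_bound[OF assms(2,1,3)])
    fix C assume C: "C \<in> \<B>"
    obtain \<psi>' where "\<psi>' \<in> iso (G\<lparr>carrier := G\<^sub>b C\<rparr>) K" using conj_block_stabilizer[OF assms(3) C \<psi> K(1)] .
    then show "card (klein_pairs G (G\<^sub>b C)) \<le> N" using klein_pairs_iso[OF C _ K] N by fastforce
  qed
  ultimately show ?thesis by simp
qed

lemma k_dvd:
  assumes "B \<in> \<B>"
  shows "k dvd card (G\<^sub>b B)"
proof -
  obtain x where "x \<in> B" using block_nonempty[OF assms] ..
  from card_block_stabilizer[OF assms this, symmetric] show ?thesis by (rule dvdI)
qed

lemma subgroup_point_stabilizer:
  assumes "x \<in> P"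
  shows "subgroup {g \<in> carrier G. \<phi> g x = x} G"
  using stabilizer_subgroup[OF assms] by (simp add: stabilizer_def)

lemma flag_stabilizer_dvd:
  assumes "B \<in> \<B>" "x \<in> B"
  shows "card {g \<in> G\<^sub>b B. \<phi> g x = x} dvd card {g \<in> carrier G. \<phi> g x = x}"
proof -
  have x: "x \<in> P" using assms block by blast
  let ?S = "{g \<in> carrier G. \<phi> g x = x}" and ?T = "{g \<in> G\<^sub>b B. \<phi> g x = x}"
  have "?T = G\<^sub>b B \<inter> ?S" by auto
  then have "subgroup ?T G"
    using subgroups_Inter_pair[OF subgroup_block_stabilizer[OF assms(1)] subgroup_point_stabilizer[OF x]] by simp
  then have "subgroup ?T (G\<lparr>carrier := ?S\<rparr>)"
    by (rule subgroup_incl[OF _ subgroup_point_stabilizer[OF x]]) auto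
  from group.lagrange[OF subgroup_imp_group[OF subgroup_point_stabilizer[OF x]] this]
  have "card (rcosets\<^bsub>G\<lparr>carrier := ?S\<rparr>\<^esub> ?T) * card ?T = card ?S" by (simp add: order_def)
  then have "card ?S = card ?T * card (rcosets\<^bsub>G\<lparr>carrier := ?S\<rparr>\<^esub> ?T)" by (simp only: mult.commute)
  then show ?thesis by (rule dvdI)
qed

lemma complement_of_two_points:
  assumes "B \<in> \<B>" "k = q - 1" and ab: "a \<in> G\<^sub>b B" "b \<in> G\<^sub>b B"
    "a \<otimes>\<^bsub>G\<^esub> a \<otimes>\<^bsub>G\<^esub> a = \<one>\<^bsub>G\<^esub>" "b \<otimes>\<^bsub>G\<^esub> b \<otimes>\<^bsub>G\<^esub> b = \<one>\<^bsub>G\<^esub>"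
  shows "a \<otimes>\<^bsub>G\<^esub> b = b \<otimes>\<^bsub>G\<^esub> a"
proof -
  have B: "B \<subseteq> P" "card B = k" using block assms by auto
  have "card (P - B) = 2"
    using B finite_P card_P assms(2) q_ge finite_subset[OF B(1) finite_P] by (simp add: card_Diff_subset)
  then obtain x y where xy: "P - B = {x, y}" "x \<noteq> y" by (auto simp: card_2_iff)
  then have P: "x \<in> P" "y \<in> P" by auto
  have fixed: "\<phi> g x = x \<and> \<phi> g y = y" if g: "g \<in> G\<^sub>b B" "g \<otimes>\<^bsub>G\<^esub> g \<otimes>\<^bsub>G\<^esub> g = \<one>\<^bsub>G\<^esub>" for g
  proof -
    have gc: "g \<in> carrier G" using g by auto
    have inj: "inj_on (\<phi> g) P" using inj_prop gc by blast
    have "\<phi> g ` (P - B) = P - B"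
      using inj_on_image_set_diff[OF inj Diff_subset B(1)] surj_prop[OF gc] g(1) by auto
    then have "\<phi> g ` {x, y} = {x, y}" unfolding xy .
    then have mem: "\<phi> g x \<in> {x, y}" "\<phi> g y \<in> {x, y}" by auto
    have "\<phi> g x \<noteq> \<phi> g y" using inj P xy(2) by (meson inj_onD)
    \<comment> \<open>If \<open>g\<close> exchanged the two outer points, its cube would exchange
      them too.\<close>
    moreover have "\<phi> g (\<phi> g (\<phi> g x)) = x"
      using gc P act_closed composition_rule[of x "g \<otimes>\<^bsub>G\<^esub> g" g] composition_rule[of "\<phi> g x" g g] g(2) act_one[of x] by simp
    ultimately show ?thesis using mem xy(2) by (metis insertE singletonD)
  qed
  show ?thesis
    using two_fixed_points_commute[OF _ _ P xy(2)] fixed[OF ab(1,3)] fixed[OF ab(2,4)] ab by auto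
qed

text \<open>In characteristic two an involution fixes exactly one point, so commuting involutions
  fix the same one. For \<open>u\<close> and its conjugate by \<open>c\<close> this forces
  \<open>c\<close> to fix that point as well, whose stabilizer has order \<open>q * (q - 1)\<close>,
  prime to 3. The inverse of \<open>c\<close> is written as its square.\<close>

lemma char_two_A4_pair:
  assumes "even q" "\<not> 3 dvd q * (q - 1)" and uc: "u \<in> carrier G" "c \<in> carrier G"
    "u \<noteq> \<one>\<^bsub>G\<^esub>" "u \<otimes>\<^bsub>G\<^esub> u = \<one>\<^bsub>G\<^esub>" "c \<otimes>\<^bsub>G\<^esub> c \<otimes>\<^bsub>G\<^esub> c = \<one>\<^bsub>G\<^esub>"
    "u \<otimes>\<^bsub>G\<^esub> (c \<otimes>\<^bsub>G\<^esub> u \<otimes>\<^bsub>G\<^esub> (c \<otimes>\<^bsub>G\<^esub> c)) = (c \<otimes>\<^bsub>G\<^esub> u \<otimes>\<^bsub>G\<^esub> (c \<otimes>\<^bsub>G\<^esub> c)) \<otimes>\<^bsub>G\<^esub> u"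
  shows "c = \<one>\<^bsub>G\<^esub>"
proof -
  have p: "p = 2" using even_q assms by simp
  let ?w = "c \<otimes>\<^bsub>G\<^esub> u \<otimes>\<^bsub>G\<^esub> (c \<otimes>\<^bsub>G\<^esub> c)"
  have w: "?w \<in> carrier G" using uc by simp
  have cc: "c \<otimes>\<^bsub>G\<^esub> (c \<otimes>\<^bsub>G\<^esub> c) = \<one>\<^bsub>G\<^esub>" using uc by (simp add: m_assoc)
  have uu: "\<phi> u (\<phi> u x) = x" if "x \<in> P" for x
    using composition_rule[OF that uc(1,1)] uc(4) act_one[OF that] by simp
  have "odd (card {x \<in> P. \<phi> u x = x})"
  proof (rule odd_card_fixed_points[OF finite_P])
    show "odd (card P)" using card_P \<open>even q\<close> by simp
  qed (use uu act_closed[OF uc(1)] in auto)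
  then have "{x \<in> P. \<phi> u x = x} \<noteq> {}" by (metis card.empty even_zero)
  then obtain z where z: "z \<in> P" "\<phi> u z = z" by auto
  have unique: "y = y'" if "v \<in> carrier G" "v \<noteq> \<one>\<^bsub>G\<^esub>" "v \<otimes>\<^bsub>G\<^esub> v = \<one>\<^bsub>G\<^esub>" "y \<in> P" "y' \<in> P" "\<phi> v y = y" "\<phi> v y' = y'" for v y y'
  proof (rule ccontr)
    assume "y \<noteq> y'"
    moreover have "v [^]\<^bsub>G\<^esub> (p ^ 1) = \<one>\<^bsub>G\<^esub>" using that(1,3) by (simp add: p numeral_2_eq_2)
    ultimately show False using p_element_two_fixed_points[of v 1 y y'] that by auto
  qed
  have "\<phi> u (\<phi> ?w z) = \<phi> ?w z"
    using composition_rule[OF z(1) uc(1) w] composition_rule[OF z(1) w uc(1)] uc(6) z by simp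
  then have wz: "\<phi> ?w z = z"
    using unique[OF uc(1,3,4) _ z(1) _ z(2)] act_closed[OF w z(1)] by blast
  have cz: "\<phi> c z \<in> P" using act_closed uc z by simp
  have c3: "c \<otimes>\<^bsub>G\<^esub> (c \<otimes>\<^bsub>G\<^esub> (c \<otimes>\<^bsub>G\<^esub> a)) = a" and u2: "u \<otimes>\<^bsub>G\<^esub> (u \<otimes>\<^bsub>G\<^esub> a) = a" if "a \<in> carrier G" for a
  proof -
    have "c \<otimes>\<^bsub>G\<^esub> (c \<otimes>\<^bsub>G\<^esub> (c \<otimes>\<^bsub>G\<^esub> a)) = c \<otimes>\<^bsub>G\<^esub> c \<otimes>\<^bsub>G\<^esub> c \<otimes>\<^bsub>G\<^esub> a" using uc(1,2) that by (simp only: m_assoc m_closed)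
    then show "c \<otimes>\<^bsub>G\<^esub> (c \<otimes>\<^bsub>G\<^esub> (c \<otimes>\<^bsub>G\<^esub> a)) = a" using uc(5) that by simp
    have "u \<otimes>\<^bsub>G\<^esub> (u \<otimes>\<^bsub>G\<^esub> a) = u \<otimes>\<^bsub>G\<^esub> u \<otimes>\<^bsub>G\<^esub> a" using uc(1,2) that by (simp only: m_assoc m_closed)
    then show "u \<otimes>\<^bsub>G\<^esub> (u \<otimes>\<^bsub>G\<^esub> a) = a" using uc(4) that by simp
  qed
  have ww: "?w \<otimes>\<^bsub>G\<^esub> ?w = \<one>\<^bsub>G\<^esub>"
    using uc(1,2) cc by (simp add: m_assoc c3 u2)
  have wc: "?w \<otimes>\<^bsub>G\<^esub> c = c \<otimes>\<^bsub>G\<^esub> u"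
    using uc(1,2) cc by (simp add: m_assoc)
  have w1: "?w \<noteq> \<one>\<^bsub>G\<^esub>"
  proof
    assume "?w = \<one>\<^bsub>G\<^esub>"
    then have "c = c \<otimes>\<^bsub>G\<^esub> u" using wc uc by simp
    then show False using uc by (metis l_cancel_one')
  qed
  \<comment> \<open>\<open>c\<close> carries the fixed point of \<open>u\<close> to the fixed point
    of its conjugate \<open>?w\<close>.\<close>
  have "\<phi> ?w (\<phi> c z) = \<phi> c z"
    using composition_rule[OF z(1) w uc(2)] composition_rule[OF z(1) uc(2,1)] wc z by simp
  then have fixc: "\<phi> c z = z" using unique[OF w w1 ww cz z(1) _ wz] by blast
  let ?S = "{g \<in> carrier G. \<phi> g z = z}"
  have "(q + 1) * card ?S = q * (q ^ 2 - 1)"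
    using card_point_stabilizer[OF z(1)] order_G d_cases(1)[OF \<open>even q\<close>] by (metis mult.right_neutral)
  also have "\<dots> = (q + 1) * (q * (q - 1))" by (cases q) (auto simp: power2_eq_square algebra_simps)
  finally have S: "card ?S = q * (q - 1)" by (simp only: mult_cancel1) simp
  interpret S: group "G\<lparr>carrier := ?S\<rparr>" by (rule subgroup_imp_group[OF subgroup_point_stabilizer[OF z(1)]])
  have "c [^]\<^bsub>G\<lparr>carrier := ?S\<rparr>\<^esub> order (G\<lparr>carrier := ?S\<rparr>) = \<one>\<^bsub>G\<lparr>carrier := ?S\<rparr>\<^esub>"
    by (rule S.pow_order_eq_1) (use uc fixc in simp)
  then have "c [^]\<^bsub>G\<^esub> card ?S = \<one>\<^bsub>G\<^esub>" by (simp add: order_def nat_pow_consistent[symmetric])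
  then have 1: "ord c dvd q * (q - 1)" using S uc(2) pow_eq_id by metis
  have "c [^]\<^bsub>G\<^esub> (3::nat) = \<one>\<^bsub>G\<^esub>" using uc by (simp add: numeral_3_eq_3)
  then have "ord c dvd 3" using uc(2) pow_eq_id by blast
  then have "ord c = 1 \<or> ord c = 3" using prime_nat_iff[of 3] by auto
  then have "ord c = 1" using 1 assms(2) by auto
  then show ?thesis using uc(2) ord_eq_1 by blast
qed

text \<open>A point moved by the square of \<open>h\<close> has a regular orbit under
  \<open>h\<close>, a four-set invariant under \<open>h\<close> and its square. An odd number of
  blocks contain it, so one of them is invariant.\<close>

lemma element_of_order_four:
  assumes "odd l" and h: "h \<in> carrier G" "h \<otimes>\<^bsub>G\<^esub> h \<noteq> \<one>\<^bsub>G\<^esub>" "(h \<otimes>\<^bsub>G\<^esub> h) \<otimes>\<^bsub>G\<^esub> (h \<otimes>\<^bsub>G\<^esub> h) = \<one>\<^bsub>G\<^esub>"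
  obtains C where "C \<in> \<B>" "h \<in> G\<^sub>b C"
proof -
  let ?u = "h \<otimes>\<^bsub>G\<^esub> h"
  have u: "?u \<in> carrier G" using h by simp
  have "card {x \<in> P. \<phi> ?u x = x} < card P" using card_fixed_points_le[OF u h(2)] card_P q_ge by simp
  then have "{x \<in> P. \<phi> ?u x = x} \<noteq> P" by fastforce
  then obtain x where x: "x \<in> P" "\<phi> ?u x \<noteq> x" by auto
  define y where "y = \<phi> h x"
  define z where "z = \<phi> h y"
  define w where "w = \<phi> h z"
  have P: "y \<in> P" "z \<in> P" "w \<in> P" using act_closed[OF h(1)] x(1) by (simp_all add: y_def z_def w_def)
  have ux: "\<phi> ?u a = \<phi> h (\<phi> h a)" if "a \<in> P" for a using composition_rule[OF that h(1,1)] .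
  have hw: "\<phi> h w = x"
  proof -
    have "\<phi> h w = \<phi> ?u (\<phi> ?u x)" using ux[OF x(1)] ux[OF P(2)] by (simp add: w_def z_def y_def)
    also have "\<dots> = x" using composition_rule[OF x(1) u u] h(3) act_one[OF x(1)] by simp
    finally show ?thesis .
  qed
  have hs: "\<phi> h x = y" "\<phi> h y = z" "\<phi> h z = w" by (simp_all add: y_def z_def w_def)
  have "z \<noteq> x" using x ux[OF x(1)] by (simp add: z_def y_def)
  then have ne: "x \<noteq> y" "x \<noteq> z" "x \<noteq> w" "y \<noteq> z" "y \<noteq> w" "z \<noteq> w" using hs hw by metis+
  then have T: "card {x, y, z, w} = 4" by simp
  have Th: "\<phi> h ` {x, y, z, w} = {x, y, z, w}" by (simp only: image_insert image_empty hs hw) blast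
  have sub: "{x, y, z, w} \<subseteq> P" using P x by simp
  have Tu: "\<phi> ?u ` {x, y, z, w} = {x, y, z, w}" by (simp only: image_mult[OF h(1,1) sub] Th)
  have comm: "?u \<otimes>\<^bsub>G\<^esub> h = h \<otimes>\<^bsub>G\<^esub> ?u" using h by (simp add: m_assoc)
  obtain C where "C \<in> \<B>" "{x, y, z, w} \<subseteq> C" "?u \<in> G\<^sub>b C" "h \<in> G\<^sub>b C"
    by (rule invariant_block[OF \<open>odd l\<close> u h(1,3) disjI2[OF refl] comm sub T Tu Th])
  then show thesis using that by blast
qed

lemma order_four_17:
  assumes "q = 17"
  obtains h where "h \<in> carrier G" "h \<otimes>\<^bsub>G\<^esub> h \<noteq> \<one>\<^bsub>G\<^esub>" "(h \<otimes>\<^bsub>G\<^esub> h) \<otimes>\<^bsub>G\<^esub> (h \<otimes>\<^bsub>G\<^esub> h) = \<one>\<^bsub>G\<^esub>"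
proof -
  have z: "(17 :: 'a) = 0" using of_nat_CARD_eq_0[where 'a = 'a] CARD_q assms by simp
  have "(18 :: 'a) = 17 + 1" "(6561 :: 'a) = 385 * 17 + 16" "(77 :: 'a) = 4 * 17 + 9" by simp_all
  then have e: "(18 :: 'a) = 1" "(6561 :: 'a) = 16" "(77 :: 'a) = 9" unfolding z by simp_all
  have "(9 :: 'a) \<noteq> 0"
  proof
    assume "(9 :: 'a) = 0"
    then have "(18 :: 'a) = 0" by (metis mult_zero_right mult_numeral_1 mult_2 numeral_Bit0 add_0)
    then show False using e(1) by simp
  qed
  then have ne: "(81 :: 'a) \<noteq> 4"
  proof -
    have "(81 :: 'a) - 4 = 77" by simp
    then show ?thesis using e(3) \<open>(9 :: 'a) \<noteq> 0\<close> by (metis right_minus_eq)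
  qed
  \<comment> \<open>With 17 elements in the field, \<open>2 * 9 = 1\<close> and both 2 and 9 have
    fourth power 16, while 4 and 81 differ; so \<open>A\<close> has order four modulo
    scalars.\<close>
  define A where "A = m2 (2 :: 'a) 0 0 9"
  have A: "A \<in> carrier SL2" using e by (simp add: A_def)
  have A2: "A ** A = m2 4 0 0 81" by (simp add: A_def)
  have "(A ** A) ** (A ** A) = mat 16" using e by (simp add: A2 mat_eq_m2)
  moreover have "(A ** A) ** (A ** A) \<in> carrier SL2" using A by (intro mult_SL2)
  ultimately have "psl ((A ** A) ** (A ** A)) = \<one>\<^bsub>G\<^esub>" using psl_eq_one_iff by blast
  moreover have "psl (A ** A) \<noteq> \<one>\<^bsub>G\<^esub>"
  proof
    assume "psl (A ** A) = \<one>\<^bsub>G\<^esub>"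
    then have "A ** A \<in> range mat" using psl_eq_one_iff mult_SL2[OF A A] by blast
    then obtain c where "m2 (4 :: 'a) 0 0 81 = mat c" unfolding A2 by blast
    then show False using ne by (auto simp: mat_eq_m2)
  qed
  ultimately show thesis using that[of "psl A"] A by (simp add: psl_mult)
qed

end

context psl2_design
begin

lemma block_stabilizer_embedding:
  assumes "B \<in> \<B>" and iso: "G\<lparr>carrier := G\<^sub>b B\<rparr> \<cong> K" and K: "group K" "order K = n" "n > 0"
  obtains \<psi> \<sigma> where "\<psi> \<in> iso (G\<lparr>carrier := G\<^sub>b B\<rparr>) K" "\<sigma> \<in> hom K G" "inj_on \<sigma> (carrier K)" "\<sigma> ` carrier K \<subseteq> G\<^sub>b B"
    "\<sigma> \<one>\<^bsub>K\<^esub> = \<one>\<^bsub>G\<^esub>" "card (G\<^sub>b B) = n" "finite (carrier K)"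
proof -
  let ?H = "G\<lparr>carrier := G\<^sub>b B\<rparr>"
  have H: "group ?H" using subgroup_block_stabilizer[OF assms(1)] by (rule subgroup_imp_group)
  obtain \<psi> where \<psi>: "\<psi> \<in> iso ?H K" using iso by (auto simp: is_iso_def)
  let ?\<sigma> = "inv_into (carrier ?H) \<psi>"
  have \<sigma>: "?\<sigma> \<in> iso K ?H" using group.iso_set_sym[OF H \<psi>] .
  then have bij: "bij_betw ?\<sigma> (carrier K) (G\<^sub>b B)" by (simp add: iso_def)
  have hom: "?\<sigma> \<in> hom K G" using \<sigma> by (auto simp: iso_def hom_def)
  have "?\<sigma> \<one>\<^bsub>K\<^esub> = \<one>\<^bsub>G\<^esub>" using hom_one[OF hom K(1) group_PSL2] .
  moreover have "card (G\<^sub>b B) = n" using iso_same_card[OF iso] K by (simp add: order_def)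
  moreover have "finite (carrier K)" using K by (metis card_ge_0_finite order_def)
  ultimately show thesis using that[OF \<psi> hom] bij by (auto simp: bij_betw_def)
qed

lemma no_block_complement_pair:
  assumes "B \<in> \<B>" and \<sigma>: "\<sigma> \<in> hom K G" "inj_on \<sigma> (carrier K)" "\<sigma> ` carrier K \<subseteq> G\<^sub>b B" "\<sigma> \<one>\<^bsub>K\<^esub> = \<one>\<^bsub>G\<^esub>" "group K"
    and ab: "a \<in> carrier K" "b \<in> carrier K" "a \<otimes>\<^bsub>K\<^esub> a \<otimes>\<^bsub>K\<^esub> a = \<one>\<^bsub>K\<^esub>" "b \<otimes>\<^bsub>K\<^esub> b \<otimes>\<^bsub>K\<^esub> b = \<one>\<^bsub>K\<^esub>" "a \<otimes>\<^bsub>K\<^esub> b \<noteq> b \<otimes>\<^bsub>K\<^esub> a"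
  shows "k \<noteq> q - 1"
proof
  assume k: "k = q - 1"
  interpret K: group K by fact
  have mult: "\<sigma> (x \<otimes>\<^bsub>K\<^esub> y) = \<sigma> x \<otimes>\<^bsub>G\<^esub> \<sigma> y" if "x \<in> carrier K" "y \<in> carrier K" for x y
    using \<sigma>(1) that by (simp add: hom_def)
  have "\<sigma> a \<otimes>\<^bsub>G\<^esub> \<sigma> b = \<sigma> b \<otimes>\<^bsub>G\<^esub> \<sigma> a"
  proof (rule complement_of_two_points[OF assms(1) k])
    show "\<sigma> a \<in> G\<^sub>b B" "\<sigma> b \<in> G\<^sub>b B" using \<sigma>(3) ab by blast+
    show "\<sigma> a \<otimes>\<^bsub>G\<^esub> \<sigma> a \<otimes>\<^bsub>G\<^esub> \<sigma> a = \<one>\<^bsub>G\<^esub>" "\<sigma> b \<otimes>\<^bsub>G\<^esub> \<sigma> b \<otimes>\<^bsub>G\<^esub> \<sigma> b = \<one>\<^bsub>G\<^esub>"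
      using ab \<sigma>(4) by (simp_all add: mult[symmetric])
  qed
  then have "\<sigma> (a \<otimes>\<^bsub>K\<^esub> b) = \<sigma> (b \<otimes>\<^bsub>K\<^esub> a)" using ab by (simp add: mult)
  then show False using inj_onD[OF \<sigma>(2)] ab by (metis K.m_closed)
qed

lemma three_cycles_in_groups:
  obtains a b where "a \<circ> a \<circ> a = id" "b \<circ> b \<circ> b = id" "a \<circ> b \<noteq> b \<circ> a" "a \<noteq> id"
    "\<And>n. n \<ge> 4 \<Longrightarrow> a \<in> carrier (alt_group n) \<and> b \<in> carrier (alt_group n) \<and> a \<in> carrier (sym_group n) \<and> b \<in> carrier (sym_group n)"
  by (rule that[OF noncommuting_three_cycles(1-4)])
    (use noncommuting_three_cycles(5-7) in \<open>simp add: alt_group_carrier sym_group_carrier\<close>)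

lemma no_alt_4:
  assumes "B \<in> \<B>"
  shows "\<not> G\<lparr>carrier := G\<^sub>b B\<rparr> \<cong> alt_group 4"
proof
  assume iso: "G\<lparr>carrier := G\<^sub>b B\<rparr> \<cong> alt_group 4"
  let ?K = "alt_group 4"
  have K: "group ?K" by (rule alt_group_is_group)
  have n: "order ?K = 12" using alt_group_card_carrier[of 4] by (simp add: order_def fact_numeral)
  obtain \<psi> \<sigma> where \<psi>: "\<psi> \<in> iso (G\<lparr>carrier := G\<^sub>b B\<rparr>) ?K" and \<sigma>: "\<sigma> \<in> hom ?K G" "inj_on \<sigma> (carrier ?K)"
      "\<sigma> ` carrier ?K \<subseteq> G\<^sub>b B" "\<sigma> \<one>\<^bsub>?K\<^esub> = \<one>\<^bsub>G\<^esub>" and card: "card (G\<^sub>b B) = 12" and fin: "finite (carrier ?K)"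
    by (rule block_stabilizer_embedding[OF assms iso K n]) simp_all
  have "k = 12 \<and> (q = 13 \<or> (q = 17 \<and> odd l) \<or> q = 32)"
  proof (rule parameters_A4)
    show "k * (k - 1) * (k - 2) * (k - 3) = l * d * (q - 2) * 12" using parameter_equation[OF assms] card by simp
    show "k dvd 12" using k_dvd[OF assms] card by simp
    show "(q - 5) * 12 \<le> 2 * k * 6" if "odd q" "odd l"
      using klein_bound_iso[OF that assms \<psi> K fin klein_pairs_alt_4] n by simp
  qed (use k_gt k_le l_gt d_cases q_not in auto)
  then consider "k = 12" "q = 13" | "q = 17" "odd l" | "q = 32" by blast
  then show False
  proof cases
    case 1
    \<comment> \<open>Here \<open>k = q - 1\<close>, so the noncommuting three-cycles give the
      contradiction.\<close>
    obtain a b where ab: "a \<circ> a \<circ> a = id" "b \<circ> b \<circ> b = id" "a \<circ> b \<noteq> b \<circ> a"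
      "a \<in> carrier ?K" "b \<in> carrier ?K" by (rule three_cycles_in_groups) simp
    have "k \<noteq> q - 1"
      by (rule no_block_complement_pair[OF assms \<sigma> K ab(4,5)]) (use ab in \<open>simp_all add: alt_group_mult alt_group_one\<close>)
    then show False using 1 by simp
  next
    case 2
    \<comment> \<open>Over 17 elements \<open>PSL2\<close> has an element of order four, and some
      block stabilizer contains it, whereas A4 has no such element.\<close>
    obtain h where h: "h \<in> carrier G" "h \<otimes>\<^bsub>G\<^esub> h \<noteq> \<one>\<^bsub>G\<^esub>" "(h \<otimes>\<^bsub>G\<^esub> h) \<otimes>\<^bsub>G\<^esub> (h \<otimes>\<^bsub>G\<^esub> h) = \<one>\<^bsub>G\<^esub>"
      by (rule order_four_17[OF 2(1)])
    obtain C where C: "C \<in> \<B>" "h \<in> G\<^sub>b C" by (rule element_of_order_four[OF 2(2) h])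
    obtain \<psi>' where \<psi>': "\<psi>' \<in> iso (G\<lparr>carrier := G\<^sub>b C\<rparr>) ?K"
      by (rule conj_block_stabilizer[OF assms C(1) \<psi> K])
    have sub: "subgroup (G\<^sub>b C) G" by (rule subgroup_block_stabilizer[OF C(1)])
    have mult: "\<psi>' (x \<otimes>\<^bsub>G\<^esub> y) = \<psi>' x \<circ> \<psi>' y" if "x \<in> G\<^sub>b C" "y \<in> G\<^sub>b C" for x y
      using \<psi>' that by (auto simp: iso_def hom_def alt_group_mult)
    have one: "\<psi>' \<one>\<^bsub>G\<^esub> = id"
      using hom_one[of \<psi>' "G\<lparr>carrier := G\<^sub>b C\<rparr>" ?K] \<psi>' subgroup_imp_group[OF sub] K
      by (simp add: iso_def alt_group_one)
    have hh: "h \<otimes>\<^bsub>G\<^esub> h \<in> G\<^sub>b C" using subgroup.m_closed[OF sub C(2) C(2)] .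
    have "\<psi>' ((h \<otimes>\<^bsub>G\<^esub> h) \<otimes>\<^bsub>G\<^esub> (h \<otimes>\<^bsub>G\<^esub> h)) = id" unfolding h(3) by (rule one)
    then have "\<psi>' h \<circ> \<psi>' h \<circ> \<psi>' h \<circ> \<psi>' h = id" unfolding mult[OF hh hh] mult[OF C(2,2)] by (simp only: o_assoc)
    moreover have "\<psi>' h \<in> carrier ?K" using \<psi>' C(2) by (auto simp: iso_def hom_def)
    ultimately have "\<psi>' h \<circ> \<psi>' h = id" using alt_4_no_element_of_order_4 by blast
    then have "\<psi>' (h \<otimes>\<^bsub>G\<^esub> h) = \<psi>' \<one>\<^bsub>G\<^esub>" unfolding mult[OF C(2,2)] one .
    moreover have "inj_on \<psi>' (G\<^sub>b C)" using \<psi>' by (simp add: iso_def bij_betw_def)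
    ultimately show False using inj_onD[OF _ _ hh subgroup.one_closed[OF sub]] h(2) by blast
  next
    case 3
    \<comment> \<open>For \<open>q = 32\<close> point stabilizers have order \<open>32 * 31\<close>,
      prime to 3. Here \<open>u\<close> is a double transposition and \<open>c\<close> a
      three-cycle, which would have to be trivial.\<close>
    define u :: "nat \<Rightarrow> nat" where "u = Transposition.transpose 1 2 \<circ> Transposition.transpose 3 4"
    define c :: "nat \<Rightarrow> nat" where "c = Transposition.transpose 1 2 \<circ> Transposition.transpose 2 3"
    have "u permutes {1..4}" "c permutes {1..4}"
      unfolding u_def c_def by (auto intro!: permutes_compose permutes_swap_id)
    moreover have "evenperm u" "evenperm c"
      unfolding u_def c_def by (simp_all add: evenperm_comp evenperm_swap permutation_swap_id)
    ultimately have uc: "u \<in> carrier ?K" "c \<in> carrier ?K" by (simp_all add: alt_group_carrier)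
    have rel: "u \<noteq> id" "c \<noteq> id" "u \<circ> u = id" "c \<circ> c \<circ> c = id" "u \<circ> (c \<circ> u \<circ> (c \<circ> c)) = (c \<circ> u \<circ> (c \<circ> c)) \<circ> u"
    proof -
      have U: "u 1 = 2" "u 2 = 1" "u 3 = 4" "u 4 = 3" and C: "c 1 = 2" "c 2 = 3" "c 3 = 1" "c 4 = 4"
        by (simp_all add: u_def c_def Transposition.transpose_def)
      have out: "u x = x" "c x = x" if "x \<noteq> 1" "x \<noteq> 2" "x \<noteq> 3" "x \<noteq> 4" for x
        using that by (simp_all add: u_def c_def Transposition.transpose_def)
      have eqI: "v = w" if "v 1 = w 1" "v 2 = w 2" "v 3 = w 3" "v 4 = w 4"
        "\<And>x. x \<noteq> 1 \<Longrightarrow> x \<noteq> 2 \<Longrightarrow> x \<noteq> 3 \<Longrightarrow> x \<noteq> 4 \<Longrightarrow> v x = w x" for v w :: "nat \<Rightarrow> nat"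
        using that by (intro ext) metis
      show "u \<noteq> id" "c \<noteq> id" using U C by (metis id_apply n_not_Suc_n numeral_2_eq_2 One_nat_def)+
      show "u \<circ> u = id" "c \<circ> c \<circ> c = id" "u \<circ> (c \<circ> u \<circ> (c \<circ> c)) = (c \<circ> u \<circ> (c \<circ> c)) \<circ> u"
        by (rule eqI; simp add: U C out del: One_nat_def)+
    qed
    interpret K: group ?K by (rule K)
    have mult: "\<sigma> (x \<circ> y) = \<sigma> x \<otimes>\<^bsub>G\<^esub> \<sigma> y" if "x \<in> carrier ?K" "y \<in> carrier ?K" for x y
      using \<sigma>(1) that by (simp add: hom_def alt_group_mult)
    have closed: "x \<circ> y \<in> carrier ?K" if "x \<in> carrier ?K" "y \<in> carrier ?K" for x y
      using K.m_closed[OF that] by (simp add: alt_group_mult)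
    have one: "\<sigma> id = \<one>\<^bsub>G\<^esub>" using \<sigma>(4) by (simp add: alt_group_one)
    have id: "id \<in> carrier ?K" using K.one_closed by (simp add: alt_group_one)
    have "\<sigma> c = \<one>\<^bsub>G\<^esub>"
    proof (rule char_two_A4_pair)
      show "even q" "\<not> 3 dvd q * (q - 1)" using 3 by simp_all
      show "\<sigma> u \<in> carrier G" "\<sigma> c \<in> carrier G" using \<sigma>(3) uc by blast+
      show "\<sigma> u \<noteq> \<one>\<^bsub>G\<^esub>" using inj_onD[OF \<sigma>(2) _ uc(1) id] rel(1) one by metis
      show "\<sigma> u \<otimes>\<^bsub>G\<^esub> \<sigma> u = \<one>\<^bsub>G\<^esub>" "\<sigma> c \<otimes>\<^bsub>G\<^esub> \<sigma> c \<otimes>\<^bsub>G\<^esub> \<sigma> c = \<one>\<^bsub>G\<^esub>"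
        using uc rel one by (simp_all add: mult[symmetric] closed)
      have "\<sigma> (u \<circ> (c \<circ> u \<circ> (c \<circ> c))) = \<sigma> ((c \<circ> u \<circ> (c \<circ> c)) \<circ> u)" by (simp only: rel(5))
      then show "\<sigma> u \<otimes>\<^bsub>G\<^esub> (\<sigma> c \<otimes>\<^bsub>G\<^esub> \<sigma> u \<otimes>\<^bsub>G\<^esub> (\<sigma> c \<otimes>\<^bsub>G\<^esub> \<sigma> c)) = \<sigma> c \<otimes>\<^bsub>G\<^esub> \<sigma> u \<otimes>\<^bsub>G\<^esub> (\<sigma> c \<otimes>\<^bsub>G\<^esub> \<sigma> c) \<otimes>\<^bsub>G\<^esub> \<sigma> u"
        using uc by (simp only: mult closed)
    qed
    then show False using inj_onD[OF \<sigma>(2) _ uc(2) id] rel(2) one by metis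
  qed
qed

lemma no_sym_4:
  assumes "B \<in> \<B>"
  shows "\<not> G\<lparr>carrier := G\<^sub>b B\<rparr> \<cong> sym_group 4"
proof
  assume iso: "G\<lparr>carrier := G\<^sub>b B\<rparr> \<cong> sym_group 4"
  let ?K = "sym_group 4"
  have K: "group ?K" by (rule sym_group_is_group)
  have n: "order ?K = 24" using sym_group_card_carrier[of 4] by (simp add: order_def fact_numeral)
  obtain \<psi> \<sigma> where \<psi>: "\<psi> \<in> iso (G\<lparr>carrier := G\<^sub>b B\<rparr>) ?K" and \<sigma>: "\<sigma> \<in> hom ?K G" "inj_on \<sigma> (carrier ?K)"
      "\<sigma> ` carrier ?K \<subseteq> G\<^sub>b B" "\<sigma> \<one>\<^bsub>?K\<^esub> = \<one>\<^bsub>G\<^esub>" and card: "card (G\<^sub>b B) = 24" and fin: "finite (carrier ?K)"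
    by (rule block_stabilizer_embedding[OF assms iso K n]) simp_all
  have "k = 24 \<and> q = 25"
  proof (rule parameters_S4)
    show "k * (k - 1) * (k - 2) * (k - 3) = l * d * (q - 2) * 24" using parameter_equation[OF assms] card by simp
    show "k dvd 24" using k_dvd[OF assms] card by simp
    show "(q - 5) * 24 \<le> 2 * k * 24" if "odd q" "odd l"
      using klein_bound_iso[OF that assms \<psi> K fin klein_pairs_sym_4] n by simp
  qed (use k_gt k_le l_gt d_cases q_not in auto)
  moreover obtain a b where ab: "a \<circ> a \<circ> a = id" "b \<circ> b \<circ> b = id" "a \<circ> b \<noteq> b \<circ> a"
    "a \<in> carrier ?K" "b \<in> carrier ?K" by (rule three_cycles_in_groups) simp
  moreover have "k \<noteq> q - 1"
    by (rule no_block_complement_pair[OF assms \<sigma> K ab(4,5)]) (use ab in \<open>simp_all add: sym_group_mult sym_group_one\<close>)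
  ultimately show False by simp
qed

lemma no_alt_5:
  assumes "B \<in> \<B>"
  shows "\<not> G\<lparr>carrier := G\<^sub>b B\<rparr> \<cong> alt_group 5"
proof
  assume iso: "G\<lparr>carrier := G\<^sub>b B\<rparr> \<cong> alt_group 5"
  let ?K = "alt_group 5"
  have K: "group ?K" by (rule alt_group_is_group)
  have n: "order ?K = 60" using alt_group_card_carrier[of 5] by (simp add: order_def fact_numeral)
  obtain \<psi> \<sigma> where \<psi>: "\<psi> \<in> iso (G\<lparr>carrier := G\<^sub>b B\<rparr>) ?K" and \<sigma>: "\<sigma> \<in> hom ?K G" "inj_on \<sigma> (carrier ?K)"
      "\<sigma> ` carrier ?K \<subseteq> G\<^sub>b B" "\<sigma> \<one>\<^bsub>?K\<^esub> = \<one>\<^bsub>G\<^esub>" and card: "card (G\<^sub>b B) = 60" and fin: "finite (carrier ?K)"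
    by (rule block_stabilizer_embedding[OF assms iso K n]) simp_all
  have cases: "(k = 15 \<and> q = 16) \<or> (k = 60 \<and> q = 61) \<or> (k = 30 \<and> (q = 31 \<or> q = 128))"
  proof (rule parameters_A5)
    show "k * (k - 1) * (k - 2) * (k - 3) = l * d * (q - 2) * 60" using parameter_equation[OF assms] card by simp
    show "k dvd 60" using k_dvd[OF assms] card by simp
    show "(q - 5) * 60 \<le> 2 * k * 30" if "odd q" "odd l"
      using klein_bound_iso[OF that assms \<psi> K fin klein_pairs_alt_5] n by simp
  qed (use k_gt k_le l_gt d_cases q_not in auto)
  obtain a b where ab: "a \<circ> a \<circ> a = id" "b \<circ> b \<circ> b = id" "a \<circ> b \<noteq> b \<circ> a"
    "a \<in> carrier ?K" "b \<in> carrier ?K" by (rule three_cycles_in_groups) simp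
  have k1: "k \<noteq> q - 1"
    by (rule no_block_complement_pair[OF assms \<sigma> K ab(4,5)]) (use ab in \<open>simp_all add: alt_group_mult alt_group_one\<close>)
  have q31: False if "k = 30" "q = 31"
  proof -
    obtain x where x: "x \<in> B" using block_nonempty[OF assms] ..
    then have "x \<in> P" using block(1)[OF assms] by blast
    have m: "card {g \<in> G\<^sub>b B. \<phi> g x = x} = 2" using card_block_stabilizer[OF assms x] card \<open>k = 30\<close> by simp
    have "d = 2" using d_cases(2) \<open>q = 31\<close> by simp
    then have "order G = 14880" using order_G \<open>q = 31\<close> by simp
    then have "card {g \<in> carrier G. \<phi> g x = x} = 465" using card_point_stabilizer[OF \<open>x \<in> P\<close>] \<open>q = 31\<close> by simp
    \<comment> \<open>A group of order 2 cannot lie in a point stabilizer of odd order 465.\<close>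
    then show False using flag_stabilizer_dvd[OF assms x] m by simp
  qed
  have q128: False if "q = 128"
  proof -
    have "d = 1" using d_cases(1) \<open>q = 128\<close> by simp
    \<comment> \<open>The order of \<open>PSL2\<close> over 128 elements is not divisible by
      5.\<close>
    then have "card \<B> * 60 = 2097024" using card_blocks[OF assms] card order_G \<open>q = 128\<close> by simp
    then show False by presburger
  qed
  show False using cases k1 q31 q128 by auto
qed

end

section \<open>Block stabilizers defined over a subfield\<close>

text \<open>The map that adds \<open>t * cross v w\<close> times \<open>v\<close> to
  \<open>w\<close>, for \<open>v = (x, y)\<close>. For nonzero \<open>v\<close> these are all the
  unipotent matrices fixing \<open>v\<close>.\<close>

fun transvection :: "'a \<times> 'a \<Rightarrow> 'a \<Rightarrow> 'a::field ^ 2 ^ 2" where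
  "transvection (x, y) t = m2 (1 - t * x * y) (t * x * x) (- (t * y * y)) (1 + t * x * y)"

abbreviation vec_of :: "'a \<times> 'a \<Rightarrow> 'a::field ^ 2" where
  "vec_of v \<equiv> v2 (fst v) (snd v)"

lemma transvection_SL2: "transvection v t \<in> carrier SL2"
  by (cases v) (simp add: algebra_simps)

lemma transvection_add: "transvection v s ** transvection v t = transvection v (s + t)"
  by (cases v) (simp add: algebra_simps)

text \<open>Scaling the vector only changes the parameter, so the group of transvections depends on
  the line alone and there are \<open>Q + 1\<close> such groups over \<open>Q\<close>
  elements.\<close>

lemma transvection_scale: "transvection (c * x, c * y) t = transvection (x, y) (c * c * t)"
  by (simp add: algebra_simps)

lemma transvection_scalar:
  assumes "transvection (x, y) t \<in> range mat" "x \<noteq> 0 \<or> y \<noteq> 0"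
  shows "t = 0"
  using assms by (auto simp: mat_eq_m2)

lemma transvection_apply: "transvection (x, y) t *v w = w + (t * cross (v2 x y) w) *s v2 x y"
proof -
  obtain r s where w: "w = v2 r s" by (rule v2_cases)
  show ?thesis unfolding w by (simp add: vec_eq_iff forall_2 algebra_simps)
qed

lemma transvection_zero: "transvection v 0 = mat 1"
  by (cases v) (simp add: mat_eq_m2)

text \<open>\<open>M\<close> carries the transvections along a vector to those along its image; the
  parameter is divided by \<open>det M\<close> because \<open>M\<close> multiplies
  \<open>cross\<close> by it.\<close>

lemma transvection_conj:
  assumes "det M \<noteq> 0" and M: "M *v v2 x y = v2 x' y'"
  shows "M ** transvection (x, y) t = transvection (x', y') (t / det M) ** M"
proof -
  obtain a b c d where m: "M = m2 a b c d" by (cases M)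
  have x': "x' = a * x + b * y" "y' = c * x + d * y" using M m by auto
  have nz: "a * d - b * c \<noteq> 0" using assms m by simp
  have "transvection (x', y') (t * (a * d - b * c) / (a * d - b * c) / (a * d - b * c)) ** M
      = m2 a b c d ** transvection (x, y) t"
  proof -
    define e where "e = t / (a * d - b * c)"
    have t: "t = e * (a * d - b * c)" using nz by (simp add: e_def)
    have "t * (a * d - b * c) / (a * d - b * c) / (a * d - b * c) = e" using nz by (simp add: e_def)
    then show ?thesis unfolding m x' t by (simp add: algebra_simps)
  qed
  then show ?thesis using nz m by simp
qed

declare transvection.simps [simp del]

section \<open>The algebra generated by one matrix\<close>

lemma singular_kernel:
  fixes A :: "'a::field ^ 2 ^ 2"
  assumes "det A = 0"
  obtains v where "v \<noteq> 0" "A *v v = 0"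
proof -
  obtain a b c d where m: "A = m2 a b c d" by (cases A)
  have det: "a * d = b * c" using assms m by simp
  show thesis
  proof (cases "a = 0 \<and> b = 0")
    case False
    have "A *v v2 (- b) a = 0" using det by (simp add: m zero_v2 mult.commute)
    then show thesis using that[of "v2 (- b) a"] False by (auto simp: zero_v2)
  next
    case ab: True
    show thesis
    proof (cases "c = 0 \<and> d = 0")
      case False
      have "A *v v2 (- d) c = 0" using ab by (simp add: m zero_v2 mult.commute)
      then show thesis using that[of "v2 (- d) c"] False by (auto simp: zero_v2)
    next
      case True
      have "A *v v2 1 0 = 0" using ab True by (simp add: m zero_v2)
      then show thesis using that[of "v2 1 0"] by (simp add: zero_v2)
    qed
  qed
qed

text \<open>The combination of 1 and \<open>M\<close> with coefficients \<open>a\<close> and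
  \<open>b\<close>. If \<open>M\<close> has no eigenvector, the nonzero combinations form the
  multiplicative group of a quadratic extension field, a nonsplit torus.\<close>

definition lin :: "'a::field ^ 2 ^ 2 \<Rightarrow> 'a \<Rightarrow> 'a \<Rightarrow> 'a ^ 2 ^ 2" where
  "lin M a b = m2 (a + b * M $ 1 $ 1) (b * M $ 1 $ 2) (b * M $ 2 $ 1) (a + b * M $ 2 $ 2)"

lemma lin_apply: "lin M a b *v v = a *s v + b *s (M *v v)"
proof -
  obtain r s where v: "v = v2 r s" by (rule v2_cases)
  obtain p q t u where m: "M = m2 p q t u" by (cases M)
  show ?thesis unfolding v m by (simp add: lin_def vec_eq_iff forall_2 algebra_simps)
qed

lemma lin_zero: "lin M a 0 = mat a"
  by (simp add: lin_def mat_eq_m2)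

lemma lin_commute: "lin M a b ** M = M ** lin M a b"
  by (cases M) (simp add: lin_def algebra_simps)

text \<open>Cayley-Hamilton: the square of \<open>M\<close> is its trace times \<open>M\<close>
  minus its determinant.\<close>

lemma lin_mult:
  "lin M a b ** lin M a' b' = lin M (a * a' - b * b' * det M) (a * b' + a' * b + b * b' * (M $ 1 $ 1 + M $ 2 $ 2))"
  by (cases M) (simp add: lin_def algebra_simps)

text \<open>The adjugate of a two by two matrix is its trace minus the matrix, hence again a
  combination of 1 and \<open>M\<close>.\<close>

lemma lin_inverse:
  assumes "det (lin M a b) \<noteq> 0"
  obtains a' b' where "lin M a' b' ** lin M a b = mat 1" "lin M a b ** lin M a' b' = mat 1"
proof -
  obtain p q r s where m: "M = m2 p q r s" by (cases M)
  define D where "D = (a + b * p) * (a + b * s) - b * q * (b * r)"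
  have D: "D \<noteq> 0" using assms by (simp add: lin_def m D_def)
  let ?a = "(a + b * (p + s)) / D" and ?b = "- b / D"
  have adj: "lin M ?a ?b = m2 ((a + b * s) / D) (- (b * q) / D) (- (b * r) / D) ((a + b * p) / D)"
    using D by (simp add: lin_def m field_simps)
  have "lin M ?a ?b ** lin M a b = mat 1" "lin M a b ** lin M ?a ?b = mat 1"
    unfolding adj using D by (simp_all add: lin_def m mat_eq_m2 field_simps) (simp_all add: D_def algebra_simps)
  then show thesis by (rule that)
qed

lemma lin_inj:
  assumes "lin M a b = lin M a' b'" "M \<notin> range mat"
  shows "a = a' \<and> b = b'"
proof -
  obtain p q r s where m: "M = m2 p q r s" by (cases M)
  have ns: "q \<noteq> 0 \<or> r \<noteq> 0 \<or> p \<noteq> s" using assms(2) by (auto simp: m mat_eq_m2)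
  have e: "a + b * p = a' + b' * p" "b * q = b' * q" "b * r = b' * r" "a + b * s = a' + b' * s"
    using assms(1) by (auto simp: lin_def m)
  have "(b - b') * (p - s) = (a + b * p) - (a' + b' * p) - ((a + b * s) - (a' + b' * s))" by (simp add: algebra_simps)
  then have "(b - b') * (p - s) = 0" unfolding e by simp
  then have "b = b'" using ns e(2,3) by auto
  then show ?thesis using e by auto
qed

section \<open>Lines of the plane\<close>

definition line :: "'a::field ^ 2 \<Rightarrow> ('a ^ 2) set" where
  "line v = range (\<lambda>c. c *s v)"

text \<open>One normalized spanning vector for each line through the origin.\<close>

definition line_reps :: "('a::field \<times> 'a) set" where
  "line_reps = insert (0, 1) (range (\<lambda>s. (1, s)))"

lemma line_repE:
  assumes "(v :: 'a::field ^ 2) \<noteq> 0"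
  obtains r c where "r \<in> line_reps" "c \<noteq> 0" "v = v2 (c * fst r) (c * snd r)"
proof -
  obtain x y where v: "v = v2 x y" by (rule v2_cases)
  show thesis
  proof (cases "x = 0")
    case True
    then show thesis using that[of "(0, 1)" y] assms v by (auto simp: line_reps_def zero_v2)
  next
    case False
    then show thesis using that[of "(1, y / x)" x] v by (auto simp: line_reps_def)
  qed
qed

lemma card_line_reps: "card (line_reps :: ('a::{field,finite} \<times> 'a) set) = CARD('a) + 1"
proof -
  have "card (range (\<lambda>s :: 'a. (1 :: 'a, s))) = CARD('a)" by (rule card_image) (auto simp: inj_on_def)
  moreover have "(0, 1) \<notin> range (\<lambda>s :: 'a. (1 :: 'a, s))" by auto
  ultimately show ?thesis by (simp add: line_reps_def)
qed

lemma line_scale: "c \<noteq> 0 \<Longrightarrow> line (c *s v) = line (v :: 'a::field ^ 2)"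
  unfolding line_def
proof (intro equalityI subsetI)
  fix w assume "c \<noteq> 0" "w \<in> range (\<lambda>e. e *s v)"
  then obtain e where "w = e *s v" by auto
  then have "w = (e / c) *s (c *s v)" using \<open>c \<noteq> 0\<close> by (simp add: vector_smult_assoc)
  then show "w \<in> range (\<lambda>e. e *s (c *s v))" by blast
qed (auto simp: vector_smult_assoc)

lemma line_image: "(\<lambda>w. M *v w) ` line v = line (M *v (v :: 'a::field ^ 2))"
  unfolding line_def by (auto simp: image_image vec.scale)

definition lines :: "('a::field ^ 2) set set" where
  "lines = line ` (UNIV - {0})"

lemma card_lines: "card (lines :: ('a::{field,finite} ^ 2) set set) = CARD('a) + 1"
proof -
  have L: "(lines :: ('a ^ 2) set set) = (\<lambda>r. line (v2 (fst r) (snd r))) ` line_reps"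
  proof (intro equalityI subsetI)
    fix e :: "('a ^ 2) set" assume "e \<in> lines"
    then obtain v where v: "v \<noteq> 0" "e = line v" by (auto simp: lines_def)
    obtain r c where r: "r \<in> line_reps" "c \<noteq> 0" "v = v2 (c * fst r) (c * snd r)" using line_repE[OF v(1)] .
    then have "v = c *s v2 (fst r) (snd r)" by simp
    then have "e = line (v2 (fst r) (snd r))" using v(2) line_scale[OF r(2), of "v2 (fst r) (snd r)"] by (simp only:)
    then show "e \<in> (\<lambda>r. line (v2 (fst r) (snd r))) ` line_reps" using r(1) by blast
  next
    fix e :: "('a ^ 2) set" assume "e \<in> (\<lambda>r. line (v2 (fst r) (snd r))) ` line_reps"
    then show "e \<in> lines" by (auto simp: lines_def line_reps_def zero_v2)
  qed
  have I: "inj_on (\<lambda>r. line (v2 (fst r) (snd r) :: 'a ^ 2)) line_reps"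
  proof (rule inj_onI)
    fix r r' :: "'a \<times> 'a" assume r: "r \<in> line_reps" "r' \<in> line_reps" and eq: "line (v2 (fst r) (snd r)) = line (v2 (fst r') (snd r'))"
    have "v2 (fst r') (snd r') \<in> line (v2 (fst r') (snd r'))"
      unfolding line_def by (rule range_eqI[of _ _ 1]) simp
    then have "v2 (fst r') (snd r') \<in> line (v2 (fst r) (snd r))" using eq by simp
    then obtain c where "v2 (fst r') (snd r') = c *s v2 (fst r) (snd r)" unfolding line_def by blast
    then show "r = r'" using r by (auto simp: line_reps_def)
  qed
  have "card (lines :: ('a ^ 2) set set) = card (line_reps :: ('a \<times> 'a) set)"
    unfolding L by (rule card_image[OF I])
  then show ?thesis by (simp only: card_line_reps)
qed

text \<open>
  For a block stabilizer isomorphic to \<open>PSL(2, Q)\<close> or \<open>PGL(2, Q)\<close>, \<open>D\<close> is \<open>SL(2, Q)\<close> or \<open>GL(2, Q)\<close>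
  and \<open>\<theta>\<close> is the projection.  The abstract isomorphism is not assumed to come from an inclusion of fields.
\<close>

locale linear_stabilizer = psl2_design P \<B> \<phi> p f q k l
  for P :: "'p set" and \<B> and \<phi> :: "('a::{field,finite} ^ 2 ^ 2) set \<Rightarrow> 'p \<Rightarrow> 'p" and p f q k l :: nat +
  fixes D :: "('b::{field,finite} ^ 2 ^ 2) set" and \<theta> :: "'b ^ 2 ^ 2 \<Rightarrow> ('a ^ 2 ^ 2) set" and B :: "'p set" and j Q :: nat
  assumes B: "B \<in> \<B>"
    and SL2_D: "carrier SL2 \<subseteq> D" and det_D: "\<And>A. A \<in> D \<Longrightarrow> det A \<noteq> 0"
    and mult_D: "\<And>A A'. A \<in> D \<Longrightarrow> A' \<in> D \<Longrightarrow> A ** A' \<in> D"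
    and inv_D: "\<And>A. A \<in> D \<Longrightarrow> \<exists>A'\<in>D. A ** A' = mat 1"
    and \<theta>_mult: "\<And>A A'. A \<in> D \<Longrightarrow> A' \<in> D \<Longrightarrow> \<theta> (A ** A') = \<theta> A \<otimes>\<^bsub>PSL2\<^esub> \<theta> A'"
    and \<theta>_image: "\<theta> ` D = {g \<in> carrier PSL2. \<phi> g ` B = B}"
    and \<theta>_eq: "\<And>A A'. A \<in> D \<Longrightarrow> A' \<in> D \<Longrightarrow> \<theta> A = \<theta> A' \<longleftrightarrow> (\<exists>c. A = mat c ** A')"
    and CARD_Q: "CARD('b) = Q" and Q_eq: "Q = p ^ j"
begin

abbreviation "fix_x x \<equiv> {g \<in> G\<^sub>b B. \<phi> g x = x}"

lemma \<theta>_closed: "A \<in> D \<Longrightarrow> \<theta> A \<in> G\<^sub>b B" "A \<in> D \<Longrightarrow> \<theta> A \<in> carrier G"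
  using \<theta>_image by blast+

lemma one_D: "mat 1 \<in> D" using SL2_D by (meson one_SL2 subsetD)

lemma \<theta>_one: "\<theta> (mat 1) = \<one>\<^bsub>G\<^esub>"
proof -
  have "\<theta> (mat 1) \<otimes>\<^bsub>G\<^esub> \<theta> (mat 1) = \<theta> (mat 1)" using \<theta>_mult[OF one_D one_D] by simp
  then show ?thesis using \<theta>_closed(2)[OF one_D] by (metis l_cancel_one)
qed

lemma \<theta>_eq_one: "A \<in> D \<Longrightarrow> \<theta> A = \<one>\<^bsub>G\<^esub> \<longleftrightarrow> A \<in> range mat"
  using \<theta>_eq[OF _ one_D, of A] \<theta>_one by auto

lemma \<theta>_act: "A \<in> D \<Longrightarrow> A' \<in> D \<Longrightarrow> x \<in> P \<Longrightarrow> \<phi> (\<theta> (A ** A')) x = \<phi> (\<theta> A) (\<phi> (\<theta> A') x)"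
  by (simp only: \<theta>_mult composition_rule \<theta>_closed)

lemma transvection_D: "transvection v t \<in> D"
  using transvection_SL2 SL2_D by blast

lemma transvection_hom: "(\<lambda>t. \<theta> (transvection v t)) \<in> hom additive_group G"
  using \<theta>_closed(2)[OF transvection_D] \<theta>_mult[OF transvection_D transvection_D, of v _ v]
  by (auto simp: hom_def additive_group_def transvection_add)

lemma transvection_power: "\<theta> (transvection v t) [^]\<^bsub>G\<^esub> (p ^ j) = \<one>\<^bsub>G\<^esub>"
proof -
  have "\<theta> (transvection v t) [^]\<^bsub>G\<^esub> (n::nat) = \<theta> (transvection v (of_nat n * t))" for n
  proof (induction n)
    case 0
    show ?case by (simp add: \<theta>_one transvection_zero)
  next
    case (Suc n)
    then show ?case
      using \<theta>_mult[OF transvection_D transvection_D, of v "of_nat n * t" v t] by (simp add: transvection_add algebra_simps)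
  qed
  from this[of "p ^ j"] have "\<theta> (transvection v t) [^]\<^bsub>G\<^esub> (p ^ j) = \<theta> (transvection v (of_nat CARD('b) * t))"
    using CARD_Q Q_eq by simp
  then show ?thesis by (simp add: of_nat_CARD_eq_0 \<theta>_one transvection_zero)
qed

text \<open>The transvections along \<open>v\<close> form the image of a \<open>p\<close>-group and
  so fix a point; by \<open>p_element_two_fixed_points\<close> a single nontrivial one of them fixes
  no other.\<close>

lemma transvection_fixed_point:
  obtains y where "y \<in> P" "\<And>t. \<phi> (\<theta> (transvection v t)) y = y"
    "\<And>t x. t \<noteq> 0 \<Longrightarrow> fst v \<noteq> 0 \<or> snd v \<noteq> 0 \<Longrightarrow> x \<in> P \<Longrightarrow> \<phi> (\<theta> (transvection v t)) x = x \<Longrightarrow> x = y"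
proof -
  have "CARD('b) = p ^ j" using CARD_Q Q_eq by simp
  then obtain y where y: "y \<in> P" "\<And>t. \<phi> (\<theta> (transvection v t)) y = y"
    using additive_hom_fixed_point[OF transvection_hom] by blast
  have "x = y" if t: "t \<noteq> 0" "fst v \<noteq> 0 \<or> snd v \<noteq> 0" "x \<in> P" "\<phi> (\<theta> (transvection v t)) x = x" for t x
  proof (rule ccontr)
    assume "x \<noteq> y"
    then have "\<theta> (transvection v t) = \<one>\<^bsub>G\<^esub>"
      using p_element_two_fixed_points[OF \<theta>_closed(2)[OF transvection_D] transvection_power t(3) y(1) _ t(4) y(2)] by blast
    then have "transvection v t \<in> range mat" using \<theta>_eq_one[OF transvection_D] by blast
    then show False using transvection_scalar[of "fst v" "snd v" t] t by simp
  qed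
  then show thesis using that y by blast
qed

text \<open>Flag-transitivity moves \<open>x\<close> to any other block point by some
  \<open>\<theta> M\<close>, and conjugation by \<open>M\<close> turns the given transvection into
  one fixing that point. So every block point is the fixed point of one of the \<open>Q + 1\<close>
  transvection groups.\<close>

lemma transvection_fixes_block_point:
  assumes x: "x \<in> B" and t: "t \<noteq> 0" "fst v \<noteq> 0 \<or> snd v \<noteq> 0" "\<phi> (\<theta> (transvection v t)) x = x"
  shows "k \<le> Q + 1"
proof -
  have BP: "B \<subseteq> P" using block B by blast
  have "\<exists>y. y \<in> P \<and> (\<forall>t x. t \<noteq> 0 \<longrightarrow> fst r \<noteq> 0 \<or> snd r \<noteq> 0 \<longrightarrow> x \<in> P \<longrightarrow> \<phi> (\<theta> (transvection r t)) x = x \<longrightarrow> x = y)" for r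
    using transvection_fixed_point[of r] by metis
  then obtain y where y: "\<And>r t x. t \<noteq> 0 \<Longrightarrow> fst r \<noteq> 0 \<or> snd r \<noteq> 0 \<Longrightarrow> x \<in> P \<Longrightarrow> \<phi> (\<theta> (transvection r t)) x = x \<Longrightarrow> x = y r"
    by metis
  have "B \<subseteq> y ` line_reps"
  proof
    fix x' assume x': "x' \<in> B"
    obtain g where g: "g \<in> carrier G" "\<phi> g x = x'" "\<phi> g ` B = B" by (rule flag_transE[OF B x B x'])
    then have "g \<in> \<theta> ` D" using \<theta>_image by blast
    then obtain M where M: "M \<in> D" "g = \<theta> M" by blast
    obtain a b where ab: "M *v v2 (fst v) (snd v) = v2 a b" by (rule v2_cases)
    have conj: "M ** transvection v t = transvection (a, b) (t / det M) ** M"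
      using transvection_conj[OF det_D[OF M(1)] ab, of t] by simp
    have nz: "v2 a b \<noteq> 0"
    proof
      assume "v2 a b = 0"
      then have "cross (M *v v2 (fst v) (snd v)) (M *v w) = 0" for w using ab by (simp add: cross_def zero_v2)
      then have "cross (v2 (fst v) (snd v)) w = 0" for w using cross_matrix[of M] det_D[OF M(1)] by simp
      from this[of "v2 0 1"] this[of "v2 1 0"] show False using t(2) by auto
    qed
    obtain r c where r: "r \<in> line_reps" "c \<noteq> 0" "v2 a b = v2 (c * fst r) (c * snd r)" using line_repE[OF nz] .
    have "\<phi> (\<theta> (transvection (a, b) (t / det M))) x' = \<phi> (\<theta> (M ** transvection v t)) x"
      using \<theta>_act[OF transvection_D M(1), of x "(a, b)" "t / det M"] BP x g(2) M(2) conj by auto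
    also have "\<dots> = x'" using \<theta>_act[OF M(1) transvection_D, of x v t] BP x t(3) g(2) M(2) by auto
    finally have "\<phi> (\<theta> (transvection r (c * c * (t / det M)))) x' = x'"
      using r(3) transvection_scale[of c "fst r" "snd r" "t / det M"] by simp
    moreover have "c * c * (t / det M) \<noteq> 0" using r(2) t(1) det_D[OF M(1)] by simp
    moreover have "fst r \<noteq> 0 \<or> snd r \<noteq> 0" using r(1) by (auto simp: line_reps_def)
    ultimately have "x' = y r" using y x' BP by blast
    then show "x' \<in> y ` line_reps" using r(1) by blast
  qed
  then have "card B \<le> card (y ` line_reps)" by (rule card_mono[rotated]) simp
  also have "\<dots> \<le> card (line_reps :: ('b \<times> 'b) set)" by (rule card_image_le) simp
  finally show ?thesis using block(2)[OF B] by (simp add: card_line_reps CARD_Q)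
qed

text \<open>A repeated eigenvalue makes \<open>M\<close> a scalar times a transvection. With two
  different eigenvalues \<open>M\<close> normalizes the transvection groups along both eigenlines
  and hence fixes their two points; as \<open>\<theta> M\<close> has no third fixed point,
  \<open>x\<close> is one of them. Either way a transvection fixes \<open>x\<close>.\<close>

lemma no_eigenvector:
  assumes x: "x \<in> B" and M: "M \<in> D" "M \<notin> range mat" "\<phi> (\<theta> M) x = x" and v: "v \<noteq> 0" "M *v v = a *s v"
  shows "k \<le> Q + 1"
proof -
  have xP: "x \<in> P" using block B x by blast
  obtain v1 v2' where v': "v = v2 v1 v2'" by (rule v2_cases)
  have vnz: "v1 \<noteq> 0 \<or> v2' \<noteq> 0" using v(1) v' by (auto simp: zero_v2)
  obtain w where w: "cross v w \<noteq> 0"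
  proof -
    have "cross v (v2 0 1) \<noteq> 0 \<or> cross v (v2 1 0) \<noteq> 0" using vnz v' by auto
    then show thesis using that by blast
  qed
  obtain r b where rb: "M *v w = r *s v + b *s w" using basis_decomposition[OF w] .
  then have "det M = a * b" using v(2) w by (intro det_eq_eigenvalues[of M v a w b r]) (auto simp: add.commute)
  then have ab: "a \<noteq> 0" "b \<noteq> 0" using det_D[OF M(1)] by auto
  show ?thesis
  proof (cases "a = b")
    case True
    define t where "t = r / (a * cross v w)"
    have Mt: "M = mat a ** transvection (v1, v2') t"
    proof (rule matrix_eq_on_basis[OF _ _ w])
      show "M *v v = mat a ** transvection (v1, v2') t *v v"
        using v(2) by (simp add: matrix_vector_mul_assoc[symmetric] mat_mult_vector transvection_apply v'[symmetric])
      have "a * (t * cross v w) = r" using ab w by (simp add: t_def)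
      then show "M *v w = mat a ** transvection (v1, v2') t *v w"
        using rb True by (simp add: matrix_vector_mul_assoc[symmetric] mat_mult_vector transvection_apply v'[symmetric]
            vector_add_ldistrib vector_smult_assoc add.commute)
    qed
    have "t \<noteq> 0"
    proof
      assume "t = 0"
      then have "M = mat a" using Mt by (simp add: transvection_zero)
      then show False using M(2) by blast
    qed
    moreover have "\<theta> M = \<theta> (transvection (v1, v2') t)" using \<theta>_eq[OF M(1) transvection_D] Mt by blast
    ultimately show ?thesis using transvection_fixes_block_point[OF x, of t "(v1, v2')"] M(3) vnz by simp
  next
    case False
    \<comment> \<open>\<open>e\<close> is chosen so that \<open>w + e *s v\<close> is an eigenvector
      for \<open>b\<close>.\<close>
    define e where "e = r / (b - a)"
    define u where "u = w + e *s v"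
    have Mu: "M *v u = b *s u"
    proof -
      have e: "r + e * a = b * e" using False by (simp add: e_def field_simps)
      have "M *v u = (r + e * a) *s v + b *s w"
        unfolding u_def by (simp add: matrix_vector_right_distrib vec.scale rb v(2) vector_smult_assoc vector_sadd_rdistrib add_ac)
      also have "\<dots> = b *s u" unfolding e u_def by (simp add: vector_add_ldistrib vector_smult_assoc add.commute)
      finally show ?thesis .
    qed
    have vu: "cross v u \<noteq> 0" using w by (simp add: u_def cross_def algebra_simps)
    obtain u1 u2 where u': "u = v2 u1 u2" by (rule v2_cases)
    have unz: "u1 \<noteq> 0 \<or> u2 \<noteq> 0" using vu u' by (auto simp: cross_def)
    have fixes_line_point: "\<phi> (\<theta> M) y = y"
      if e: "M *v v2 e1 e2 = c *s v2 e1 e2" "e1 \<noteq> 0 \<or> e2 \<noteq> 0" "c \<noteq> 0"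
        and y: "y \<in> P" "\<And>t. \<phi> (\<theta> (transvection (e1, e2) t)) y = y"
          "\<And>t x. t \<noteq> 0 \<Longrightarrow> fst (e1, e2) \<noteq> 0 \<or> snd (e1, e2) \<noteq> 0 \<Longrightarrow> x \<in> P \<Longrightarrow> \<phi> (\<theta> (transvection (e1, e2) t)) x = x \<Longrightarrow> x = y"
      for e1 e2 c y
    proof -
      let ?s = "c * c * (1 / det M)"
      have "M *v v2 e1 e2 = v2 (c * e1) (c * e2)" using e(1) by simp
      from transvection_conj[OF det_D[OF M(1)] this, of 1]
      have conj: "M ** transvection (e1, e2) 1 = transvection (e1, e2) ?s ** M" by (simp only: transvection_scale)
      have "\<phi> (\<theta> (transvection (e1, e2) ?s)) (\<phi> (\<theta> M) y) = \<phi> (\<theta> M) (\<phi> (\<theta> (transvection (e1, e2) 1)) y)"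
        using \<theta>_act[OF transvection_D M(1) y(1), of "(e1, e2)" ?s] \<theta>_act[OF M(1) transvection_D y(1), of "(e1, e2)" 1] conj by simp
      then have fixed: "\<phi> (\<theta> (transvection (e1, e2) ?s)) (\<phi> (\<theta> M) y) = \<phi> (\<theta> M) y" using y(2) by simp
      have nz: "?s \<noteq> 0" "fst (e1, e2) \<noteq> 0 \<or> snd (e1, e2) \<noteq> 0" using e det_D[OF M(1)] by simp_all
      show ?thesis by (rule y(3)[OF nz act_closed[OF \<theta>_closed(2)[OF M(1)] y(1)] fixed])
    qed
    obtain y where y: "y \<in> P" "\<And>t. \<phi> (\<theta> (transvection (v1, v2') t)) y = y"
          "\<And>t x. t \<noteq> 0 \<Longrightarrow> fst (v1, v2') \<noteq> 0 \<or> snd (v1, v2') \<noteq> 0 \<Longrightarrow> x \<in> P \<Longrightarrow> \<phi> (\<theta> (transvection (v1, v2') t)) x = x \<Longrightarrow> x = y"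
      by (rule transvection_fixed_point[of "(v1, v2')"]) blast
    obtain z where z: "z \<in> P" "\<And>t. \<phi> (\<theta> (transvection (u1, u2) t)) z = z"
          "\<And>t x. t \<noteq> 0 \<Longrightarrow> fst (u1, u2) \<noteq> 0 \<or> snd (u1, u2) \<noteq> 0 \<Longrightarrow> x \<in> P \<Longrightarrow> \<phi> (\<theta> (transvection (u1, u2) t)) x = x \<Longrightarrow> x = z"
      by (rule transvection_fixed_point[of "(u1, u2)"]) blast
    have My: "\<phi> (\<theta> M) y = y" by (rule fixes_line_point[OF _ vnz ab(1) y]) (use v(2) v' in simp)
    have Mz: "\<phi> (\<theta> M) z = z" by (rule fixes_line_point[OF _ unz ab(2) z]) (use Mu u' in simp)
    \<comment> \<open>Otherwise transvections along two different lines would have a common fixed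
      point and, being \<open>p\<close>-elements, commute up to a scalar; evaluating both products
      on \<open>v\<close> forces \<open>?d = 0\<close>.\<close>
    have "y \<noteq> z"
    proof
      assume "y = z"
      then have "\<theta> (transvection (v1, v2') 1) \<otimes>\<^bsub>G\<^esub> \<theta> (transvection (u1, u2) 1) = \<theta> (transvection (u1, u2) 1) \<otimes>\<^bsub>G\<^esub> \<theta> (transvection (v1, v2') 1)"
        using p_elements_common_fixed_point_commute[OF \<theta>_closed(2)[OF transvection_D] transvection_power \<theta>_closed(2)[OF transvection_D] transvection_power y(1) y(2)] z(2) by blast
      then have "\<theta> (transvection (v1, v2') 1 ** transvection (u1, u2) 1) = \<theta> (transvection (u1, u2) 1 ** transvection (v1, v2') 1)"
        by (simp only: \<theta>_mult transvection_D)
      then obtain c where c: "transvection (v1, v2') 1 ** transvection (u1, u2) 1 = mat c ** (transvection (u1, u2) 1 ** transvection (v1, v2') 1)"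
        using \<theta>_eq[OF mult_D[OF transvection_D transvection_D] mult_D[OF transvection_D transvection_D]] by blast
      let ?d = "cross u v"
      have sgn: "cross v u = - ?d" by (simp add: cross_def)
      have "transvection (v1, v2') 1 ** transvection (u1, u2) 1 *v v = (1 - ?d * ?d) *s v + ?d *s u"
        unfolding matrix_vector_mul_assoc[symmetric] transvection_apply u'[symmetric] v'[symmetric]
        by (simp add: vec_eq_iff cross_def algebra_simps)
      moreover have "mat c ** (transvection (u1, u2) 1 ** transvection (v1, v2') 1) *v v = c *s v + (c * ?d) *s u"
        unfolding matrix_vector_mul_assoc[symmetric] transvection_apply u'[symmetric] v'[symmetric] mat_mult_vector
        by (simp add: vec_eq_iff cross_def algebra_simps)
      ultimately have eq: "(1 - ?d * ?d) *s v + ?d *s u = c *s v + (c * ?d) *s u" using c by simp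
      have "cross v ((1 - ?d * ?d) *s v + ?d *s u) = ?d * cross v u" "cross v (c *s v + (c * ?d) *s u) = c * ?d * cross v u"
        "cross ((1 - ?d * ?d) *s v + ?d *s u) u = (1 - ?d * ?d) * cross v u" "cross (c *s v + (c * ?d) *s u) u = c * cross v u"
        by (simp_all add: cross_def algebra_simps)
      then have "?d = c * ?d" "1 - ?d * ?d = c" using eq vu by auto
      moreover have "?d \<noteq> 0" using vu sgn by simp
      ultimately show False by auto
    qed
    have "\<theta> M \<noteq> \<one>\<^bsub>G\<^esub>" using \<theta>_eq_one[OF M(1)] M(2) by blast
    then have "x = y \<or> x = z"
      using three_fixed_points[OF \<theta>_closed(2)[OF M(1)] xP y(1) z(1) _ _ \<open>y \<noteq> z\<close> M(3) My Mz] by blast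
    then show ?thesis
    proof
      assume "x = y"
      then show ?thesis using transvection_fixes_block_point[OF x, of 1 "(v1, v2')"] y(2) vnz by simp
    next
      assume "x = z"
      then show ?thesis using transvection_fixes_block_point[OF x, of 1 "(u1, u2)"] z(2) unz by simp
    qed
  qed
qed

end

context linear_stabilizer
begin

lemma fix_subgroup: "x \<in> B \<Longrightarrow> subgroup (fix_x x) G"
proof -
  assume "x \<in> B"
  then have x: "x \<in> P" using block B by blast
  have "fix_x x = G\<^sub>b B \<inter> {g \<in> carrier G. \<phi> g x = x}" by auto
  then show ?thesis
    using subgroups_Inter_pair[OF subgroup_block_stabilizer[OF B] subgroup_point_stabilizer[OF x]] by simp
qed

lemma lift_exists:
  assumes "g \<in> fix_x x"
  obtains A where "A \<in> D" "\<theta> A = g"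
proof -
  have "g \<in> G\<^sub>b B" using assms by simp
  then have "g \<in> \<theta> ` D" by (simp only: \<theta>_image)
  then show thesis using that by blast
qed

text \<open>By \<open>no_eigenvector\<close> the point stabilizer acts semiregularly on the \<open>Q + 1\<close> lines of the plane.\<close>

lemma card_fix_dvd:
  assumes x: "x \<in> B" and big: "k > Q + 1"
  shows "card (fix_x x) dvd Q + 1"
proof -
  have ex: "\<exists>A. A \<in> D \<and> \<theta> A = g" if "g \<in> fix_x x" for g
    by (rule lift_exists[OF that]) blast
  \<comment> \<open>A lift of a product is the product of the lifts only up to a scalar, which is
    invisible on lines.\<close>
  define lift where "lift g = (SOME A. A \<in> D \<and> \<theta> A = g)" for g
  have lift: "lift g \<in> D \<and> \<theta> (lift g) = g" if "g \<in> fix_x x" for g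
    unfolding lift_def by (rule someI_ex) (rule ex[OF that])
  let ?H = "G\<lparr>carrier := fix_x x\<rparr>"
  have H: "group ?H" using fix_subgroup[OF x] by (rule subgroup_imp_group)
  let ?act = "\<lambda>g e. (\<lambda>w. lift g *v w) ` e"
  have nz: "A *v v \<noteq> 0" if "A \<in> D" "v \<noteq> 0" for A and v :: "'b ^ 2"
  proof
    assume 0: "A *v v = 0"
    have "invertible A" using det_D[OF that(1)] by (simp add: invertible_det_nz)
    then obtain A' where "A' ** A = mat 1" by (auto simp: invertible_def)
    then have "v = A' *v (A *v v)" by (simp add: matrix_vector_mul_assoc)
    then show False using 0 that(2) by simp
  qed
  have act_line: "?act g (line v) = line (lift g *v v)" for g v by (rule line_image)
  have "card (carrier ?H) dvd card (lines :: ('b ^ 2) set set)"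
  proof (rule card_dvd_free_action[OF H, where act = ?act])
    show "finite (lines :: ('b ^ 2) set set)" by simp
  next
    fix g e assume g: "g \<in> carrier ?H" and "e \<in> (lines :: ('b ^ 2) set set)"
    then obtain v where v: "v \<noteq> 0" "e = line v" by (auto simp: lines_def)
    have L: "lift g \<in> D" "\<theta> (lift g) = g" using lift g by auto
    show "?act g e \<in> lines" unfolding v(2) act_line using nz[OF L(1) v(1)] by (simp add: lines_def)
    show "?act g e = e \<longleftrightarrow> g = \<one>\<^bsub>?H\<^esub>"
    proof
      assume "?act g e = e"
      then have "line (lift g *v v) = line v" unfolding v(2) act_line .
      moreover have "lift g *v v \<in> line (lift g *v v)" unfolding line_def by (rule range_eqI[of _ _ 1]) simp
      ultimately obtain a where "lift g *v v = a *s v" unfolding line_def by blast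
      then have "lift g \<in> range mat"
        using no_eigenvector[OF x L(1) _ _ v(1), of a] L(2) g big by auto
      then show "g = \<one>\<^bsub>?H\<^esub>" using \<theta>_eq_one[OF L(1)] L(2) by simp
    next
      assume "g = \<one>\<^bsub>?H\<^esub>"
      then have "lift g \<in> range mat" using \<theta>_eq_one[OF L(1)] L(2) by simp
      then obtain c where c: "lift g = mat c" by blast
      then have "c \<noteq> 0" using det_D[OF L(1)] by (auto simp: mat_eq_m2)
      then have "line (lift g *v v) = line v" unfolding c mat_mult_vector by (rule line_scale)
      then show "?act g e = e" unfolding v(2) act_line .
    qed
  next
    fix g h e assume g: "g \<in> carrier ?H" and h: "h \<in> carrier ?H" and "e \<in> (lines :: ('b ^ 2) set set)"
    then obtain v where v: "v \<noteq> 0" "e = line v" by (auto simp: lines_def)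
    have L: "lift g \<in> D" "\<theta> (lift g) = g" "lift h \<in> D" "\<theta> (lift h) = h" using lift g h by auto
    have gh: "g \<otimes>\<^bsub>G\<^esub> h \<in> fix_x x" using group.is_monoid[OF H] g h monoid.m_closed[of ?H g h] by simp
    have "\<theta> (lift (g \<otimes>\<^bsub>G\<^esub> h)) = \<theta> (lift g ** lift h)" using lift[OF gh] \<theta>_mult[OF L(1,3)] L by simp
    then obtain c where c: "lift (g \<otimes>\<^bsub>G\<^esub> h) = mat c ** (lift g ** lift h)"
      using \<theta>_eq[OF _ mult_D[OF L(1,3)]] lift[OF gh] by blast
    have "det (lift (g \<otimes>\<^bsub>G\<^esub> h)) \<noteq> 0" using det_D lift[OF gh] by blast
    then have "c \<noteq> 0" unfolding c by (auto simp: det_mul det_mat2)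
    have "?act (g \<otimes>\<^bsub>?H\<^esub> h) e = line (c *s (lift g *v (lift h *v v)))"
    proof -
      have "?act (g \<otimes>\<^bsub>?H\<^esub> h) e = line (lift (g \<otimes>\<^bsub>G\<^esub> h) *v v)"
        unfolding v(2) act_line by simp
      also have "lift (g \<otimes>\<^bsub>G\<^esub> h) *v v = c *s (lift g *v (lift h *v v))"
        by (simp only: c matrix_vector_mul_assoc[symmetric] mat_mult_vector)
      finally show ?thesis .
    qed
    also have "\<dots> = ?act g (?act h e)" unfolding v(2) act_line by (rule line_scale[OF \<open>c \<noteq> 0\<close>])
    finally show "?act (g \<otimes>\<^bsub>?H\<^esub> h) e = ?act g (?act h e)" .
  qed
  then show ?thesis by (simp add: card_lines CARD_Q)
qed

abbreviation "scalars \<equiv> card (D \<inter> range mat)"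

text \<open>
  The nonzero combinations of \<open>1\<close> and a lift \<open>M\<close> of a stabilizing element commute with \<open>M\<close>, hence
  permute its at most two fixed points.
\<close>

lemma centralizer_bound:
  assumes x: "x \<in> B" and big: "k > Q + 1" and nontriv: "card (fix_x x) \<noteq> 1"
  obtains M where "M \<notin> range mat" "\<forall>a b. (a, b) \<noteq> (0, 0) \<longrightarrow> det (lin M a b) \<noteq> 0"
    "card (D \<inter> {lin M a b | a b. (a, b) \<noteq> (0, 0)}) \<le> 2 * (scalars * card (fix_x x))"
proof -
  have xP: "x \<in> P" using block B x by blast
  have one: "\<one>\<^bsub>G\<^esub> \<in> fix_x x" using subgroup.one_closed[OF fix_subgroup[OF x]] .
  have "fix_x x \<noteq> {\<one>\<^bsub>G\<^esub>}" using nontriv by auto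
  then obtain h where h: "h \<in> fix_x x" "h \<noteq> \<one>\<^bsub>G\<^esub>" using one by blast
  obtain M where M: "M \<in> D" "\<theta> M = h" by (rule lift_exists[OF h(1)])
  have ns: "M \<notin> range mat" using \<theta>_eq_one[OF M(1)] M(2) h(2) by blast
  have hx: "\<phi> h x = x" and hG: "h \<in> carrier G" using h by auto
  have noeig: "M *v v \<noteq> a *s v" if "v \<noteq> 0" for v a
    using no_eigenvector[OF x M(1) ns _ that, of a] M(2) hx big by auto
  \<comment> \<open>A kernel vector of a nonzero combination would be an eigenvector of
    \<open>M\<close>.\<close>
  have det: "det (lin M a b) \<noteq> 0" if ab: "(a, b) \<noteq> (0, 0)" for a b
  proof
    assume 0: "det (lin M a b) = 0"
    obtain v where v: "v \<noteq> 0" "lin M a b *v v = 0" using singular_kernel[OF 0] .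
    have eq: "a *s v + b *s (M *v v) = 0" using v(2) by (simp add: lin_apply)
    show False
    proof (cases "b = 0")
      case True
      then have "a *s v = 0" using eq by simp
      then show False using v(1) ab True by (auto simp: vec.scale_eq_0_iff)
    next
      case False
      have "M *v v = (1 / b) *s (b *s (M *v v))" using False by (simp add: vector_smult_assoc)
      also have "b *s (M *v v) = - (a *s v)" using eq by (simp add: eq_neg_iff_add_eq_0 add.commute)
      also have "(1 / b) *s (- (a *s v)) = (- (a / b)) *s v" by (simp add: vec_eq_iff)
      finally show False using noeig[OF v(1)] by blast
    qed
  qed
  let ?C = "D \<inter> {lin M a b | a b. (a, b) \<noteq> (0, 0)}"
  let ?Cx = "{X \<in> ?C. \<phi> (\<theta> X) x = x}"
  let ?F = "{y \<in> P. \<phi> h y = y}"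
  have F2: "card ?F \<le> 2" using card_fixed_points_le[OF hG h(2)] .
  have fin: "finite ?F" using finite_P by simp
  have commute: "\<phi> (\<theta> X) y \<in> ?F" if X: "X \<in> ?C" and y: "y \<in> ?F" for X y
  proof -
    have XD: "X \<in> D" and XM: "X ** M = M ** X" using X lin_commute by auto
    have yP: "y \<in> P" using y by simp
    have "\<phi> h (\<phi> (\<theta> X) y) = \<phi> (\<theta> (M ** X)) y" using \<theta>_act[OF M(1) XD yP] M(2) by simp
    also have "\<dots> = \<phi> (\<theta> X) (\<phi> h y)" using \<theta>_act[OF XD M(1) yP] M(2) XM by simp
    finally show ?thesis using y act_closed[OF \<theta>_closed(2)[OF XD] yP] by simp
  qed
  have multC: "X ** Y \<in> ?C" if X: "X \<in> ?C" and Y: "Y \<in> ?C" for X Y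
  proof -
    obtain a b a' b' where ab: "X = lin M a b" "Y = lin M a' b'" using X Y by blast
    have D: "X ** Y \<in> D" using mult_D X Y by blast
    obtain c e where ce: "X ** Y = lin M c e" unfolding ab lin_mult by blast
    have "(c, e) \<noteq> (0, 0)"
    proof
      assume "(c, e) = (0, 0)"
      then have "X ** Y = mat 0" using ce by (simp add: lin_zero)
      then have "det (X ** Y) = 0" by (simp only: det_mat2 mult_zero_left)
      then show False using det_D[OF D] by blast
    qed
    then show ?thesis using D ce by blast
  qed
  \<comment> \<open>An element of \<open>?C\<close> that moves \<open>x\<close> exchanges it with a
    second fixed point of \<open>h\<close>. Multiplication by one such element maps all of them
    injectively to elements fixing \<open>x\<close>; this is the factor 2 in the bound.\<close>
  have "card (?C - ?Cx) \<le> card ?Cx"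
  proof (cases "?C - ?Cx = {}")
    case True
    then show ?thesis by (metis card.empty le0)
  next
    case False
    then obtain X0 where X0: "X0 \<in> ?C" "\<phi> (\<theta> X0) x \<noteq> x" by blast
    let ?y = "\<phi> (\<theta> X0) x"
    have xF: "x \<in> ?F" using xP hx by simp
    have yF: "?y \<in> ?F" using commute[OF X0(1) xF] .
    have "card {x, ?y} = 2" using X0(2) by simp
    then have F: "?F = {x, ?y}" using card_seteq[OF fin, of "{x, ?y}"] xF yF F2 by auto
    have X0D: "X0 \<in> D" using X0 by blast
    have "invertible X0" using det_D[OF X0D] by (simp add: invertible_det_nz)
    then obtain X1 where X1: "X1 ** X0 = mat 1" by (auto simp: invertible_def)
    show ?thesis
    proof (rule card_inj_on_le[where f = "\<lambda>X. X0 ** X"])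
      show "inj_on (\<lambda>X. X0 ** X) (?C - ?Cx)"
      proof (rule inj_onI)
        fix X Y assume "X0 ** X = X0 ** Y"
        then have "X1 ** X0 ** X = X1 ** X0 ** Y" by (simp add: matrix_mul_assoc[symmetric])
        then show "X = Y" using X1 by simp
      qed
      show "(\<lambda>X. X0 ** X) ` (?C - ?Cx) \<subseteq> ?Cx"
      proof
        fix Z assume "Z \<in> (\<lambda>X. X0 ** X) ` (?C - ?Cx)"
        then obtain X where X: "X \<in> ?C" "X \<notin> ?Cx" "Z = X0 ** X" by blast
        have XD: "X \<in> D" using X by blast
        have "\<phi> (\<theta> X) x = ?y" using commute[OF X(1) xF] X(1,2) unfolding F by blast
        then have Z: "\<phi> (\<theta> Z) x = \<phi> (\<theta> X0) ?y" using \<theta>_act[OF X0D XD xP] X(3) by simp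
        have yP: "?y \<in> P" using yF by simp
        have "\<phi> (\<theta> X0) ?y \<in> {x, ?y}" using commute[OF X0(1) yF] unfolding F .
        moreover have "\<phi> (\<theta> X0) ?y \<noteq> ?y"
          using inj_onD[OF inj_prop[OF \<theta>_closed(2)[OF X0D]] _ yP xP] X0(2) by blast
        ultimately have "\<phi> (\<theta> Z) x = x" unfolding Z by simp
        then show "Z \<in> ?Cx" using multC[OF X0(1) X(1)] X(3) by blast
      qed
    qed simp
  qed
  moreover have "card ?C = card ?Cx + card (?C - ?Cx)"
    using card_Diff_subset[of ?Cx ?C] card_mono[of ?C ?Cx] by (simp add: subset_iff)
  ultimately have 1: "card ?C \<le> 2 * card ?Cx" by linarith
  \<comment> \<open>Two lifts of the same group element differ by a scalar in
    \<open>D\<close>.\<close>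
  have "card ?Cx \<le> scalars * card (fix_x x)"
  proof (rule card_le_fibres[where f = \<theta>])
    show "finite (fix_x x)" by simp
    show "\<theta> X \<in> fix_x x" if "X \<in> ?Cx" for X using that \<theta>_closed(1)[of X] by simp
    fix g
    show "card {X \<in> ?Cx. \<theta> X = g} \<le> scalars"
    proof (cases "{X \<in> ?Cx. \<theta> X = g} = {}")
      case True
      show ?thesis unfolding True by simp
    next
      case False
      then obtain Y where Y: "Y \<in> D" "\<theta> Y = g" by blast
      obtain Y' where Y': "Y' \<in> D" "Y ** Y' = mat 1" using inv_D[OF Y(1)] by blast
      have "{X \<in> ?Cx. \<theta> X = g} \<subseteq> (\<lambda>Z. Z ** Y) ` (D \<inter> range mat)"
      proof
        fix X assume "X \<in> {X \<in> ?Cx. \<theta> X = g}"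
        then have X: "X \<in> D" "\<theta> X = \<theta> Y" using Y by auto
        then obtain c where c: "X = mat c ** Y" using \<theta>_eq[OF X(1) Y(1)] by blast
        then have "mat c = X ** Y'" using Y'(2) by (simp add: matrix_mul_assoc[symmetric])
        then have "mat c \<in> D" using mult_D[OF X(1) Y'(1)] by simp
        then show "X \<in> (\<lambda>Z. Z ** Y) ` (D \<inter> range mat)" using c by blast
      qed
      then have "card {X \<in> ?Cx. \<theta> X = g} \<le> card ((\<lambda>Z. Z ** Y) ` (D \<inter> range mat))"
        by (rule card_mono[rotated]) simp
      also have "\<dots> \<le> scalars" by (rule card_image_le) simp
      finally show ?thesis .
    qed
  qed
  then have "card ?C \<le> 2 * (scalars * card (fix_x x))" using 1 by linarith
  then show thesis using that[OF ns] det by blast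
qed

end

lemma card_lin:
  fixes M :: "'a::{field,finite} ^ 2 ^ 2"
  assumes "M \<notin> range mat"
  shows "card {lin M a b | a b. (a, b) \<noteq> (0, 0)} = CARD('a) ^ 2 - 1"
proof -
  have eq: "{lin M a b | a b. (a, b) \<noteq> (0, 0)} = (\<lambda>(a, b). lin M a b) ` (UNIV - {(0, 0)})" by auto
  have "inj_on (\<lambda>(a, b). lin M a b) (UNIV - {(0, 0)})"
    using lin_inj[OF _ assms] by (auto simp: inj_on_def)
  then have "card {lin M a b | a b. (a, b) \<noteq> (0, 0)} = card (UNIV - {(0 :: 'a, 0 :: 'a)})"
    unfolding eq by (rule card_image)
  then show ?thesis by (simp add: card_Diff_singleton power2_eq_square)
qed

text \<open>The determinant is the norm of the quadratic extension. It takes at most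
  \<open>CARD('a) - 1\<close> values on \<open>CARD('a) ^ 2 - 1\<close> elements, and each nonempty
  fibre is a translate of the part with determinant 1.\<close>

lemma card_SL2_lin:
  fixes M :: "'a::{field,finite} ^ 2 ^ 2"
  assumes M: "M \<notin> range mat" and det: "\<And>a b. (a, b) \<noteq> (0, 0) \<Longrightarrow> det (lin M a b) \<noteq> 0"
  shows "CARD('a) + 1 \<le> card (carrier SL2 \<inter> {lin M a b | a b. (a, b) \<noteq> (0, 0)})"
proof -
  let ?E = "{lin M a b | a b. (a, b) \<noteq> (0, 0)}"
  let ?n = "card (carrier SL2 \<inter> ?E)"
  have two: "CARD('a) \<ge> 2" by (rule CARD_field_ge_2)
  have "card ?E \<le> ?n * card (UNIV - {0 :: 'a})"
  proof (rule card_le_fibres[where f = det])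
    show "det X \<in> UNIV - {0}" if "X \<in> ?E" for X using that det by auto
    fix c
    show "card {X \<in> ?E. det X = c} \<le> ?n"
    proof (cases "{X \<in> ?E. det X = c} = {}")
      case True
      show ?thesis unfolding True by simp
    next
      case False
      then obtain Y where Y: "Y \<in> ?E" "det Y = c" by blast
      then obtain a b where ab: "Y = lin M a b" "(a, b) \<noteq> (0, 0)" by blast
      obtain a' b' where inv: "lin M a' b' ** Y = mat 1" "Y ** lin M a' b' = mat 1"
        unfolding ab(1) by (rule lin_inverse[OF det[OF ab(2)]])
      show ?thesis
      proof (rule card_inj_on_le[where f = "\<lambda>X. lin M a' b' ** X"])
        show "inj_on (\<lambda>X. lin M a' b' ** X) {X \<in> ?E. det X = c}"
        proof (rule inj_onI)
          fix X Z assume "lin M a' b' ** X = lin M a' b' ** Z"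
          then have "Y ** lin M a' b' ** X = Y ** lin M a' b' ** Z" by (simp add: matrix_mul_assoc[symmetric])
          then show "X = Z" unfolding inv by simp
        qed
        show "(\<lambda>X. lin M a' b' ** X) ` {X \<in> ?E. det X = c} \<subseteq> carrier SL2 \<inter> ?E"
        proof
          fix Z assume "Z \<in> (\<lambda>X. lin M a' b' ** X) ` {X \<in> ?E. det X = c}"
          then obtain X where X: "X \<in> ?E" "det X = c" "Z = lin M a' b' ** X" by blast
          obtain r s where rs: "X = lin M r s" using X(1) by blast
          have "det (lin M a' b') * det Y = 1" using arg_cong[OF inv(1), of det] by (simp add: det_mul)
          then have Z: "det Z = 1" using X(2,3) Y(2) by (simp add: det_mul)
          obtain u w where uw: "Z = lin M u w" unfolding X(3) rs lin_mult by blast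
          have "(u, w) \<noteq> (0, 0)"
          proof
            assume "(u, w) = (0, 0)"
            then have "Z = mat 0" using uw by (simp add: lin_zero)
            then show False using Z by (simp only: det_mat2) simp
          qed
          then show "Z \<in> carrier SL2 \<inter> ?E" using Z uw by (auto simp: SL2_def)
        qed
      qed simp
    qed
  qed simp
  moreover have "card (UNIV - {0 :: 'a}) = CARD('a) - 1" by simp
  moreover have "CARD('a) ^ 2 - 1 = (CARD('a) + 1) * (CARD('a) - 1)"
    by (cases "CARD('a)") (auto simp: power2_eq_square algebra_simps)
  ultimately have "(CARD('a) + 1) * (CARD('a) - 1) \<le> ?n * (CARD('a) - 1)" using card_lin[OF M] by simp
  then show ?thesis using two by (simp only: mult_le_cancel2)
qed

context linear_stabilizer
begin

text \<open>With \<open>D = carrier GL2\<close> the whole torus of order \<open>Q ^ 2 - 1\<close>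
  enters \<open>centralizer_bound\<close>, and the \<open>Q - 1\<close> scalars cancel against
  it.\<close>

lemma card_fix_GL2:
  assumes D: "D = carrier GL2" and x: "x \<in> B" and big: "k > Q + 1"
  shows "card (fix_x x) dvd Q + 1 \<and> (card (fix_x x) = 1 \<or> Q + 1 \<le> 2 * card (fix_x x))"
proof (cases "card (fix_x x) = 1")
  case False
  obtain M where M: "M \<notin> range mat" "\<forall>a b. (a, b) \<noteq> (0, 0) \<longrightarrow> det (lin M a b) \<noteq> 0"
    "card (D \<inter> {lin M a b | a b. (a, b) \<noteq> (0, 0)}) \<le> 2 * (scalars * card (fix_x x))"
    by (rule centralizer_bound[OF x big False])
  have two: "Q \<ge> 2" using CARD_field_ge_2[where 'a = 'b] CARD_Q by simp
  have "D \<inter> {lin M a b | a b. (a, b) \<noteq> (0, 0)} = {lin M a b | a b. (a, b) \<noteq> (0, 0)}"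
    using M(2) unfolding D GL2_def by auto
  then have "Q ^ 2 - 1 \<le> 2 * ((Q - 1) * card (fix_x x))"
    using M(3) card_lin[OF M(1)] card_GL2_scalars[where 'a = 'b] unfolding D CARD_Q by simp
  moreover have "Q ^ 2 - 1 = (Q - 1) * (Q + 1)" by (cases Q) (auto simp: power2_eq_square algebra_simps)
  ultimately have "(Q - 1) * (Q + 1) \<le> (Q - 1) * (2 * card (fix_x x))" by (simp add: ac_simps)
  then have "Q + 1 \<le> 2 * card (fix_x x)" using two by (simp only: mult_le_cancel1)
  then show ?thesis using card_fix_dvd[OF x big] by blast
qed simp

text \<open>With \<open>D = carrier SL2\<close> at least \<open>Q + 1\<close> elements of the torus
  remain, against one scalar for even and two scalars for odd \<open>Q\<close>; hence the constants
  2 and 4.\<close>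

lemma card_fix_SL2:
  assumes D: "D = carrier SL2" and x: "x \<in> B" and big: "k > Q + 1"
  shows "card (fix_x x) dvd Q + 1 \<and> (card (fix_x x) = 1 \<or> Q + 1 \<le> (if even Q then 2 else 4) * card (fix_x x))"
proof (cases "card (fix_x x) = 1")
  case False
  obtain M where M: "M \<notin> range mat" "\<forall>a b. (a, b) \<noteq> (0, 0) \<longrightarrow> det (lin M a b) \<noteq> 0"
    "card (D \<inter> {lin M a b | a b. (a, b) \<noteq> (0, 0)}) \<le> 2 * (scalars * card (fix_x x))"
    by (rule centralizer_bound[OF x big False])
  have "scalars = (if even Q then 1 else 2)"
    using card_SL2_scalars[where 'a = 'b] unfolding D CARD_Q .
  then show ?thesis
    using M(3) card_SL2_lin[OF M(1)] M(2) card_fix_dvd[OF x big] unfolding D CARD_Q by (auto split: if_splits)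
qed simp

end

section \<open>Excluding the subfield groups\<close>

context psl2_design
begin

lemma reduced_parameter_equation:
  assumes "B \<in> \<B>" "x \<in> B"
  shows "(k - 1) * (k - 2) * (k - 3) = l * d * (q - 2) * card {g \<in> G\<^sub>b B. \<phi> g x = x}"
proof -
  have "k * ((k - 1) * (k - 2) * (k - 3)) = k * (l * d * (q - 2) * card {g \<in> G\<^sub>b B. \<phi> g x = x})"
    using parameter_equation[OF assms(1)] card_block_stabilizer[OF assms] by (simp add: ac_simps)
  then show ?thesis using k_gt by simp
qed

lemma subfield_order:
  assumes "Q ^ g = q" "g > 0"
  obtains j where "Q = p ^ j"
proof -
  have "Q dvd p ^ f" using assms q_eq by (metis dvd_power)
  then show thesis using divides_primepow_nat[OF prime_p] that by blast
qed

lemma no_PGL2: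
  assumes B: "B \<in> \<B>" and g: "CARD('b::{field,finite}) ^ g = q" "g > 1"
  shows "\<not> G\<lparr>carrier := G\<^sub>b B\<rparr> \<cong> (PGL2 :: ('b ^ 2 ^ 2) set monoid)"
proof
  let ?K = "PGL2 :: ('b ^ 2 ^ 2) set monoid" and ?Q = "CARD('b)"
  assume iso: "G\<lparr>carrier := G\<^sub>b B\<rparr> \<cong> ?K"
  have two: "?Q \<ge> 2" by (rule CARD_field_ge_2)
  have ord: "order ?K = ?Q ^ 3 - ?Q"
    unfolding order_PGL2 by (simp add: power3_eq_cube power2_eq_square diff_mult_distrib2 mult.assoc)
  have pos: "order ?K > 0"
    unfolding order_PGL2 using two one_less_power[of ?Q 2] by simp
  obtain \<psi> \<sigma> where \<sigma>: "\<sigma> \<in> hom ?K G" "inj_on \<sigma> (carrier ?K)" "\<sigma> ` carrier ?K \<subseteq> G\<^sub>b B"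
      and card: "card (G\<^sub>b B) = order ?K"
    by (rule block_stabilizer_embedding[OF B iso group_PGL2 refl pos])
  obtain j where j: "?Q = p ^ j" using subfield_order[OF g(1)] g(2) by auto
  have in_K: "A \<in> carrier GL2 \<Longrightarrow> pgl A \<in> carrier ?K" for A by (simp add: carrier_PGL2)
  interpret linear_stabilizer P \<B> \<phi> p f q k l "carrier (GL2 :: ('b ^ 2 ^ 2) monoid)" "\<sigma> \<circ> pgl" B j ?Q
  proof
    show "carrier SL2 \<subseteq> carrier (GL2 :: ('b ^ 2 ^ 2) monoid)" by (auto simp: SL2_def GL2_def)
    show "det A \<noteq> 0" if "A \<in> carrier GL2" for A :: "'b ^ 2 ^ 2" using that by (simp add: GL2_def)
    show "A ** A' \<in> carrier GL2" if "A \<in> carrier GL2" "A' \<in> carrier GL2" for A A' :: "'b ^ 2 ^ 2"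
      using that by (simp add: GL2_def det_mul)
    show "\<exists>A'\<in>carrier GL2. A ** A' = mat 1" if "A \<in> carrier GL2" for A :: "'b ^ 2 ^ 2"
      using group.r_inv_ex[OF group_GL2 that] by (simp add: GL2_def)
    show "(\<sigma> \<circ> pgl) (A ** A') = (\<sigma> \<circ> pgl) A \<otimes>\<^bsub>PSL2\<^esub> (\<sigma> \<circ> pgl) A'"
      if "A \<in> carrier GL2" "A' \<in> carrier GL2" for A A' :: "'b ^ 2 ^ 2"
      using hom_mult[OF pgl_hom that] hom_mult[OF \<sigma>(1) in_K[OF that(1)] in_K[OF that(2)]] by (simp add: GL2_def)
    have "card (G\<^sub>b B) > 0" unfolding card by (rule pos)
    then have "finite (G\<^sub>b B)" by (rule card_ge_0_finite)
    moreover have "card (\<sigma> ` carrier ?K) = card (G\<^sub>b B)" using card_image[OF \<sigma>(2)] card by (simp add: order_def)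
    ultimately have "\<sigma> ` carrier ?K = G\<^sub>b B" using \<sigma>(3) by (intro card_subset_eq)
    then show "(\<sigma> \<circ> pgl) ` carrier GL2 = G\<^sub>b B" by (simp only: carrier_PGL2 image_comp)
    show "(\<sigma> \<circ> pgl) A = (\<sigma> \<circ> pgl) A' \<longleftrightarrow> (\<exists>c. A = mat c ** A')"
      if "A \<in> carrier GL2" "A' \<in> carrier GL2" for A A' :: "'b ^ 2 ^ 2"
      using inj_on_eq_iff[OF \<sigma>(2) in_K[OF that(1)] in_K[OF that(2)]] pgl_eq_iff[OF that] by simp
  qed (fact B refl j)+
  obtain x where x: "x \<in> B" using block_nonempty[OF B] ..
  show False
  proof (rule family_full[of ?Q g k "card (fix_x x)" "l * d"])
    show "k * card (fix_x x) = ?Q ^ 3 - ?Q" using card_block_stabilizer[OF B x] card ord by simp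
    show "(k - 1) * (k - 2) * (k - 3) = l * d * (?Q ^ g - 2) * card (fix_x x)"
      unfolding g(1) by (rule reduced_parameter_equation[OF B x])
    show "11 \<le> l * d" using l_gt by (simp add: d_def)
    show "card (fix_x x) dvd ?Q + 1 \<and> (card (fix_x x) = 1 \<or> ?Q + 1 \<le> 2 * card (fix_x x))" if "k > ?Q + 1"
      using card_fix_GL2[OF refl x that] .
  qed (use two g k_le k_gt in auto)
qed

lemma no_PSL2:
  assumes B: "B \<in> \<B>" and g: "CARD('b::{field,finite}) ^ g = q"
  shows "\<not> G\<lparr>carrier := G\<^sub>b B\<rparr> \<cong> (PSL2 :: ('b ^ 2 ^ 2) set monoid)"
proof
  let ?K = "PSL2 :: ('b ^ 2 ^ 2) set monoid" and ?Q = "CARD('b)"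
  assume iso: "G\<lparr>carrier := G\<^sub>b B\<rparr> \<cong> ?K"
  have two: "?Q \<ge> 2" by (rule CARD_field_ge_2)
  have g0: "g > 0" using g q_ge by (cases g) auto
  \<comment> \<open>The same \<open>d\<close> serves both field orders, since they have the same
    parity.\<close>
  have even: "even ?Q \<longleftrightarrow> even q" using g g0 by (simp flip: g)
  have ord: "order ?K * d = ?Q ^ 3 - ?Q"
    using order_PSL2[where 'a = 'b] even unfolding d_def
    by (simp add: power3_eq_cube power2_eq_square diff_mult_distrib2 mult.assoc)
  have "?Q ^ 3 > ?Q" using two power_strict_increasing[of 1 3 ?Q] by simp
  then have pos: "order ?K > 0" using ord by (cases "order ?K") auto
  obtain \<psi> \<sigma> where \<sigma>: "\<sigma> \<in> hom ?K G" "inj_on \<sigma> (carrier ?K)" "\<sigma> ` carrier ?K \<subseteq> G\<^sub>b B"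
      and card: "card (G\<^sub>b B) = order ?K"
    by (rule block_stabilizer_embedding[OF B iso group_PSL2 refl pos])
  \<comment> \<open>For \<open>g = 1\<close> the stabilizer has the order of the whole group. Then
    \<open>11 * (q + 1) * q * (q - 1) * (q - 2)\<close> would be at most
    \<open>k * (k - 1) * (k - 2) * (k - 3)\<close>, which is impossible for
    \<open>k \<le> q\<close>.\<close>
  have g2: "g \<ge> 2"
  proof (rule ccontr)
    assume "\<not> g \<ge> 2"
    then have "?Q = q" using g g0 by (cases "g = 1") auto
    then have eq: "k * (k - 1) * (k - 2) * (k - 3) = l * (q - 2) * (q ^ 3 - q)"
      using parameter_equation[OF B] card ord by (metis (no_types, lifting) mult.assoc mult.commute)
    have "q ^ 3 - q = (q + 1) * (q * (q - 1))" by (cases q) (auto simp: power3_eq_cube algebra_simps)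
    then have "11 * ((q + 1) * (q * (q - 1) * (q - 2))) \<le> l * ((q + 1) * (q * (q - 1) * (q - 2)))"
      using l_gt by (intro mult_right_mono) auto
    also have "\<dots> = k * (k - 1) * (k - 2) * (k - 3)"
      unfolding eq \<open>q ^ 3 - q = (q + 1) * (q * (q - 1))\<close> by (simp only: ac_simps)
    also have "\<dots> \<le> q * (q - 1) * (q - 2) * (q + 1)" using k_le by (intro mult_mono) auto
    finally have "11 * ((q + 1) * (q * (q - 1) * (q - 2))) \<le> 1 * ((q + 1) * (q * (q - 1) * (q - 2)))"
      by (simp add: ac_simps)
    then show False using q_ge by (simp only: mult_le_cancel2) simp
  qed
  obtain j where j: "?Q = p ^ j" using subfield_order[OF g g0] by auto
  have in_K: "A \<in> carrier SL2 \<Longrightarrow> psl A \<in> carrier ?K" for A by (simp add: carrier_PSL2)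
  interpret linear_stabilizer P \<B> \<phi> p f q k l "carrier (SL2 :: ('b ^ 2 ^ 2) monoid)" "\<sigma> \<circ> psl" B j ?Q
  proof
    show "carrier SL2 \<subseteq> carrier (SL2 :: ('b ^ 2 ^ 2) monoid)" ..
    show "det A \<noteq> 0" if "A \<in> carrier SL2" for A :: "'b ^ 2 ^ 2" using that by (simp add: SL2_def)
    show "A ** A' \<in> carrier SL2" if "A \<in> carrier SL2" "A' \<in> carrier SL2" for A A' :: "'b ^ 2 ^ 2"
      using that by (simp add: SL2_def det_mul)
    show "\<exists>A'\<in>carrier SL2. A ** A' = mat 1" if "A \<in> carrier SL2" for A :: "'b ^ 2 ^ 2"
      using group.r_inv_ex[OF group_SL2 that] by (simp add: SL2_def)
    show "(\<sigma> \<circ> psl) (A ** A') = (\<sigma> \<circ> psl) A \<otimes>\<^bsub>PSL2\<^esub> (\<sigma> \<circ> psl) A'"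
      if "A \<in> carrier SL2" "A' \<in> carrier SL2" for A A' :: "'b ^ 2 ^ 2"
      using hom_mult[OF psl_hom that] hom_mult[OF \<sigma>(1) in_K[OF that(1)] in_K[OF that(2)]] by (simp add: SL2_def)
    have "card (G\<^sub>b B) > 0" unfolding card by (rule pos)
    then have "finite (G\<^sub>b B)" by (rule card_ge_0_finite)
    moreover have "card (\<sigma> ` carrier ?K) = card (G\<^sub>b B)" using card_image[OF \<sigma>(2)] card by (simp add: order_def)
    ultimately have "\<sigma> ` carrier ?K = G\<^sub>b B" using \<sigma>(3) by (intro card_subset_eq)
    then show "(\<sigma> \<circ> psl) ` carrier SL2 = G\<^sub>b B" by (simp only: carrier_PSL2 image_comp)
    show "(\<sigma> \<circ> psl) A = (\<sigma> \<circ> psl) A' \<longleftrightarrow> (\<exists>c. A = mat c ** A')"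
      if "A \<in> carrier SL2" "A' \<in> carrier SL2" for A A' :: "'b ^ 2 ^ 2"
      using inj_on_eq_iff[OF \<sigma>(2) in_K[OF that(1)] in_K[OF that(2)]] psl_eq_iff[OF that] by simp
  qed (fact B refl j)+
  obtain x where x: "x \<in> B" using block_nonempty[OF B] ..
  have km: "k * card (fix_x x) * d = ?Q ^ 3 - ?Q" using card_block_stabilizer[OF B x] card ord by simp
  have eq: "(k - 1) * (k - 2) * (k - 3) = l * d * (?Q ^ g - 2) * card (fix_x x)"
    unfolding g by (rule reduced_parameter_equation[OF B x])
  show False
  proof (cases "even q")
    case True
    then have d: "d = 1" by (simp add: d_def)
    show False
    proof (rule family_full[of ?Q g k "card (fix_x x)" l])
      show "card (fix_x x) dvd ?Q + 1 \<and> (card (fix_x x) = 1 \<or> ?Q + 1 \<le> 2 * card (fix_x x))" if "k > ?Q + 1"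
        using card_fix_SL2[OF refl x that] True even by simp
    qed (use two g g2 k_le k_gt l_gt km eq d in auto)
  next
    case False
    then have d: "d = 2" by (simp add: d_def)
    show False
    proof (rule family_half[of ?Q g k "card (fix_x x)" l])
      show "card (fix_x x) dvd ?Q + 1 \<and> (card (fix_x x) = 1 \<or> ?Q + 1 \<le> 4 * card (fix_x x))" if "k > ?Q + 1"
        using card_fix_SL2[OF refl x that] False even by simp
      show "2 * (k * card (fix_x x)) = ?Q ^ 3 - ?Q" using km d by simp
      show "(k - 1) * (k - 2) * (k - 3) = 2 * l * (?Q ^ g - 2) * card (fix_x x)" using eq d by (simp add: ac_simps)
    qed (use two g g2 k_le k_gt l_gt False even in auto)
  qed
qed

end

theorem theorem1p2:
  fixes p f q k l :: nat
  assumes "prime p" and "q = p ^ f" and "q \<ge> 4"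
    and "CARD('a::{field, finite}) = q"
    and "l > 10" and "q + 1 > k" and "k > 4"
  shows "\<not> (\<exists>(P :: 'p set) \<B> \<phi> B.
           t_design 4 (q + 1) k l P \<B> \<and>
           acts_by_automorphisms (PSL2 :: ('a ^ 2 ^ 2) set monoid) P \<B> \<phi> \<and>
           flag_transitive (PSL2 :: ('a ^ 2 ^ 2) set monoid) \<B> \<phi> \<and>
           B \<in> \<B> \<and>
           (let G\<^sub>B = setwise_stabilizer (PSL2 :: ('a ^ 2 ^ 2) set monoid) \<phi> B in
              G\<^sub>B \<cong> alt_group 4 \<or>
              G\<^sub>B \<cong> sym_group 4 \<or>
              G\<^sub>B \<cong> alt_group 5 \<or>
              (\<exists>g > 1. even g \<and> CARD('b::{field, finite}) ^ g = q \<and>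
                 G\<^sub>B \<cong> (PGL2 :: ('b ^ 2 ^ 2) set monoid)) \<or>
              (\<exists>g. CARD('b) ^ g = q \<and>
                 G\<^sub>B \<cong> (PSL2 :: ('b ^ 2 ^ 2) set monoid))))"
proof (rule notI, elim exE conjE)
  fix P :: "'p set" and \<B> and \<phi> :: "('a ^ 2 ^ 2) set \<Rightarrow> 'p \<Rightarrow> 'p" and B
  assume design: "t_design 4 (q + 1) k l P \<B>" "acts_by_automorphisms (PSL2 :: ('a ^ 2 ^ 2) set monoid) P \<B> \<phi>"
    "flag_transitive (PSL2 :: ('a ^ 2 ^ 2) set monoid) \<B> \<phi>"
    and B: "B \<in> \<B>"
    and types: "let G\<^sub>B = setwise_stabilizer (PSL2 :: ('a ^ 2 ^ 2) set monoid) \<phi> B in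
              G\<^sub>B \<cong> alt_group 4 \<or>
              G\<^sub>B \<cong> sym_group 4 \<or>
              G\<^sub>B \<cong> alt_group 5 \<or>
              (\<exists>g > 1. even g \<and> CARD('b) ^ g = q \<and>
                 G\<^sub>B \<cong> (PGL2 :: ('b ^ 2 ^ 2) set monoid)) \<or>
              (\<exists>g. CARD('b) ^ g = q \<and>
                 G\<^sub>B \<cong> (PSL2 :: ('b ^ 2 ^ 2) set monoid))"
  interpret psl2_design P \<B> \<phi> p f q k l
    using design assms by unfold_locales auto
  have "setwise_stabilizer G \<phi> B = G\<lparr>carrier := G\<^sub>b B\<rparr>"
    by (simp add: setwise_stabilizer_def stabilizer_def)
  then show False
    using types no_alt_4[OF B] no_sym_4[OF B] no_alt_5[OF B] no_PGL2[OF B, where 'b = 'b] no_PSL2[OF B, where 'b = 'b]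
    unfolding Let_def by auto
qed

end
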